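(* Let $K,L$ be compact Hausdorff spaces with $L$ extremally disconnected, and let $T:C(K)\to C(L)$ be a bounded linear operator. Then there exists a weakly compact operator $W:C(K)\to C(L)$ such that $$\|T^*\|_w=\|T\|_w=\|T-W\|.$$
   Context: Scalars are real or complex. An operator between Banach spaces is weakly compact if the image of the unit ball is relatively weakly compact. For an operator $R:E\to F$ between Banach spaces, the weak essential norm is $\|R\|_w=\inf\{\|R-W\|: W:E\to F\text{ weakly compact}\}$; thus $\|T^*\|_w$ is the distance from $T^*:C(L)^*\to C(K)^*$ to the weakly compact operators $C(L)^*\to C(K)^*$. A topological space is extremally disconnected if the closure of every open set is open. *)

theory Defs
  imports "HOL-Analysis.Analysis"
begin

text \<open>
  Scalars.  The library's normed spaces are real. A normed space over a field \<open>'k\<close> (instantiated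
  in the end with \<^typ>\<open>real\<close> and with \<^typ>\<open>complex\<close>) is represented by a type of class
  \<open>real_normed_vector\<close> together with a scalar multiplication \<open>s :: 'k \<Rightarrow> 'e \<Rightarrow> 'e\<close>; a bounded
  operator over \<open>'k\<close> is a \<^typ>\<open>'e::real_normed_vector \<Rightarrow>\<^sub>L 'f::real_normed_vector\<close> that satisfies
  the library predicate \<open>Vector_Spaces.linear s s'\<close>.  The operator norm does not depend on the
  scalar field.
\<close>

definition extremally_disconnected :: "'a topology \<Rightarrow> bool" where
  "extremally_disconnected X \<longleftrightarrow> (\<forall>U. openin X U \<longrightarrow> openin X (X closure_of U))"


section \<open>Weak compactness\<close>

definition weak_topology ::
    "('k::real_normed_field \<Rightarrow> 'e::real_normed_vector \<Rightarrow> 'e) \<Rightarrow> 'e topology" where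
  "weak_topology s = topology_generated_by
     {blinfun_apply \<phi> -` U | (\<phi> :: 'e \<Rightarrow>\<^sub>L 'k) U. Vector_Spaces.linear s (*) \<phi> \<and> open U}"

lemma vector_space_over_itself: "vector_space ((*) :: 'k::field \<Rightarrow> 'k \<Rightarrow> 'k)"
  by standard (simp_all add: algebra_simps)

lemma topspace_weak_topology:
  fixes s :: "'k::real_normed_field \<Rightarrow> 'e::real_normed_vector \<Rightarrow> 'e"
  assumes "vector_space s"
  shows "topspace (weak_topology s) = UNIV"
proof -
  interpret V: vector_space_pair s "(*) :: 'k \<Rightarrow> 'k \<Rightarrow> 'k"
    using assms by (simp add: vector_space_pair_def vector_space_over_itself)
  have "Vector_Spaces.linear s (*) (blinfun_apply (0 :: 'e \<Rightarrow>\<^sub>L 'k))"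
    by (simp add: zero_blinfun.rep_eq V.linear_zero)
  then have "\<exists>(\<phi> :: 'e \<Rightarrow>\<^sub>L 'k) U. UNIV = blinfun_apply \<phi> -` U \<and>
      Vector_Spaces.linear s (*) \<phi> \<and> open U"
    by (intro exI[of _ 0] exI[of _ UNIV]) simp
  then show ?thesis
    unfolding weak_topology_def topology_generated_by_topspace by blast
qed

definition weakly_compact_op ::
    "('k::real_normed_field \<Rightarrow> 'e::real_normed_vector \<Rightarrow> 'e) \<Rightarrow>
     ('k \<Rightarrow> 'f::real_normed_vector \<Rightarrow> 'f) \<Rightarrow> ('e \<Rightarrow>\<^sub>L 'f) \<Rightarrow> bool" where
  "weakly_compact_op s s' R \<longleftrightarrow>
     Vector_Spaces.linear s s' R \<and>
     compactin (weak_topology s') (weak_topology s' closure_of (R ` cball 0 1))"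

definition weak_ess_norm ::
    "('k::real_normed_field \<Rightarrow> 'e::real_normed_vector \<Rightarrow> 'e) \<Rightarrow>
     ('k \<Rightarrow> 'f::real_normed_vector \<Rightarrow> 'f) \<Rightarrow> ('e \<Rightarrow>\<^sub>L 'f) \<Rightarrow> real" where
  "weak_ess_norm s s' R = Inf {norm (R - W) | W. weakly_compact_op s s' W}"

lemma weakly_compact_op_zero:
  fixes s :: "'k::real_normed_field \<Rightarrow> 'e::real_normed_vector \<Rightarrow> 'e"
    and s' :: "'k \<Rightarrow> 'f::real_normed_vector \<Rightarrow> 'f"
  assumes "vector_space s" "vector_space s'"
  shows "weakly_compact_op s s' 0"
proof -
  interpret V: vector_space_pair s s'
    using assms by (simp add: vector_space_pair_def)
  interpret W: vector_space_pair s' "(*) :: 'k \<Rightarrow> 'k \<Rightarrow> 'k"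
    using assms by (simp add: vector_space_pair_def vector_space_over_itself)
  define X where "X = weak_topology s'"
  have top: "topspace X = UNIV"
    unfolding X_def by (rule topspace_weak_topology) fact
  have img: "blinfun_apply (0 :: 'e \<Rightarrow>\<^sub>L 'f) ` cball 0 1 = {0}"
    by (auto simp: zero_blinfun.rep_eq image_constant_conv)
  have "compactin X (X closure_of {0})"
    unfolding compactin_def
  proof (intro conjI allI impI)
    show "X closure_of {0} \<subseteq> topspace X"
      by (rule closure_of_subset_topspace)
  next
    fix \<U> assume U: "Ball \<U> (openin X) \<and> X closure_of {0} \<subseteq> \<Union>\<U>"
    have "0 \<in> X closure_of {0}"
      using closure_of_subset[of "{0}" X] top by auto
    then obtain A where A: "A \<in> \<U>" "0 \<in> A" using U by blast
    have sub: "x \<in> A" if x: "x \<in> X closure_of {0}" for x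
    proof -
      obtain B where B: "B \<in> \<U>" "x \<in> B" using U x by blast
      have fx: "\<phi> x = 0" if lin: "Vector_Spaces.linear s' (*) (blinfun_apply \<phi>)"
        for \<phi> :: "'f \<Rightarrow>\<^sub>L 'k"
      proof (rule ccontr)
        assume "\<phi> x \<noteq> 0"
        have "openin X (blinfun_apply \<phi> -` (-{0}))"
          unfolding X_def weak_topology_def
        proof (rule topology_generated_by_Basis, rule CollectI, intro exI conjI)
          show "blinfun_apply \<phi> -` (-{0}) = blinfun_apply \<phi> -` (-{0})" by (rule refl)
          show "open (-{0 :: 'k})" by (simp add: open_Compl)
        qed (rule lin)
        moreover have "x \<in> \<phi> -` (-{0})"
          using \<open>\<phi> x \<noteq> 0\<close> by simp
        moreover have "\<exists>y. y \<in> {0} \<and> y \<in> T" if "x \<in> T" "openin X T" for T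
          using x that unfolding in_closure_of by simp
        ultimately have "0 \<in> \<phi> -` (-{0})"
          by (metis singletonD)
        then show False by simp
      qed
      have "generate_topology_on
          {blinfun_apply \<phi> -` U | (\<phi> :: 'f \<Rightarrow>\<^sub>L 'k) U. Vector_Spaces.linear s' (*) \<phi> \<and> open U} A"
        using U A(1) unfolding X_def weak_topology_def
        by (intro openin_topology_generated_by) blast
      then have "0 \<in> A \<longleftrightarrow> x \<in> A"
      proof (induction rule: generate_topology_on.induct)
        case (Basis V)
        then show ?case by (auto simp: fx)
      qed blast+
      then show ?thesis using A by simp
    qed
    then show "\<exists>\<F>. finite \<F> \<and> \<F> \<subseteq> \<U> \<and> X closure_of {0} \<subseteq> \<Union>\<F>"
      using A by (intro exI[of _ "{A}"]) auto
  qed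
  then show ?thesis
    unfolding weakly_compact_op_def X_def[symmetric] img
    by (simp add: zero_blinfun.rep_eq V.linear_zero)
qed


section \<open>The space of continuous functions and its dual\<close>

text \<open>For compact \<open>K\<close> every continuous function is bounded, so \<open>C(K)\<close> with the supremum norm
  is the library type of bounded continuous functions.\<close>

definition cfun_scale ::
    "'k::real_normed_field \<Rightarrow> ('a::topological_space \<Rightarrow>\<^sub>C 'k) \<Rightarrow> ('a \<Rightarrow>\<^sub>C 'k)" where
  "cfun_scale c f = Bcontfun (\<lambda>x. c * f x)"

lemma apply_cfun_scale [simp]: "apply_bcontfun (cfun_scale c f) x = c * f x"
proof -
  have "(\<lambda>x. c * f x) \<in> bcontfun"
    by (rule bcontfun_normI[where b = "norm c * norm f"])
       (auto intro!: continuous_intros mult_left_mono norm_bounded simp: norm_mult)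
  then show ?thesis
    by (simp add: cfun_scale_def Bcontfun_inverse)
qed

lemma vector_space_cfun_scale: "vector_space cfun_scale"
  by standard (auto intro!: bcontfun_eqI simp: algebra_simps)

text \<open>The dual of \<open>C(K)\<close> consists of the \<open>'k\<close>-linear bounded functionals, not of all
  real-linear ones; hence it is a subtype of the library's operator type.\<close>

typedef (overloaded) ('a, 'k) cfun_dual =
  "{\<phi> :: ('a::topological_space \<Rightarrow>\<^sub>C 'k::real_normed_field) \<Rightarrow>\<^sub>L 'k.
      Vector_Spaces.linear cfun_scale (*) \<phi>}"
  morphisms functional_of_dual dual_of_functional
proof
  interpret vector_space_pair "cfun_scale :: 'k \<Rightarrow> ('a \<Rightarrow>\<^sub>C 'k) \<Rightarrow> _" "(*) :: 'k \<Rightarrow> 'k \<Rightarrow> 'k"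
    using vector_space_cfun_scale by (simp add: vector_space_pair_def vector_space_over_itself)
  show "0 \<in> {\<phi> :: ('a \<Rightarrow>\<^sub>C 'k) \<Rightarrow>\<^sub>L 'k. Vector_Spaces.linear cfun_scale (*) \<phi>}"
    by (simp add: zero_blinfun.rep_eq linear_zero)
qed

setup_lifting type_definition_cfun_dual

lemma linear_cfun_functional_iff:
  fixes \<phi> :: "('a::topological_space \<Rightarrow>\<^sub>C 'k::real_normed_field) \<Rightarrow>\<^sub>L 'k"
  shows
  "Vector_Spaces.linear cfun_scale (*) (blinfun_apply \<phi>) \<longleftrightarrow>
     (\<forall>c f. \<phi> (cfun_scale c f) = c * \<phi> f)"
  using vector_space_cfun_scale[where 'a = 'k and 'b = 'a]
  by (auto simp: Vector_Spaces.linear_iff blinfun.add_right vector_space_over_itself)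

instantiation cfun_dual :: (topological_space, real_normed_field) real_vector
begin

lift_definition zero_cfun_dual :: "('a, 'b) cfun_dual" is 0
  by (simp add: linear_cfun_functional_iff)

lift_definition plus_cfun_dual :: "('a, 'b) cfun_dual \<Rightarrow> ('a, 'b) cfun_dual \<Rightarrow> ('a, 'b) cfun_dual"
  is "(+)"
  by (simp add: linear_cfun_functional_iff blinfun.add_left algebra_simps)

lift_definition uminus_cfun_dual :: "('a, 'b) cfun_dual \<Rightarrow> ('a, 'b) cfun_dual" is uminus
  by (simp add: linear_cfun_functional_iff blinfun.minus_left)

lift_definition minus_cfun_dual :: "('a, 'b) cfun_dual \<Rightarrow> ('a, 'b) cfun_dual \<Rightarrow> ('a, 'b) cfun_dual"
  is "(-)"
  by (simp add: linear_cfun_functional_iff blinfun.diff_left algebra_simps)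

lift_definition scaleR_cfun_dual :: "real \<Rightarrow> ('a, 'b) cfun_dual \<Rightarrow> ('a, 'b) cfun_dual" is scaleR
  by (simp add: linear_cfun_functional_iff blinfun.scaleR_left)

instance
  by standard (transfer; simp add: algebra_simps)+

end

instantiation cfun_dual :: (topological_space, real_normed_field) real_normed_vector
begin

lift_definition norm_cfun_dual :: "('a, 'b) cfun_dual \<Rightarrow> real" is norm .

definition dist_cfun_dual :: "('a, 'b) cfun_dual \<Rightarrow> ('a, 'b) cfun_dual \<Rightarrow> real"
  where "dist_cfun_dual \<phi> \<psi> = norm (\<phi> - \<psi>)"

definition sgn_cfun_dual :: "('a, 'b) cfun_dual \<Rightarrow> ('a, 'b) cfun_dual"
  where "sgn_cfun_dual \<phi> = \<phi> /\<^sub>R norm \<phi>"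

definition uniformity_cfun_dual :: "(('a, 'b) cfun_dual \<times> ('a, 'b) cfun_dual) filter"
  where "uniformity_cfun_dual = (INF e\<in>{0 <..}. principal {(x, y). dist x y < e})"

definition open_cfun_dual :: "('a, 'b) cfun_dual set \<Rightarrow> bool"
  where "open_cfun_dual S = (\<forall>x\<in>S. \<forall>\<^sub>F (x', y) in uniformity. x' = x \<longrightarrow> y \<in> S)"

instance
proof
  fix x y :: "('a, 'b) cfun_dual" and a :: real
  show "(norm x = 0) = (x = 0)" "norm (x + y) \<le> norm x + norm y" "norm (a *\<^sub>R x) = \<bar>a\<bar> * norm x"
    by (transfer; simp add: norm_triangle_ineq)+
qed (simp_all add: dist_cfun_dual_def sgn_cfun_dual_def uniformity_cfun_dual_def
      open_cfun_dual_def)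

end

lift_definition dual_scale ::
    "'k::real_normed_field \<Rightarrow> ('a::topological_space, 'k) cfun_dual \<Rightarrow> ('a, 'k) cfun_dual"
  is "\<lambda>c \<phi>. blinfun_mult_right c o\<^sub>L \<phi>"
  by (simp add: linear_cfun_functional_iff)

lemma functional_of_dual_scale [simp]:
  "functional_of_dual (dual_scale c \<phi>) f = c * functional_of_dual \<phi> f"
  by (simp add: dual_scale.rep_eq)

lemma vector_space_dual_scale: "vector_space dual_scale"
  by standard (transfer; auto intro!: blinfun_eqI simp: blinfun.add_left algebra_simps)+

text \<open>The adjoint \<open>\<phi> \<mapsto> \<phi> \<circ> T\<close> is meaningful for \<open>'k\<close>-linear \<open>T\<close> only; see \<open>adjoint_apply\<close>.\<close>

definition cfun_adjoint ::
    "(('a::topological_space \<Rightarrow>\<^sub>C 'k::real_normed_field) \<Rightarrow>\<^sub>L ('b::topological_space \<Rightarrow>\<^sub>C 'k)) \<Rightarrow>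
     ('b, 'k) cfun_dual \<Rightarrow>\<^sub>L ('a, 'k) cfun_dual" where
  "cfun_adjoint T = Blinfun (\<lambda>\<phi>. dual_of_functional (functional_of_dual \<phi> o\<^sub>L T))"

lemma
  fixes T :: "('a::topological_space \<Rightarrow>\<^sub>C 'k::real_normed_field) \<Rightarrow>\<^sub>L ('b::topological_space \<Rightarrow>\<^sub>C 'k)"
  assumes T: "Vector_Spaces.linear cfun_scale cfun_scale (blinfun_apply T)"
  shows adjoint_apply: "functional_of_dual (cfun_adjoint T \<phi>) f = functional_of_dual \<phi> (T f)"
    and linear_adjoint: "Vector_Spaces.linear dual_scale dual_scale (cfun_adjoint T)"
proof -
  interpret T: Vector_Spaces.linear cfun_scale cfun_scale "blinfun_apply T" by (rule T)
  have hom: "functional_of_dual \<phi> (cfun_scale c f) = c * functional_of_dual \<phi> f"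
    for \<phi> :: "('b, 'k) cfun_dual" and c f
    using functional_of_dual[of \<phi>] by (simp add: linear_cfun_functional_iff)
  have rep: "functional_of_dual (dual_of_functional (functional_of_dual \<phi> o\<^sub>L T))
      = functional_of_dual \<phi> o\<^sub>L T" for \<phi>
    by (rule dual_of_functional_inverse) (simp add: linear_cfun_functional_iff T.scale hom)
  define A where "A \<phi> = dual_of_functional (functional_of_dual \<phi> o\<^sub>L T)" for \<phi>
  have A: "functional_of_dual (A \<phi>) = functional_of_dual \<phi> o\<^sub>L T" for \<phi>
    unfolding A_def by (rule rep)
  have bl: "bounded_linear A"
  proof (rule bounded_linear_intro)
    fix x y :: "('b, 'k) cfun_dual" and r :: real
    show "A (x + y) = A x + A y"
      by (rule functional_of_dual_inject[THEN iffD1], rule blinfun_eqI)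
         (simp add: A plus_cfun_dual.rep_eq blinfun.add_left)
    show "A (r *\<^sub>R x) = r *\<^sub>R A x"
      by (rule functional_of_dual_inject[THEN iffD1], rule blinfun_eqI)
         (simp add: A scaleR_cfun_dual.rep_eq blinfun.scaleR_left)
    show "norm (A x) \<le> norm x * norm T"
      unfolding norm_cfun_dual.rep_eq A by (rule norm_blinfun_compose)
  qed
  show ap: "functional_of_dual (cfun_adjoint T \<phi>) f = functional_of_dual \<phi> (T f)" for \<phi> f
    by (simp add: cfun_adjoint_def A_def[symmetric] bounded_linear_Blinfun_apply[OF bl] A)
  have "cfun_adjoint T (dual_scale c \<phi>) = dual_scale c (cfun_adjoint T \<phi>)" for c \<phi>
    by (rule functional_of_dual_inject[THEN iffD1], rule blinfun_eqI) (simp add: ap)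
  then show "Vector_Spaces.linear dual_scale dual_scale (cfun_adjoint T)"
    by (simp add: Vector_Spaces.linear_iff vector_space_dual_scale blinfun.add_right)
qed

end

theory Submission
  imports Defs
begin

text \<open>
  Write \<open>M(K)\<close> for the dual of \<open>C(K)\<close>. An operator \<open>R : C(K) \<rightarrow> C(L)\<close> is studied through its
  rows, the functionals \<open>R\<^sup>* \<delta>\<^sub>t\<close> in \<open>M(K)\<close> with \<open>t\<close> in \<open>L\<close>. The key is that weak compactness is a
  domination property: \<open>R\<close> is weakly compact exactly if for each \<open>e > 0\<close> there is a positive
  functional \<open>u\<close> on \<open>C(K)\<close> with \<open>\<parallel>R f\<parallel> \<le> u |f| + e \<parallel>f\<parallel>\<close> for all \<open>f\<close>.

  Weak compactness gives domination (\<open>weakly_compact_set_dominated\<close> for sets in \<open>M(K)\<close>,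
  \<open>weakly_compact_imp_nearly_dominated\<close> for operators). If domination fails, functionals of the
  set and functions in the unit ball can be chosen in turn, so that each function is almost
  negligible for the functionals chosen before it. Making the functions almost disjoint and passing
  to a subsequence with Rosenthal's lemma yields a double sequence of numbers whose iterated
  limits are separated (\<open>undominated_array\<close>), which a weak cluster point forbids.

  Domination gives weak compactness (\<open>nearly_dominated_imp_weakly_compact\<close>). Up to a small norm,
  \<open>\<parallel>R f\<parallel> \<le> u |f|\<close>, and by Cauchy-Schwarz the right-hand side is at most a multiple of the
  Hilbertian seminorm \<open>sqrt (u |f|\<^sup>2)\<close>. A functional on \<open>M(K)\<close> is, on the functionals bounded by
  such a seminorm, uniformly close to the evaluation at some \<open>f\<close> in \<open>C(K)\<close>. Hence \<open>R\<^sup>*\<^sup>*\<close> takes its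
  values in \<open>C(L)\<close>, and Alaoglu's theorem makes both \<open>R\<close> and \<open>R\<^sup>*\<close> weakly compact.

  Now let \<open>r\<close> be the distance of \<open>T\<^sup>*\<close> to the weakly compact operators. The rows of weakly compact
  operators that are almost best for \<open>T\<^sup>*\<close> give positive functionals \<open>u\<^sub>n\<close>, increasing in \<open>n\<close>, with
  \<open>|\<mu> f| \<le> u\<^sub>n |f| + (r + 1/n) \<parallel>f\<parallel>\<close> for each row \<open>\<mu>\<close> of \<open>T\<close>. Each row can be truncated: there is
  \<open>\<nu>\<close> with \<open>\<parallel>\<mu> - \<nu>\<parallel> \<le> r\<close> and \<open>|\<nu> f| \<le> u\<^sub>n |f| + \<parallel>f\<parallel>/n\<close> for all \<open>n\<close> at once (\<open>truncate_dual\<close>). It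
  suffices to cut \<open>|\<mu>|\<close> at a level of the scale \<open>u\<^sub>1 \<le> u\<^sub>2 \<le> \<dots>\<close> at which the mass lost is
  exactly \<open>r\<close>, and to take \<open>\<nu> = 0\<close> if \<open>\<mu>\<close> has norm at most \<open>r\<close>.

  The truncated rows need not depend continuously on \<open>t\<close>. Here the topology of \<open>L\<close> enters: there are
  ultrafilters \<open>F\<^sub>t\<close> converging to \<open>t\<close>, chosen so coherently that the limit along \<open>F\<^sub>t\<close> turns every
  bounded function on \<open>L\<close> into a continuous one (\<open>ultrafilter_section\<close>; this is Gleason's theorem
  that \<open>L\<close> is projective). The limits of the truncated rows are the rows of an operator \<open>W\<close> with the
  same bounds, so \<open>\<parallel>T - W\<parallel> \<le> r\<close> and \<open>W\<close> is weakly compact. Finally \<open>r\<close> is at most the distance of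
  \<open>T\<close> to the weakly compact operators, because adjoints of weakly compact operators are weakly
  compact. The three numbers therefore agree.

  Real and complex scalars are treated together, as a normed field that is also a Euclidean space.
\<close>

section \<open>Sublinear functionals and the Hahn-Banach theorem\<close>

definition sublinear :: "('v::real_vector \<Rightarrow> real) \<Rightarrow> bool" where
  "sublinear p \<longleftrightarrow> (\<forall>x y. p (x + y) \<le> p x + p y) \<and> (\<forall>r x. 0 \<le> r \<longrightarrow> p (r *\<^sub>R x) = r * p x)"

lemma sublinear_add: "sublinear p \<Longrightarrow> p (x + y) \<le> p x + p y"
  and sublinear_scale: "sublinear p \<Longrightarrow> 0 \<le> r \<Longrightarrow> p (r *\<^sub>R x) = r * p x"
  by (auto simp: sublinear_def)

lemma sublinear_zero: "sublinear p \<Longrightarrow> p 0 = 0"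
  using sublinear_scale[of p 0 0] by simp

lemma sublinear_minus: "sublinear p \<Longrightarrow> - p (- x) \<le> p x"
  using sublinear_add[of p x "-x"] sublinear_zero[of p] by simp

lemma sublinearI:
  assumes "\<And>x y. p (x + y) \<le> p x + p y" "\<And>r x. 0 < r \<Longrightarrow> p (r *\<^sub>R x) \<le> r * p x" "p 0 = 0"
  shows "sublinear p"
  unfolding sublinear_def
proof (intro conjI allI impI)
  fix r :: real and x assume "0 \<le> r"
  show "p (r *\<^sub>R x) = r * p x"
  proof (cases "r = 0")
    case False
    then have r: "0 < r" using \<open>0 \<le> r\<close> by simp
    have "p (inverse r *\<^sub>R (r *\<^sub>R x)) \<le> inverse r * p (r *\<^sub>R x)"
      by (rule assms(2)) (use r in simp)
    then have "r * p x \<le> p (r *\<^sub>R x)"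
      using r by (simp add: field_simps)
    with assms(2)[OF r, of x] show ?thesis by simp
  qed (simp add: assms(3))
qed (rule assms(1))

text \<open>
  For fixed \<open>y\<close>, the infimum over \<open>t \<ge> 0\<close> of \<open>s (z + t y) - t s y\<close> is sublinear in \<open>z\<close> and lies below
  \<open>s\<close>. By minimality it is \<open>s\<close>, and \<open>t = 1\<close> gives superadditivity.
\<close>

lemma minimal_sublinear_additive:
  assumes s: "sublinear s" and min: "\<And>q. sublinear q \<Longrightarrow> (\<And>x. q x \<le> s x) \<Longrightarrow> q = s"
  shows "s (x + y) = s x + s y"
proof -
  define q where "q z = (INF t\<in>{0..}. s (z + t *\<^sub>R y) - t * s y)" for z
  have low: "- s (- z) \<le> s (z + t *\<^sub>R y) - t * s y" if "0 \<le> t" for z t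
  proof -
    have "s (t *\<^sub>R y) \<le> s (z + t *\<^sub>R y) + s (- z)"
      using sublinear_add[OF s, of "z + t *\<^sub>R y" "- z"] by simp
    then show ?thesis using sublinear_scale[OF s that, of y] by simp
  qed
  have bdd: "bdd_below ((\<lambda>t. s (z + t *\<^sub>R y) - t * s y) ` {0..})" for z
    by (rule bdd_belowI2[of _ "- s (- z)"]) (use low in auto)
  have le: "q z \<le> s (z + t *\<^sub>R y) - t * s y" if "0 \<le> t" for z t
    unfolding q_def by (rule cINF_lower[OF bdd]) (use that in auto)
  have ge: "c \<le> q z" if "\<And>t. 0 \<le> t \<Longrightarrow> c \<le> s (z + t *\<^sub>R y) - t * s y" for c z
    unfolding q_def by (rule cINF_greatest) (use that in auto)
  have "sublinear q"
  proof (rule sublinearI)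
    fix u v
    have "q (u + v) - (s (u + a *\<^sub>R y) - a * s y) \<le> s (v + b *\<^sub>R y) - b * s y"
      if "0 \<le> a" "0 \<le> b" for a b
    proof -
      have "q (u + v) \<le> s ((u + a *\<^sub>R y) + (v + b *\<^sub>R y)) - (a + b) * s y"
        using le[of "a + b" "u + v"] that by (simp add: algebra_simps)
      also have "\<dots> \<le> s (u + a *\<^sub>R y) + s (v + b *\<^sub>R y) - (a + b) * s y"
        using sublinear_add[OF s] by simp
      finally show ?thesis by (simp add: algebra_simps)
    qed
    then have "q (u + v) - (s (u + a *\<^sub>R y) - a * s y) \<le> q v" if "0 \<le> a" for a
      using that by (intro ge) auto
    then have "q (u + v) - q v \<le> q u"
      by (intro ge) (simp add: algebra_simps)
    then show "q (u + v) \<le> q u + q v" by simp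
  next
    fix r :: real and z assume r: "0 < r"
    have "q (r *\<^sub>R z) / r \<le> q z"
    proof (rule ge)
      fix t :: real assume t: "0 \<le> t"
      have "q (r *\<^sub>R z) \<le> s (r *\<^sub>R (z + t *\<^sub>R y)) - r * t * s y"
        using le[of "r * t" "r *\<^sub>R z"] r t by (simp add: algebra_simps)
      also have "\<dots> = r * (s (z + t *\<^sub>R y) - t * s y)"
        using sublinear_scale[OF s, of r "z + t *\<^sub>R y"] r
        by (simp add: right_diff_distrib mult.assoc)
      finally show "q (r *\<^sub>R z) / r \<le> s (z + t *\<^sub>R y) - t * s y"
        using r by (simp add: field_simps)
    qed
    then show "q (r *\<^sub>R z) \<le> r * q z" using r by (simp add: field_simps)
  next
    have "0 \<le> q 0"
      by (rule ge) (use sublinear_scale[OF s] in simp)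
    moreover have "q 0 \<le> 0" using le[of 0 0] sublinear_zero[OF s] by simp
    ultimately show "q 0 = 0" by simp
  qed
  moreover have "q z \<le> s z" for z using le[of 0 z] by simp
  ultimately have "q = s" by (rule min)
  then have "s x + s y \<le> s (x + y)" using le[of 1 x] by simp
  with sublinear_add[OF s, of x y] show ?thesis by simp
qed

lemma chain_Inf_sublinear:
  assumes C: "C \<noteq> {}" "\<And>p. p \<in> C \<Longrightarrow> sublinear p" 
    and chain: "\<And>p q. p \<in> C \<Longrightarrow> q \<in> C \<Longrightarrow> p \<le> q \<or> q \<le> p"
  shows "sublinear (\<lambda>x. INF p\<in>C. p x)" and "\<And>p x. p \<in> C \<Longrightarrow> (INF p\<in>C. p x) \<le> p x"
proof -
  obtain p0 where p0: "p0 \<in> C" using C by blast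
  have bound: "- p0 (- x) \<le> p x" if "p \<in> C" for p x
  proof -
    have "p \<le> p0 \<or> p0 \<le> p" using chain that p0 by blast
    then show ?thesis
    proof
      assume "p \<le> p0"
      then have "p (- x) \<le> p0 (- x)" by (simp add: le_fun_def)
      with sublinear_minus[OF C(2)[OF that], of x] show ?thesis by simp
    next
      assume "p0 \<le> p"
      then have "p0 x \<le> p x" by (simp add: le_fun_def)
      with sublinear_minus[OF C(2)[OF p0], of x] show ?thesis by simp
    qed
  qed
  have bdd: "bdd_below ((\<lambda>p. p x) ` C)" for x
    by (rule bdd_belowI2[of _ "- p0 (- x)"]) (rule bound)
  show low: "(INF p\<in>C. p x) \<le> p x" if "p \<in> C" for p x
    by (rule cINF_lower[OF bdd that])
  have ge: "c \<le> (INF p\<in>C. p x)" if "\<And>p. p \<in> C \<Longrightarrow> c \<le> p x" for c x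
    by (rule cINF_greatest[OF C(1)]) (rule that)
  show "sublinear (\<lambda>x. INF p\<in>C. p x)"
  proof (rule sublinearI)
    fix x y
    have "(INF p\<in>C. p (x + y)) - p x \<le> q y" if p: "p \<in> C" and q: "q \<in> C" for p q
    proof -
      define m where "m = (if p \<le> q then p else q)"
      have m: "m \<in> C" "m x \<le> p x" "m y \<le> q y"
        using chain[OF p q] p q by (auto simp: m_def le_fun_def)
      show ?thesis
        using low[OF m(1), of "x + y"] sublinear_add[OF C(2)[OF m(1)], of x y] m by linarith
    qed
    then have "(INF p\<in>C. p (x + y)) - p x \<le> (INF p\<in>C. p y)" if "p \<in> C" for p
      using that by (intro ge) auto
    then have "(INF p\<in>C. p (x + y)) - (INF p\<in>C. p y) \<le> (INF p\<in>C. p x)"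
      by (intro ge) (simp add: algebra_simps)
    then show "(INF p\<in>C. p (x + y)) \<le> (INF p\<in>C. p x) + (INF p\<in>C. p y)" by simp
  next
    fix r :: real and x assume r: "0 < r"
    have "(INF p\<in>C. p (r *\<^sub>R x)) / r \<le> (INF p\<in>C. p x)"
    proof (rule ge)
      fix p assume p: "p \<in> C"
      show "(INF p\<in>C. p (r *\<^sub>R x)) / r \<le> p x"
        using low[OF p, of "r *\<^sub>R x"] sublinear_scale[OF C(2)[OF p], of r x] r
        by (simp add: field_simps)
    qed
    then show "(INF p\<in>C. p (r *\<^sub>R x)) \<le> r * (INF p\<in>C. p x)" using r by (simp add: field_simps)
  next
    have "(\<lambda>p. p 0) ` C = {0}" using C sublinear_zero by force
    then show "(INF p\<in>C. p 0) = 0" by simp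
  qed
qed

text \<open>
  Zorn's lemma yields a minimal sublinear functional below \<open>p\<close>, and minimality forces linearity.
\<close>

theorem Hahn_Banach_sublinear:
  fixes p :: "'v::real_vector \<Rightarrow> real"
  assumes p: "sublinear p"
  obtains \<psi> where "linear \<psi>" "\<And>x. \<psi> x \<le> p x"
proof -
  define A where "A = {q. sublinear q \<and> q \<le> p}"
  define r where "r = {(q', q). q' \<in> A \<and> q \<in> A \<and> q \<le> q'}"
  have F: "Field r = A" by (auto simp: r_def Field_def)
  have po: "Partial_order r"
    unfolding partial_order_on_def preorder_on_def
    using F by (auto simp: r_def refl_on_def trans_def antisym_def)
  have "\<exists>m\<in>Field r. \<forall>a\<in>Field r. (m, a) \<in> r \<longrightarrow> a = m"
  proof (rule Zorns_po_lemma[OF po])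
    fix C assume C: "C \<in> Chains r"
    then have CA: "C \<subseteq> A" by (auto simp: Chains_def r_def)
    show "\<exists>u\<in>Field r. \<forall>a\<in>C. (a, u) \<in> r"
    proof (cases "C = {}")
      case True
      then show ?thesis using p F by (auto simp: A_def)
    next
      case False
      have sub: "\<And>q. q \<in> C \<Longrightarrow> sublinear q" using CA by (auto simp: A_def)
      have ch: "\<And>p q. p \<in> C \<Longrightarrow> q \<in> C \<Longrightarrow> p \<le> q \<or> q \<le> p"
        using C by (auto simp: Chains_def r_def)
      define u where "u x = (INF q\<in>C. q x)" for x
      have low: "u \<le> q" if "q \<in> C" for q
        unfolding u_def le_fun_def using chain_Inf_sublinear(2)[OF False sub ch that] by simp
      have "sublinear u"
        unfolding u_def by (rule chain_Inf_sublinear(1)[OF False sub ch])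
      moreover have "u \<le> p"
      proof -
        obtain q where "q \<in> C" using False by blast
        then show ?thesis using low CA by (force simp: A_def)
      qed
      ultimately have "u \<in> A" by (simp add: A_def)
      then show ?thesis using low CA unfolding F by (auto simp: r_def)
    qed
  qed
  then obtain s where s: "s \<in> A" and min: "\<And>a. a \<in> A \<Longrightarrow> a \<le> s \<Longrightarrow> a = s"
    unfolding F by (auto simp: r_def)
  have sub: "sublinear s" and "s \<le> p" using s by (auto simp: A_def)
  have add: "s (x + y) = s x + s y" for x y
  proof (rule minimal_sublinear_additive[OF sub])
    fix q assume "sublinear q" "\<And>x. q x \<le> s x"
    then show "q = s" using \<open>s \<le> p\<close> by (intro min) (auto simp: A_def le_fun_def intro: order_trans)
  qed
  have neg: "s (- x) = - s x" for x
    using add[of x "- x"] sublinear_zero[OF sub] by simp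
  have "linear s"
  proof (rule linearI)
    fix c :: real and x
    show "s (c *\<^sub>R x) = c *\<^sub>R s x"
    proof (cases "0 \<le> c")
      case False
      have "s (c *\<^sub>R x) = - s ((- c) *\<^sub>R x)" using neg[of "(- c) *\<^sub>R x"] by simp
      then show ?thesis using sublinear_scale[OF sub, of "- c" x] False by simp
    qed (simp add: sublinear_scale[OF sub])
  qed (rule add)
  with \<open>s \<le> p\<close> show ?thesis by (intro that) (auto simp: le_fun_def)
qed

text \<open>
  A linear minorant of the infimal convolution \<open>x \<mapsto> inf\<^sub>y p (x + y) + q y - l y\<close> lies between
  \<open>l - q\<close> and \<open>p\<close>.
\<close>

corollary Hahn_Banach_sandwich:
  fixes l :: "'v::real_vector \<Rightarrow> real"
  assumes p: "sublinear p" and q: "sublinear q" and l: "linear l"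
    and le: "\<And>x. l x \<le> p x + q x"
  obtains \<psi> where "linear \<psi>" "\<And>x. \<psi> x \<le> p x" "\<And>x. l x - \<psi> x \<le> q x"
proof -
  define s where "s x = (INF y. p (x + y) + q y - l y)" for x
  have low: "- p (- x) \<le> p (x + y) + q y - l y" for x y
    using sublinear_add[OF p, of "x + y" "- x"] le[of y] by simp
  have bdd: "bdd_below (range (\<lambda>y. p (x + y) + q y - l y))" for x
    by (rule bdd_belowI2[of _ "- p (- x)"]) (rule low)
  have lower: "s x \<le> p (x + y) + q y - l y" for x y
    unfolding s_def by (rule cINF_lower[OF bdd]) simp
  have ge: "c \<le> s x" if "\<And>y. c \<le> p (x + y) + q y - l y" for c x
    unfolding s_def by (rule cINF_greatest) (use that in auto)
  have "sublinear s"
  proof (rule sublinearI)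
    fix u v
    have "s (u + v) - (p (u + a) + q a - l a) \<le> p (v + b) + q b - l b" for a b
      using lower[of "u + v" "a + b"] sublinear_add[OF p, of "u + a" "v + b"]
        sublinear_add[OF q, of a b] linear_add[OF l, of a b] by (simp add: algebra_simps)
    then have "s (u + v) - (p (u + a) + q a - l a) \<le> s v" for a by (rule ge)
    then have "s (u + v) - s v \<le> s u" by (intro ge) (simp add: algebra_simps)
    then show "s (u + v) \<le> s u + s v" by simp
  next
    fix r :: real and x assume r: "0 < r"
    have "s (r *\<^sub>R x) / r \<le> s x"
    proof (rule ge)
      fix y
      have "s (r *\<^sub>R x) \<le> p (r *\<^sub>R (x + y)) + q (r *\<^sub>R y) - l (r *\<^sub>R y)"
        using lower[of "r *\<^sub>R x" "r *\<^sub>R y"] by (simp add: algebra_simps)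
      also have "\<dots> = r * (p (x + y) + q y - l y)"
        using r by (simp only: sublinear_scale[OF p] sublinear_scale[OF q] linear_scale[OF l] less_imp_le)
          (simp add: algebra_simps)
      finally show "s (r *\<^sub>R x) / r \<le> p (x + y) + q y - l y" using r by (simp add: field_simps)
    qed
    then show "s (r *\<^sub>R x) \<le> r * s x" using r by (simp add: field_simps)
  next
    show "s 0 = 0"
      using lower[of 0 0] ge[of 0 0] le sublinear_zero[OF p] sublinear_zero[OF q] linear_0[OF l]
      by force
  qed
  then obtain \<psi> where \<psi>: "linear \<psi>" "\<And>x. \<psi> x \<le> s x"
    using Hahn_Banach_sublinear by blast
  show ?thesis
  proof (rule that[OF \<psi>(1)])
    fix x
    show "\<psi> x \<le> p x"
      using \<psi>(2)[of x] lower[of x 0] sublinear_zero[OF q] linear_0[OF l] by simp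
    show "l x - \<psi> x \<le> q x"
      using \<psi>(2)[of "- x"] lower[of "- x" x] sublinear_zero[OF p] linear_neg[OF \<psi>(1), of x] by simp
  qed
qed

section \<open>Real parts of scalar-valued functionals\<close>

text \<open>
  The adjoint of multiplication by \<open>c\<close> for the real inner product; it is complex conjugation on
  \<^typ>\<open>complex\<close> and the identity on \<^typ>\<open>real\<close>. The norm is multiplicative, so multiplication by \<open>c\<close> is
  \<open>norm c\<close> times an isometry, and its adjoint is \<open>(norm c)\<^sup>2\<close> times its inverse.
\<close>

definition scalar_adj :: "'k::{real_normed_field, euclidean_space} \<Rightarrow> 'k" where
  "scalar_adj c = (norm c)\<^sup>2 *\<^sub>R inverse c"

lemma inner_mult_left_norm:
  fixes c :: "'k::{real_normed_field, euclidean_space}"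
  shows "inner (c * x) (c * y) = (norm c)\<^sup>2 * inner x y"
proof -
  have "inner (c * x) (c * y) = ((norm (c * (x + y)))\<^sup>2 - (norm (c * x))\<^sup>2 - (norm (c * y))\<^sup>2) / 2"
    by (simp add: dot_norm distrib_left)
  then show ?thesis
    unfolding norm_mult power_mult_distrib dot_norm[of x y] by (simp add: algebra_simps)
qed

lemma inner_scalar_adj:
  fixes c :: "'k::{real_normed_field, euclidean_space}"
  shows "inner (c * x) y = inner x (scalar_adj c * y)"
proof (cases "c = 0")
  case False
  then have "inner (c * x) y = inner (c * x) (c * (inverse c * y))"
    by (simp add: mult.assoc[symmetric])
  then show ?thesis by (simp add: inner_mult_left_norm scalar_adj_def)
qed (simp add: scalar_adj_def)

lemma scalar_adj_eqI:
  fixes a b :: "'k::{real_normed_field, euclidean_space}"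
  assumes "\<And>x. inner (a * x) 1 = inner x b"
  shows "scalar_adj a = b"
  by (rule vector_eq_ldot[THEN iffD1], rule allI) (use assms in \<open>simp add: inner_scalar_adj\<close>)

lemma scalar_adj_add: "scalar_adj (a + b) = scalar_adj a + scalar_adj b"
  and scalar_adj_scaleR: "scalar_adj (r *\<^sub>R a) = r *\<^sub>R scalar_adj a"
  and scalar_adj_mult: "scalar_adj (a * b) = scalar_adj a * scalar_adj b"
  and scalar_adj_adj: "scalar_adj (scalar_adj a) = a"
proof -
  show "scalar_adj (a + b) = scalar_adj a + scalar_adj b"
    by (rule scalar_adj_eqI) (simp add: distrib_right inner_add_left inner_scalar_adj inner_add_right)
  show "scalar_adj (r *\<^sub>R a) = r *\<^sub>R scalar_adj a"
    by (rule scalar_adj_eqI) (simp add: inner_scalar_adj)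
  show "scalar_adj (a * b) = scalar_adj a * scalar_adj b"
    by (simp add: scalar_adj_def norm_mult power_mult_distrib)
  show "scalar_adj (scalar_adj a) = a"
  proof (rule scalar_adj_eqI)
    fix x
    show "inner (scalar_adj a * x) 1 = inner x a"
      using inner_scalar_adj[of a 1 x] by (simp add: inner_commute)
  qed
qed

lemma scalar_adj_Basis: "b \<in> Basis \<Longrightarrow> scalar_adj b = inverse b"
  by (simp add: scalar_adj_def)

lemma unit_rotation:
  fixes z :: "'k::{real_normed_field, euclidean_space}"
  obtains e where "norm e = 1" "e * z = of_real (norm z)"
proof (cases "z = 0")
  case True
  then show ?thesis using that[of 1] by simp
next
  case False
  then show ?thesis
    using that[of "of_real (norm z) / z"] by (simp add: norm_divide)
qed

lemma inner_of_real_one: "inner (of_real r :: 'k::{real_normed_field, euclidean_space}) 1 = r"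
proof -
  have "inner (1::'k) 1 = (norm (1::'k))\<^sup>2" by (rule power2_norm_eq_inner[symmetric])
  then show ?thesis by (simp add: of_real_def)
qed

lemma inner_one_le_norm: "inner (z :: 'k::{real_normed_field, euclidean_space}) 1 \<le> norm z"
  using norm_cauchy_schwarz[of z 1] by simp

text \<open>
  The components of the functional are forced: in the direction of a unit vector \<open>b\<close> it must have the
  component \<open>\<psi> (b\<inverse> f)\<close>. For complex scalars this is \<open>\<psi> f - \<i> \<psi> (\<i> f)\<close>.
\<close>

lemma linear_functional_with_real_part:
  fixes \<psi> :: "('a::topological_space \<Rightarrow>\<^sub>C 'k::{real_normed_field, euclidean_space}) \<Rightarrow> real"
  assumes \<psi>: "linear \<psi>"
  obtains \<phi> :: "('a \<Rightarrow>\<^sub>C 'k) \<Rightarrow> 'k"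
  where "\<And>f g. \<phi> (f + g) = \<phi> f + \<phi> g" "\<And>c f. \<phi> (cfun_scale c f) = c * \<phi> f"
    "\<And>f. inner (\<phi> f) 1 = \<psi> f"
proof -
  define \<phi> where "\<phi> f = (\<Sum>b\<in>Basis. \<psi> (cfun_scale (inverse b) f) *\<^sub>R b)" for f
  have sc: "cfun_scale (a + b) f = cfun_scale a f + cfun_scale b f"
    "cfun_scale (r *\<^sub>R a) f = r *\<^sub>R cfun_scale a f"
    "cfun_scale a (f + g) = cfun_scale a f + cfun_scale a g"
    "cfun_scale a (cfun_scale b f) = cfun_scale (a * b) f" "cfun_scale 1 f = f"
    for a b :: 'k and f g :: "'a \<Rightarrow>\<^sub>C 'k" and r
    by (auto intro!: bcontfun_eqI simp: algebra_simps)
  have csum: "cfun_scale (sum h B) f = (\<Sum>b\<in>B. cfun_scale (h b) f)" if "finite B"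
    for h B and f :: "'a \<Rightarrow>\<^sub>C 'k"
    using that by (induction B) (auto simp: sc intro!: bcontfun_eqI)
  have asum: "scalar_adj (sum h B) = (\<Sum>b\<in>B. scalar_adj (h b))" if "finite B" for h :: "'k \<Rightarrow> 'k" and B
    using that by induction (auto simp: scalar_adj_add scalar_adj_def[of 0])
  have inner: "inner (\<phi> f) z = \<psi> (cfun_scale (scalar_adj z) f)" for f z
  proof -
    have "inner (\<phi> f) z = (\<Sum>b\<in>Basis. inner z b * \<psi> (cfun_scale (inverse b) f))"
      unfolding \<phi>_def inner_sum_left inner_scaleR_left by (simp add: inner_commute mult.commute)
    also have "\<dots> = \<psi> (\<Sum>b\<in>Basis. cfun_scale (scalar_adj (inner z b *\<^sub>R b)) f)"
      by (simp add: linear_sum[OF \<psi>] scalar_adj_scaleR scalar_adj_Basis sc linear_scale[OF \<psi>])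
    also have "(\<Sum>b\<in>Basis. cfun_scale (scalar_adj (inner z b *\<^sub>R b)) f)
        = cfun_scale (scalar_adj z) f"
      by (simp only: csum[symmetric] asum[symmetric] finite_Basis euclidean_representation)
    finally show ?thesis .
  qed
  show ?thesis
  proof (rule that)
    show "\<phi> (f + g) = \<phi> f + \<phi> g" for f g
      by (simp add: vector_eq_rdot[symmetric, of "\<phi> (f + g)"] inner inner_add_left sc linear_add[OF \<psi>])
    show "\<phi> (cfun_scale c f) = c * \<phi> f" for c f
      by (simp add: vector_eq_rdot[symmetric, of "\<phi> (cfun_scale c f)"] inner inner_scalar_adj sc
          scalar_adj_mult scalar_adj_adj mult.commute)
    have "scalar_adj (1::'k) = 1" by (simp add: scalar_adj_def)
    then show "inner (\<phi> f) 1 = \<psi> f" for f by (simp add: inner sc)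
  qed
qed

section \<open>Positive functionals\<close>

text \<open>
  Positive functionals are represented by their values on nonnegative bounded continuous functions.
  On this cone the variation of a functional and the meet of two functionals have direct formulas.
\<close>

definition nonneg_bcont :: "('a::topological_space \<Rightarrow> real) set" where
  "nonneg_bcont = {g. continuous_on UNIV g \<and> (\<forall>x. 0 \<le> g x) \<and> (\<exists>c. \<forall>x. g x \<le> c)}"

lemma nonneg_bcontD:
  assumes "g \<in> nonneg_bcont"
  shows "continuous_on UNIV g" "0 \<le> g x"
  using assms by (auto simp: nonneg_bcont_def)

lemma nonneg_bcont_bound:
  assumes "g \<in> nonneg_bcont"
  obtains c where "0 \<le> c" "\<And>x. g x \<le> c"
proof -
  obtain c where "\<And>x. g x \<le> c" using assms by (auto simp: nonneg_bcont_def)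
  then show ?thesis using that[of "max 0 c"] by (simp add: le_max_iff_disj)
qed

lemma nonneg_bcontI:
  assumes "continuous_on UNIV g" "\<And>x. 0 \<le> g x" "\<And>x. g x \<le> c"
  shows "g \<in> nonneg_bcont"
  using assms by (auto simp: nonneg_bcont_def)

lemma nonneg_bcont_add [intro]:
  assumes "f \<in> nonneg_bcont" "g \<in> nonneg_bcont"
  shows "(\<lambda>x. f x + g x) \<in> nonneg_bcont"
proof -
  obtain c d where "\<And>x. f x \<le> c" "\<And>x. g x \<le> d" using assms by (meson nonneg_bcont_bound)
  then show ?thesis
    using assms by (intro nonneg_bcontI[of _ "c + d"] continuous_intros add_mono)
      (auto simp: nonneg_bcontD)
qed

lemma nonneg_bcont_smaller:
  assumes "f \<in> nonneg_bcont" "continuous_on UNIV g" "\<And>x. 0 \<le> g x" "\<And>x. g x \<le> f x"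
  shows "g \<in> nonneg_bcont"
proof -
  obtain c where "\<And>x. f x \<le> c" using assms by (meson nonneg_bcont_bound)
  then show ?thesis
    using assms by (intro nonneg_bcontI[of _ c]) (auto intro: order_trans)
qed

lemma nonneg_bcont_scale [intro]:
  assumes "f \<in> nonneg_bcont" "0 \<le> c"
  shows "(\<lambda>x. c * f x) \<in> nonneg_bcont"
proof -
  obtain d where "\<And>x. f x \<le> d" using assms by (meson nonneg_bcont_bound)
  then show ?thesis
    using assms by (intro nonneg_bcontI[of _ "c * d"] continuous_intros mult_left_mono)
      (auto simp: nonneg_bcontD)
qed

lemma nonneg_bcont_diff:
  assumes "f \<in> nonneg_bcont" "g \<in> nonneg_bcont" "\<And>x. g x \<le> f x"
  shows "(\<lambda>x. f x - g x) \<in> nonneg_bcont"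
  by (rule nonneg_bcont_smaller[OF assms(1)], intro continuous_intros)
    (use assms in \<open>auto simp: nonneg_bcontD\<close>)

lemma nonneg_bcont_const [intro, simp]: "0 \<le> c \<Longrightarrow> (\<lambda>_. c) \<in> nonneg_bcont"
  by (rule nonneg_bcontI) auto

abbreviation modulus :: "('a::topological_space \<Rightarrow>\<^sub>C 'k::real_normed_vector) \<Rightarrow> 'a \<Rightarrow> real" where
  "modulus f \<equiv> (\<lambda>x. norm (apply_bcontfun f x))"

lemma nonneg_bcont_norm [intro, simp]:
  "(modulus f) \<in> nonneg_bcont"
proof (rule nonneg_bcontI)
  show "continuous_on UNIV (modulus f)"
    by (rule continuous_on_norm) (rule continuous_on_apply_bcontfun)
  show "norm (apply_bcontfun f x) \<le> norm f" for x by (rule norm_bounded)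
qed (rule norm_ge_zero)

definition pos_functional :: "(('a::topological_space \<Rightarrow> real) \<Rightarrow> real) \<Rightarrow> bool" where
  "pos_functional u \<longleftrightarrow>
     (\<forall>f\<in>nonneg_bcont. \<forall>g\<in>nonneg_bcont. u (\<lambda>x. f x + g x) = u f + u g) \<and>
     (\<forall>f\<in>nonneg_bcont. \<forall>c\<ge>0. u (\<lambda>x. c * f x) = c * u f) \<and>
     (\<forall>f\<in>nonneg_bcont. 0 \<le> u f)"

lemma pos_functional_add:
    "pos_functional u \<Longrightarrow> f \<in> nonneg_bcont \<Longrightarrow> g \<in> nonneg_bcont \<Longrightarrow>
       u (\<lambda>x. f x + g x) = u f + u g"
  and pos_functional_scale:
    "pos_functional u \<Longrightarrow> f \<in> nonneg_bcont \<Longrightarrow> 0 \<le> c \<Longrightarrow> u (\<lambda>x. c * f x) = c * u f"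
  and pos_functional_nonneg: "pos_functional u \<Longrightarrow> f \<in> nonneg_bcont \<Longrightarrow> 0 \<le> u f"
  by (auto simp: pos_functional_def)

lemma pos_functional_mono:
  assumes u: "pos_functional u" and f: "f \<in> nonneg_bcont" and g: "g \<in> nonneg_bcont"
    and le: "\<And>x. f x \<le> g x"
  shows "u f \<le> u g"
proof -
  have d: "(\<lambda>x. g x - f x) \<in> nonneg_bcont" by (rule nonneg_bcont_diff[OF g f le])
  have "u (\<lambda>x. f x + (g x - f x)) = u f + u (\<lambda>x. g x - f x)"
    by (rule pos_functional_add[OF u f d])
  with pos_functional_nonneg[OF u d] show ?thesis by simp
qed

lemma pos_functional_le_const:
  assumes u: "pos_functional u" and f: "f \<in> nonneg_bcont" and le: "\<And>x. f x \<le> c"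
  shows "u f \<le> c * u (\<lambda>_. 1)"
proof -
  have c: "0 \<le> c" using nonneg_bcontD(2)[OF f] le order_trans by blast
  have "u f \<le> u (\<lambda>_. c * 1)"
    by (rule pos_functional_mono[OF u f]) (use c le in auto)
  also have "\<dots> = c * u (\<lambda>_. 1)" by (rule pos_functional_scale[OF u]) (use c in auto)
  finally show ?thesis .
qed

lemma pos_functional_norm_le:
  "pos_functional u \<Longrightarrow> u (modulus f) \<le> norm f * u (\<lambda>_. 1)"
  by (rule pos_functional_le_const) (auto intro: norm_bounded)

lemma pos_functional_diff_eq:
  assumes "pos_functional u" "f \<in> nonneg_bcont" "g \<in> nonneg_bcont" "\<And>x. g x \<le> f x"
  shows "u (\<lambda>x. f x - g x) = u f - u g"
  using pos_functional_add[OF assms(1,3) nonneg_bcont_diff[OF assms(2-4)]] by simp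

lemma pos_functional_zero [intro, simp]: "pos_functional (\<lambda>_. 0)"
  by (simp add: pos_functional_def)

lemma pos_functional_plus [intro]:
  "pos_functional u \<Longrightarrow> pos_functional v \<Longrightarrow> pos_functional (\<lambda>g. u g + v g)"
  by (simp add: pos_functional_def algebra_simps)

lemma pos_functional_mult [intro]: "pos_functional u \<Longrightarrow> 0 \<le> c \<Longrightarrow> pos_functional (\<lambda>g. c * u g)"
  by (auto simp add: pos_functional_def algebra_simps)

lemma pos_functional_sum:
  "finite I \<Longrightarrow> (\<And>i. i \<in> I \<Longrightarrow> pos_functional (u i)) \<Longrightarrow> pos_functional (\<lambda>g. \<Sum>i\<in>I. u i g)"
  by (induction rule: finite_induct) auto

lemma pos_functional_minus:
  assumes "pos_functional u" "pos_functional v" "\<And>g. g \<in> nonneg_bcont \<Longrightarrow> v g \<le> u g"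
  shows "pos_functional (\<lambda>g. u g - v g)"
  using assms by (auto simp: pos_functional_def algebra_simps)

text \<open>
  Applying the inequality for scaling to the inverse factor turns it into an equality.
\<close>

lemma pos_functionalI:
  assumes add: "\<And>f g. f \<in> nonneg_bcont \<Longrightarrow> g \<in> nonneg_bcont \<Longrightarrow> u (\<lambda>x. f x + g x) = u f + u g"
    and scale: "\<And>f c. f \<in> nonneg_bcont \<Longrightarrow> 0 < c \<Longrightarrow> u (\<lambda>x. c * f x) \<le> c * u f"
    and nonneg: "\<And>f. f \<in> nonneg_bcont \<Longrightarrow> 0 \<le> u f"
  shows "pos_functional u"
  unfolding pos_functional_def
proof (intro conjI ballI allI impI)
  fix f :: "'a \<Rightarrow> real" and c :: real assume f: "f \<in> nonneg_bcont" and c: "0 \<le> c"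
  show "u (\<lambda>x. c * f x) = c * u f"
  proof (cases "c = 0")
    case True
    have "u (\<lambda>x. 0 + 0) = u (\<lambda>x. 0) + u (\<lambda>x. 0)" by (rule add) auto
    then show ?thesis using True by simp
  next
    case False
    then have c: "0 < c" using c by simp
    have "u (\<lambda>x. inverse c * (c * f x)) \<le> inverse c * u (\<lambda>x. c * f x)"
      by (rule scale) (use f c in auto)
    moreover have "(\<lambda>x. inverse c * (c * f x)) = f" using c by auto
    ultimately have "c * u f \<le> u (\<lambda>x. c * f x)" using c by (simp add: field_simps)
    with scale[OF f c] show ?thesis by simp
  qed
qed (use add nonneg in auto)

section \<open>Meets and truncation of positive functionals\<close>

text \<open>
  The infimum of two positive functionals in the lattice of functionals (the Riesz-Kantorovich
  formula).
\<close>

definition meet :: "(('a::topological_space \<Rightarrow> real) \<Rightarrow> real) \<Rightarrow> (('a \<Rightarrow> real) \<Rightarrow> real) \<Rightarrow> ('a \<Rightarrow> real) \<Rightarrow> real"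
  where "meet p u g = (INF h\<in>{h\<in>nonneg_bcont. \<forall>x. h x \<le> g x}. p h + u (\<lambda>x. g x - h x))"

lemma meet_lower:
  assumes p: "pos_functional p" and u: "pos_functional u" and g: "g \<in> nonneg_bcont"
    and h: "h \<in> nonneg_bcont" "\<And>x. h x \<le> g x"
  shows "meet p u g \<le> p h + u (\<lambda>x. g x - h x)"
  unfolding meet_def
proof (rule cINF_lower)
  show "bdd_below ((\<lambda>h. p h + u (\<lambda>x. g x - h x)) ` {h \<in> nonneg_bcont. \<forall>x. h x \<le> g x})"
    using p u g by (intro bdd_belowI2[of _ 0])
      (auto intro!: add_nonneg_nonneg pos_functional_nonneg[OF p] pos_functional_nonneg[OF u] nonneg_bcont_diff)
qed (use h in auto)

lemma meet_greatest:
  assumes g: "g \<in> nonneg_bcont"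
    and le: "\<And>h. h \<in> nonneg_bcont \<Longrightarrow> (\<And>x. h x \<le> g x) \<Longrightarrow> c \<le> p h + u (\<lambda>x. g x - h x)"
  shows "c \<le> meet p u g"
  unfolding meet_def
proof (rule cINF_greatest)
  show "{h \<in> nonneg_bcont. \<forall>x. h x \<le> g x} \<noteq> {}" using g by blast
qed (use le in auto)

lemma pos_functional_at_zero: "pos_functional u \<Longrightarrow> u (\<lambda>_. 0) = 0"
  using pos_functional_scale[of u "\<lambda>_. 0" 0] by simp

lemma meet_le_left:
  assumes p: "pos_functional p" and u: "pos_functional u" and g: "g \<in> nonneg_bcont"
  shows "meet p u g \<le> p g"
  using meet_lower[OF p u g g] pos_functional_at_zero[OF u] by simp

lemma meet_le_right:
  assumes p: "pos_functional p" and u: "pos_functional u" and g: "g \<in> nonneg_bcont"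
  shows "meet p u g \<le> u g"
  using meet_lower[OF p u g, of "\<lambda>_. 0"] pos_functional_at_zero[OF p] nonneg_bcontD(2)[OF g] by simp

lemma meet_mono:
  assumes p: "pos_functional p" and u: "pos_functional u" and g: "g \<in> nonneg_bcont"
    and le: "\<And>h. h \<in> nonneg_bcont \<Longrightarrow> u h \<le> v h"
  shows "meet p u g \<le> meet p v g"
proof (rule meet_greatest[OF g])
  fix h :: "'a \<Rightarrow> real" assume h: "h \<in> nonneg_bcont" "\<And>x. h x \<le> g x"
  show "meet p u g \<le> p h + v (\<lambda>x. g x - h x)"
    using meet_lower[OF p u g h] le[OF nonneg_bcont_diff[OF g h]] by linarith
qed

text \<open>
  Superadditivity rests on Riesz decomposition: a function \<open>h \<le> f + g\<close> splits into \<open>min h f \<le> f\<close> and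
  a rest that is at most \<open>g\<close>.
\<close>

lemma pos_functional_meet:
  assumes p: "pos_functional p" and u: "pos_functional u"
  shows "pos_functional (meet p u)"
proof (rule pos_functionalI)
  fix f g :: "'a \<Rightarrow> real" assume f: "f \<in> nonneg_bcont" and g: "g \<in> nonneg_bcont"
  show "meet p u (\<lambda>x. f x + g x) = meet p u f + meet p u g"
  proof (rule antisym)
    have "meet p u (\<lambda>x. f x + g x) - (p h + u (\<lambda>x. f x - h x)) \<le> p k + u (\<lambda>x. g x - k x)"
      if h: "h \<in> nonneg_bcont" "\<And>x. h x \<le> f x" and k: "k \<in> nonneg_bcont" "\<And>x. k x \<le> g x" for h k
    proof -
      have "meet p u (\<lambda>x. f x + g x) \<le> p (\<lambda>x. h x + k x) + u (\<lambda>x. (f x + g x) - (h x + k x))"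
        by (rule meet_lower[OF p u]) (use f g h k in \<open>auto intro: add_mono\<close>)
      moreover have "u (\<lambda>x. (f x - h x) + (g x - k x)) = u (\<lambda>x. f x - h x) + u (\<lambda>x. g x - k x)"
        by (rule pos_functional_add[OF u]) (use f g h k in \<open>auto intro: nonneg_bcont_diff\<close>)
      moreover have "(\<lambda>x. (f x + g x) - (h x + k x)) = (\<lambda>x. (f x - h x) + (g x - k x))" by auto
      ultimately show ?thesis using pos_functional_add[OF p h(1) k(1)] by simp
    qed
    then have "meet p u (\<lambda>x. f x + g x) - (p h + u (\<lambda>x. f x - h x)) \<le> meet p u g"
      if "h \<in> nonneg_bcont" "\<And>x. h x \<le> f x" for h
      using that by (intro meet_greatest[OF g]) auto
    then have "meet p u (\<lambda>x. f x + g x) - meet p u g \<le> meet p u f"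
      by (intro meet_greatest[OF f]) (auto simp: algebra_simps)
    then show "meet p u (\<lambda>x. f x + g x) \<le> meet p u f + meet p u g" by simp
  next
    show "meet p u f + meet p u g \<le> meet p u (\<lambda>x. f x + g x)"
    proof (rule meet_greatest)
      show "(\<lambda>x. f x + g x) \<in> nonneg_bcont" using f g by auto
      fix h :: "'a \<Rightarrow> real" assume h: "h \<in> nonneg_bcont" "\<And>x. h x \<le> f x + g x"
      define h1 where "h1 x = min (h x) (f x)" for x
      define h2 where "h2 x = h x - h1 x" for x
      have h1: "h1 \<in> nonneg_bcont" "\<And>x. h1 x \<le> f x"
        unfolding h1_def
        by (rule nonneg_bcont_smaller[OF h(1)], intro continuous_intros)
          (use h f in \<open>auto simp: nonneg_bcontD\<close>)
      have h2: "h2 \<in> nonneg_bcont"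
        unfolding h2_def by (rule nonneg_bcont_diff[OF h(1) h1(1)]) (simp add: h1_def)
      have h2': "h2 x \<le> g x" for x
        using h(2)[of x] nonneg_bcontD(2)[OF g, of x] by (auto simp: h2_def h1_def)
      have "p (\<lambda>x. h1 x + h2 x) = p h1 + p h2" by (rule pos_functional_add[OF p h1(1) h2])
      then have ph: "p h = p h1 + p h2" by (simp add: h2_def)
      have "u (\<lambda>x. (f x - h1 x) + (g x - h2 x)) = u (\<lambda>x. f x - h1 x) + u (\<lambda>x. g x - h2 x)"
        by (rule pos_functional_add[OF u]) (use f g h1 h2 h2' in \<open>auto intro: nonneg_bcont_diff\<close>)
      moreover have "(\<lambda>x. (f x - h1 x) + (g x - h2 x)) = (\<lambda>x. f x + g x - h x)"
        by (auto simp: h2_def)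
      ultimately show "meet p u f + meet p u g \<le> p h + u (\<lambda>x. f x + g x - h x)"
        using ph meet_lower[OF p u f h1] meet_lower[OF p u g h2 h2'] by simp
    qed
  qed
next
  fix f :: "'a \<Rightarrow> real" and c :: real assume f: "f \<in> nonneg_bcont" and c: "0 < c"
  have "meet p u (\<lambda>x. c * f x) / c \<le> meet p u f"
  proof (rule meet_greatest[OF f])
    fix h :: "'a \<Rightarrow> real" assume h: "h \<in> nonneg_bcont" "\<And>x. h x \<le> f x"
    have "meet p u (\<lambda>x. c * f x) \<le> p (\<lambda>x. c * h x) + u (\<lambda>x. c * f x - c * h x)"
      by (rule meet_lower[OF p u]) (use f h c in auto)
    also have "(\<lambda>x. c * f x - c * h x) = (\<lambda>x. c * (f x - h x))" by (auto simp: algebra_simps)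
    also have "p (\<lambda>x. c * h x) + u \<dots> = c * (p h + u (\<lambda>x. f x - h x))"
      using c pos_functional_scale[OF p h(1), of c]
        pos_functional_scale[OF u nonneg_bcont_diff[OF f h], of c] by (simp add: algebra_simps)
    finally show "meet p u (\<lambda>x. c * f x) / c \<le> p h + u (\<lambda>x. f x - h x)"
      using c by (simp add: field_simps)
  qed
  then show "meet p u (\<lambda>x. c * f x) \<le> c * meet p u f" using c by (simp add: field_simps)
next
  fix f :: "'a \<Rightarrow> real" assume f: "f \<in> nonneg_bcont"
  show "0 \<le> meet p u f"
    by (rule meet_greatest[OF f])
      (use p u f in \<open>auto intro!: add_nonneg_nonneg pos_functional_nonneg[OF p] pos_functional_nonneg[OF u] nonneg_bcont_diff\<close>)
qed

lemma pos_functional_lim: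
  assumes pos: "\<And>n. pos_functional (a n)"
    and lim: "\<And>g. g \<in> nonneg_bcont \<Longrightarrow> (\<lambda>n. a n g) \<longlonglongrightarrow> v g"
  shows "pos_functional v"
proof (rule pos_functionalI)
  fix f g :: "'a \<Rightarrow> real" assume f: "f \<in> nonneg_bcont" and g: "g \<in> nonneg_bcont"
  have "(\<lambda>n. a n f + a n g) \<longlonglongrightarrow> v f + v g" by (intro tendsto_add lim f g)
  then have "(\<lambda>n. a n (\<lambda>x. f x + g x)) \<longlonglongrightarrow> v f + v g"
    by (simp add: pos_functional_add[OF pos f g])
  moreover have "(\<lambda>n. a n (\<lambda>x. f x + g x)) \<longlonglongrightarrow> v (\<lambda>x. f x + g x)"
    by (rule lim) (use f g in auto)
  ultimately show "v (\<lambda>x. f x + g x) = v f + v g" using LIMSEQ_unique by blast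
next
  fix f :: "'a \<Rightarrow> real" and c :: real assume f: "f \<in> nonneg_bcont" and c: "0 < c"
  have "(\<lambda>n. c * a n f) \<longlonglongrightarrow> c * v f" by (intro tendsto_intros lim f)
  then have "(\<lambda>n. a n (\<lambda>x. c * f x)) \<longlonglongrightarrow> c * v f"
    using c by (simp add: pos_functional_scale[OF pos f])
  moreover have "(\<lambda>n. a n (\<lambda>x. c * f x)) \<longlonglongrightarrow> v (\<lambda>x. c * f x)"
    by (rule lim) (use f c in auto)
  ultimately show "v (\<lambda>x. c * f x) \<le> c * v f" using LIMSEQ_unique by fastforce
next
  fix f :: "'a \<Rightarrow> real" assume f: "f \<in> nonneg_bcont"
  show "0 \<le> v f"
    using lim[OF f] by (rule LIMSEQ_le_const) (use pos_functional_nonneg[OF pos f] in auto)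
qed

text \<open>
  Moving along the segments between consecutive members of an increasing sequence, the mass varies
  continuously, so each value \<open>\<tau>\<close> is attained either on a segment or in the limit. The functional
  found there is comparable with all members of the sequence.
\<close>

lemma interpolate_pos_functionals:
  fixes a :: "nat \<Rightarrow> ('a::topological_space \<Rightarrow> real) \<Rightarrow> real"
  assumes pos: "\<And>n. pos_functional (a n)" and p: "pos_functional p"
    and mono: "\<And>n g. g \<in> nonneg_bcont \<Longrightarrow> a n g \<le> a (Suc n) g"
    and le: "\<And>n g. g \<in> nonneg_bcont \<Longrightarrow> a n g \<le> p g"
    and \<tau>: "0 \<le> \<tau>" "\<And>e. 0 < e \<Longrightarrow> \<exists>n. \<tau> - e \<le> a n (\<lambda>_. 1)"
  obtains v where "pos_functional v" "\<And>g. g \<in> nonneg_bcont \<Longrightarrow> v g \<le> p g" "v (\<lambda>_. 1) = \<tau>"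
    "\<And>n. (\<forall>g\<in>nonneg_bcont. v g \<le> a n g) \<or> (\<forall>g\<in>nonneg_bcont. a n g \<le> v g)"
proof -
  have mono': "a m g \<le> a n g" if "m \<le> n" "g \<in> nonneg_bcont" for m n g
    using that(1) by (rule lift_Suc_mono_le[of "\<lambda>n. a n g", rotated]) (rule mono[OF that(2)])
  show ?thesis
  proof (cases "\<exists>n. \<tau> \<le> a n (\<lambda>_. 1)")
    case True
    define N where "N = (LEAST n. \<tau> \<le> a n (\<lambda>_. 1))"
    have N: "\<tau> \<le> a N (\<lambda>_. 1)" unfolding N_def using True by (rule LeastI_ex)
    have N': "a n (\<lambda>_. 1) < \<tau>" if "n < N" for n
      using not_less_Least[of n "\<lambda>n. \<tau> \<le> a n (\<lambda>_. 1)"] that unfolding N_def by simp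
    define b where "b = (if N = 0 then (\<lambda>_. 0) else a (N - 1))"
    have b: "pos_functional b" by (simp add: b_def pos)
    have bN: "b g \<le> a N g" if "g \<in> nonneg_bcont" for g
      using that pos_functional_nonneg[OF pos that] mono'[of "N - 1" N g] by (simp add: b_def)
    have b\<tau>: "b (\<lambda>_. 1) \<le> \<tau>" using N'[of "N - 1"] \<tau>(1) by (cases "N = 0") (auto simp: b_def)
    \<comment> \<open>The weight \<open>l\<close> brings the convex combination of \<open>b\<close> and \<open>a N\<close> to the mass \<open>\<tau>\<close>. If \<open>D = 0\<close>, both have
      it already.\<close>
    define D where "D = a N (\<lambda>_. 1) - b (\<lambda>_. 1)"
    define l where "l = (if D = 0 then 0 else (\<tau> - b (\<lambda>_. 1)) / D)"
    have D: "0 \<le> D" using bN[of "\<lambda>_. 1"] by (simp add: D_def)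
    have l: "0 \<le> l" "l \<le> 1" "b (\<lambda>_. 1) + l * D = \<tau>"
      using D b\<tau> N by (auto simp: l_def D_def divide_simps)
    define v where "v g = (1 - l) * b g + l * a N g" for g
    have v: "pos_functional v"
      unfolding v_def using l pos b by (intro pos_functional_plus pos_functional_mult) auto
    have vb: "b g \<le> v g" and vN: "v g \<le> a N g" if "g \<in> nonneg_bcont" for g
    proof -
      have "v g - b g = l * (a N g - b g)" "a N g - v g = (1 - l) * (a N g - b g)"
        by (simp_all add: v_def algebra_simps)
      moreover have "0 \<le> l * (a N g - b g)" "0 \<le> (1 - l) * (a N g - b g)"
        using l bN[OF that] by simp_all
      ultimately show "b g \<le> v g" "v g \<le> a N g" by (metis diff_ge_0_iff_ge)+
    qed
    show ?thesis
    proof (rule that[OF v])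
      show "v g \<le> p g" if "g \<in> nonneg_bcont" for g
        using vN[OF that] le[OF that] order_trans by blast
      show "v (\<lambda>_. 1) = \<tau>" using l(3) by (simp add: v_def D_def algebra_simps)
      show "(\<forall>g\<in>nonneg_bcont. v g \<le> a n g) \<or> (\<forall>g\<in>nonneg_bcont. a n g \<le> v g)" for n
      proof (cases "N \<le> n")
        case True
        then show ?thesis using vN mono' order_trans by blast
      next
        case False
        then have "b = a (N - 1)" "n \<le> N - 1" by (auto simp: b_def)
        then show ?thesis using vb mono' order_trans by metis
      qed
    qed
  next
    case False
    define v where "v g = lim (\<lambda>n. a n g)" for g
    have lim: "(\<lambda>n. a n g) \<longlonglongrightarrow> v g" if g: "g \<in> nonneg_bcont" for g
    proof -
      have "convergent (\<lambda>n. a n g)"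
        by (rule Bseq_mono_convergent, rule BseqI'[of _ "p g"])
          (use le[OF g] pos_functional_nonneg[OF pos g] mono'[OF _ g] in auto)
      then show ?thesis unfolding v_def by (simp add: convergent_LIMSEQ_iff)
    qed
    have ge: "a n g \<le> v g" if g: "g \<in> nonneg_bcont" for n g
      by (rule incseq_le[OF _ lim[OF g]]) (use mono[OF g] in \<open>auto intro: incseq_SucI\<close>)
    show ?thesis
    proof (rule that[of v])
      show "pos_functional v" by (rule pos_functional_lim[OF pos lim])
      show "v g \<le> p g" if "g \<in> nonneg_bcont" for g
        using lim[OF that] by (rule LIMSEQ_le_const2) (use le[OF that] in auto)
      show "v (\<lambda>_. 1) = \<tau>"
      proof (rule antisym)
        have one: "(\<lambda>n. a n (\<lambda>_. 1)) \<longlonglongrightarrow> v (\<lambda>_. 1)" by (rule lim) auto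
        show "v (\<lambda>_. 1) \<le> \<tau>"
          using one by (rule LIMSEQ_le_const2) (use False in \<open>auto simp: not_le intro: less_imp_le\<close>)
        show "\<tau> \<le> v (\<lambda>_. 1)"
        proof (rule field_le_epsilon)
          fix e :: real assume "0 < e"
          then obtain n where "\<tau> - e \<le> a n (\<lambda>_. 1)" using \<tau>(2) by blast
          with ge[of "\<lambda>_. 1" n] show "\<tau> \<le> v (\<lambda>_. 1) + e" by simp
        qed
      qed
    qed (use ge in blast)
  qed
qed

text \<open>
  The functionals \<open>meet p (u n)\<close> increase and, by the hypothesis on the excess of \<open>p\<close> over \<open>u n\<close>, leave
  at most the mass \<open>r + \<epsilon> n\<close> of \<open>p\<close>. Interpolating between them gives \<open>v\<close> for which the mass left is at
  most \<open>r\<close>. Where \<open>v\<close> exceeds \<open>meet p (u n)\<close>, it does so by a positive functional of mass at most \<open>\<epsilon> n\<close>.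
\<close>

lemma truncate_pos_functional:
  fixes u :: "nat \<Rightarrow> ('a::topological_space \<Rightarrow> real) \<Rightarrow> real"
  assumes p: "pos_functional p" and u: "\<And>n. pos_functional (u n)"
    and mono: "\<And>n g. g \<in> nonneg_bcont \<Longrightarrow> u n g \<le> u (Suc n) g"
    and excess: "\<And>n h. h \<in> nonneg_bcont \<Longrightarrow> (\<And>x. h x \<le> 1) \<Longrightarrow> p h \<le> u n h + (r + \<epsilon> n)"
    and r: "0 \<le> r" and \<epsilon>: "\<And>n. 0 \<le> \<epsilon> n" "\<epsilon> \<longlonglongrightarrow> 0"
  obtains v where "pos_functional v" "\<And>g. g \<in> nonneg_bcont \<Longrightarrow> v g \<le> p g"
    "p (\<lambda>_. 1) - v (\<lambda>_. 1) \<le> r"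
    "\<And>n g c. g \<in> nonneg_bcont \<Longrightarrow> (\<And>x. g x \<le> c) \<Longrightarrow> v g \<le> u n g + \<epsilon> n * c"
proof -
  define a where "a n = meet p (u n)" for n
  \<comment> \<open>The mass that is to be kept; the maximum covers the case that \<open>p\<close> has mass less than \<open>r\<close>.\<close>
  define \<tau> where "\<tau> = max 0 (p (\<lambda>_. 1) - r)"
  have a: "pos_functional (a n)" for n unfolding a_def by (rule pos_functional_meet[OF p u])
  have au: "a n g \<le> u n g" if "g \<in> nonneg_bcont" for n g
    unfolding a_def by (rule meet_le_right[OF p u that])
  have mass: "\<tau> - \<epsilon> n \<le> a n (\<lambda>_. 1)" for n
  proof -
    have "p (\<lambda>_. 1) - (r + \<epsilon> n) \<le> a n (\<lambda>_. 1)"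
      unfolding a_def
    proof (rule meet_greatest)
      fix h :: "'a \<Rightarrow> real" assume h: "h \<in> nonneg_bcont" "\<And>x. h x \<le> 1"
      have "p (\<lambda>x. 1 - h x) \<le> u n (\<lambda>x. 1 - h x) + (r + \<epsilon> n)"
        by (rule excess, rule nonneg_bcont_diff) (use h in \<open>auto simp: nonneg_bcontD\<close>)
      moreover have "p (\<lambda>x. 1 - h x) = p (\<lambda>_. 1) - p h"
        by (rule pos_functional_diff_eq[OF p]) (use h in auto)
      ultimately show "p (\<lambda>_. 1) - (r + \<epsilon> n) \<le> p h + u n (\<lambda>x. 1 - h x)" by simp
    qed auto
    moreover have "0 \<le> a n (\<lambda>_. 1)" by (rule pos_functional_nonneg[OF a]) auto
    ultimately show ?thesis using \<epsilon>(1)[of n] by (simp add: \<tau>_def)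
  qed
  have ex: "\<exists>n. \<tau> - e \<le> a n (\<lambda>_. 1)" if "0 < e" for e
  proof -
    have "eventually (\<lambda>n. \<epsilon> n < e) sequentially" by (rule order_tendstoD(2)[OF \<epsilon>(2) that])
    then obtain n where "\<epsilon> n < e" by (auto simp: eventually_sequentially)
    with mass[of n] show ?thesis by (intro exI[of _ n]) simp
  qed
  have amono: "a n g \<le> a (Suc n) g" and ap: "a n g \<le> p g" if "g \<in> nonneg_bcont" for n g
    unfolding a_def by (rule meet_mono[OF p u that mono], assumption) (rule meet_le_left[OF p u that])
  have \<tau>0: "0 \<le> \<tau>" by (simp add: \<tau>_def)
  show ?thesis
  proof (rule interpolate_pos_functionals[OF a p amono ap \<tau>0 ex])
    fix v assume v: "pos_functional v" "\<And>g. g \<in> nonneg_bcont \<Longrightarrow> v g \<le> p g"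
      "v (\<lambda>_. 1) = \<tau>"
      and cmp: "\<And>n. (\<forall>g\<in>nonneg_bcont. v g \<le> a n g) \<or> (\<forall>g\<in>nonneg_bcont. a n g \<le> v g)"
    show thesis
  proof (rule that[OF v(1,2)])
    show "p (\<lambda>_. 1) - v (\<lambda>_. 1) \<le> r" by (simp add: v(3) \<tau>_def)
    fix n c and g :: "'a \<Rightarrow> real" assume g: "g \<in> nonneg_bcont" and c: "\<And>x. g x \<le> c"
    have c0: "0 \<le> c" using nonneg_bcontD(2)[OF g] c order_trans by blast
    from cmp[of n] show "v g \<le> u n g + \<epsilon> n * c"
    proof
      assume "\<forall>g\<in>nonneg_bcont. v g \<le> a n g"
      then show ?thesis using g au[OF g, of n] \<epsilon>(1)[of n] c0 by (force intro: add_increasing2)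
    next
      assume "\<forall>g\<in>nonneg_bcont. a n g \<le> v g"
      then have "pos_functional (\<lambda>g. v g - a n g)" using v(1) a by (intro pos_functional_minus) auto
      from pos_functional_le_const[OF this g c]
      have "v g - a n g \<le> c * (\<tau> - a n (\<lambda>_. 1))" by (simp add: v(3))
      also have "\<dots> \<le> c * \<epsilon> n" by (rule mult_left_mono[OF _ c0]) (use mass[of n] in simp)
      finally show ?thesis using au[OF g, of n] by (simp add: mult.commute)
    qed
  qed auto
  qed
qed

section \<open>The dual of the space of continuous functions\<close>

abbreviation dual_pairing ::
    "('a::topological_space, 'k::real_normed_field) cfun_dual \<Rightarrow> ('a \<Rightarrow>\<^sub>C 'k) \<Rightarrow> 'k"
    ("\<langle>_, _\<rangle>") where
  "\<langle>m, f\<rangle> \<equiv> blinfun_apply (functional_of_dual m) f"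

lemma dual_pairing_scale_right: "\<langle>m, cfun_scale c f\<rangle> = c * \<langle>m, f\<rangle>"
  using functional_of_dual[of m] by (simp add: linear_cfun_functional_iff)

lemma dual_pairing_left:
  "\<langle>m + n, f\<rangle> = \<langle>m, f\<rangle> + \<langle>n, f\<rangle>" "\<langle>m - n, f\<rangle> = \<langle>m, f\<rangle> - \<langle>n, f\<rangle>" "\<langle>r *\<^sub>R m, f\<rangle> = r *\<^sub>R \<langle>m, f\<rangle>"
  "\<langle>0, f\<rangle> = 0" "\<langle>- m, f\<rangle> = - \<langle>m, f\<rangle>"
  by (simp_all add: plus_cfun_dual.rep_eq minus_cfun_dual.rep_eq scaleR_cfun_dual.rep_eq
      zero_cfun_dual.rep_eq uminus_cfun_dual.rep_eq blinfun.bilinear_simps)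

lemmas dual_pairing_simps = dual_pairing_scale_right dual_pairing_left functional_of_dual_scale
  blinfun.add_right blinfun.diff_right blinfun.scaleR_right blinfun.minus_right blinfun.zero_right

lemma dual_eqI: "(\<And>f. \<langle>m, f\<rangle> = \<langle>n, f\<rangle>) \<Longrightarrow> m = n"
  by (rule functional_of_dual_inject[THEN iffD1], rule blinfun_eqI)

lemma norm_dual_pairing: "norm \<langle>m, f\<rangle> \<le> norm m * norm f"
  unfolding norm_cfun_dual.rep_eq by (rule norm_blinfun)

lemma norm_dual_le:
  assumes "0 \<le> c" "\<And>f. norm \<langle>m, f\<rangle> \<le> c * norm f"
  shows "norm m \<le> c"
  unfolding norm_cfun_dual.rep_eq by (rule norm_blinfun_bound) (use assms in auto)

lemma cfun_scale_of_real: "cfun_scale (of_real r) f = r *\<^sub>R f"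
  by (rule bcontfun_eqI) (simp add: scaleR_conv_of_real)

lemma cfun_scale_simps:
  "cfun_scale c (f + g) = cfun_scale c f + cfun_scale c g"
  "cfun_scale c (f - g) = cfun_scale c f - cfun_scale c g"
  "cfun_scale c (cfun_scale d f) = cfun_scale (c * d) f" "cfun_scale 1 f = f"
  by (auto intro!: bcontfun_eqI simp: algebra_simps)

lemma norm_cfun_scale: "norm (cfun_scale c f) = norm c * norm f"
proof (rule antisym)
  have le: "norm (cfun_scale c f) \<le> norm c * norm f" for c :: 'b and f :: "'a \<Rightarrow>\<^sub>C 'b"
    by (rule norm_bound) (simp add: norm_mult mult_left_mono norm_bounded)
  show "norm (cfun_scale c f) \<le> norm c * norm f" by (rule le)
  show "norm c * norm f \<le> norm (cfun_scale c f)"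
  proof (cases "c = 0")
    case False
    have "norm (cfun_scale (inverse c) (cfun_scale c f)) \<le> norm (inverse c) * norm (cfun_scale c f)"
      by (rule le)
    then have "norm f \<le> inverse (norm c) * norm (cfun_scale c f)"
      using False by (simp add: cfun_scale_simps norm_inverse)
    then show ?thesis using False by (simp add: field_simps)
  qed simp
qed

lemma dual_exists:
  fixes h :: "('a::topological_space \<Rightarrow>\<^sub>C 'k::real_normed_field) \<Rightarrow> 'k"
  assumes add: "\<And>f g. h (f + g) = h f + h g" and scale: "\<And>c f. h (cfun_scale c f) = c * h f"
    and bound: "0 \<le> b" "\<And>f. norm (h f) \<le> b * norm f"
  obtains m where "\<And>f. \<langle>m, f\<rangle> = h f" "norm m \<le> b"
proof -
  have bl: "bounded_linear h"
  proof (rule bounded_linear_intro)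
    show "h (r *\<^sub>R x) = r *\<^sub>R h x" for r x
      using scale[of "of_real r" x] by (simp add: cfun_scale_of_real scaleR_conv_of_real)
    show "norm (h x) \<le> norm x * b" for x using bound(2)[of x] by (simp add: mult.commute)
  qed (rule add)
  define m where "m = dual_of_functional (Blinfun h)"
  have "functional_of_dual m = Blinfun h"
    unfolding m_def by (rule dual_of_functional_inverse)
      (simp add: linear_cfun_functional_iff bounded_linear_Blinfun_apply[OF bl] scale)
  then have m: "\<langle>m, f\<rangle> = h f" for f by (simp add: bounded_linear_Blinfun_apply[OF bl])
  show ?thesis
    by (rule that[OF m], rule norm_dual_le) (simp_all add: m bound)
qed

definition point_eval :: "'a::topological_space \<Rightarrow> ('a, 'k::real_normed_field) cfun_dual" where
  "point_eval t = (SOME m. (\<forall>f. \<langle>m, f\<rangle> = apply_bcontfun f t) \<and> norm m \<le> 1)"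

lemma
  fixes t :: "'a::topological_space" and f :: "'a \<Rightarrow>\<^sub>C 'k::real_normed_field"
  shows point_eval: "\<langle>point_eval t, f\<rangle> = apply_bcontfun f t"
    and norm_point_eval: "norm (point_eval t :: ('a, 'k) cfun_dual) \<le> 1"
proof -
  have "\<exists>m :: ('a, 'k) cfun_dual. (\<forall>f. \<langle>m, f\<rangle> = apply_bcontfun f t) \<and> norm m \<le> 1"
    by (rule dual_exists[of "\<lambda>f :: 'a \<Rightarrow>\<^sub>C 'k. apply_bcontfun f t" 1]) (auto simp: norm_bounded)
  from someI_ex[OF this] show "norm (point_eval t :: ('a, 'k) cfun_dual) \<le> 1"
    and "\<langle>point_eval t, f\<rangle> = apply_bcontfun f t"
    unfolding point_eval_def by auto
qed

section \<open>Total variation\<close>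

text \<open>
  The total variation \<open>|m|\<close>, the least positive functional with \<open>|m f| \<le> |m| |f|\<close>.
\<close>

definition variation :: "('a::topological_space, 'k::real_normed_field) cfun_dual \<Rightarrow> ('a \<Rightarrow> real) \<Rightarrow> real" where
  "variation m g = (SUP f\<in>{f. \<forall>x. norm (apply_bcontfun f x) \<le> g x}. norm \<langle>m, f\<rangle>)"

lemma variation_upper:
  fixes m :: "('a::topological_space, 'k::real_normed_field) cfun_dual"
  assumes g: "g \<in> nonneg_bcont" and f: "\<And>x. norm (apply_bcontfun f x) \<le> g x"
  shows "norm \<langle>m, f\<rangle> \<le> variation m g"
  unfolding variation_def
proof (rule cSUP_upper)
  obtain c where c: "0 \<le> c" "\<And>x. g x \<le> c" using g by (rule nonneg_bcont_bound) blast
  show "bdd_above ((\<lambda>f. norm \<langle>m, f\<rangle>) ` {f. \<forall>x. norm (apply_bcontfun f x) \<le> g x})"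
  proof (rule bdd_aboveI2)
    fix f :: "'a \<Rightarrow>\<^sub>C 'k" assume "f \<in> {f. \<forall>x. norm (apply_bcontfun f x) \<le> g x}"
    then have "norm f \<le> c" using c by (intro norm_bound) (auto intro: order_trans)
    then show "norm \<langle>m, f\<rangle> \<le> norm m * c"
      using norm_dual_pairing[of m f] by (meson mult_left_mono norm_ge_zero order_trans)
  qed
qed (use f in simp)

lemma variation_least:
  assumes g: "g \<in> nonneg_bcont"
    and "\<And>f. (\<And>x. norm (apply_bcontfun f x) \<le> g x) \<Longrightarrow> norm \<langle>m, f\<rangle> \<le> c"
  shows "variation m g \<le> c"
  unfolding variation_def
proof (rule cSUP_least)
  show "{f. \<forall>x. norm (apply_bcontfun f x) \<le> g x} \<noteq> {}"
    using nonneg_bcontD(2)[OF g] by (auto intro!: exI[of _ 0])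
qed (use assms in auto)

lemma norm_pairing_le_variation: "norm \<langle>m, f\<rangle> \<le> variation m (modulus f)"
  by (rule variation_upper) auto

lemma bcontfun_real_multiple:
  fixes f :: "'a::topological_space \<Rightarrow>\<^sub>C 'k::real_normed_vector"
  assumes "continuous_on UNIV w" "\<And>x. \<bar>w x\<bar> \<le> c"
  obtains g where "\<And>x. apply_bcontfun g x = w x *\<^sub>R apply_bcontfun f x"
proof -
  have "(\<lambda>x. w x *\<^sub>R apply_bcontfun f x) \<in> bcontfun"
  proof (rule bcontfun_normI)
    show "continuous_on UNIV (\<lambda>x. w x *\<^sub>R apply_bcontfun f x)"
      by (intro continuous_on_scaleR assms continuous_on_apply_bcontfun)
    show "norm (w x *\<^sub>R apply_bcontfun f x) \<le> c * norm f" for x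
      using assms(2)[of x] by (simp, intro mult_mono norm_bounded) auto
  qed
  then show ?thesis using that by (metis Bcontfun_inverse)
qed

text \<open>
  A function with \<open>|f| \<le> g + h\<close> splits in the ratio \<open>g : h\<close>. The ratio is undefined where \<open>g + h\<close>
  vanishes, hence the summand \<open>\<eta>\<close> in the denominator; the part of \<open>f\<close> that this loses has norm at
  most \<open>\<eta>\<close>.
\<close>

lemma variation_add_le:
  fixes m :: "('a::topological_space, 'k::real_normed_field) cfun_dual"
  assumes g: "g \<in> nonneg_bcont" and h: "h \<in> nonneg_bcont"
  shows "variation m (\<lambda>x. g x + h x) \<le> variation m g + variation m h"
proof (rule variation_least)
  show "(\<lambda>x. g x + h x) \<in> nonneg_bcont" using g h by auto
  fix f :: "'a \<Rightarrow>\<^sub>C 'k" assume f: "\<And>x. norm (apply_bcontfun f x) \<le> g x + h x"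
  have g0: "0 \<le> g x" and h0: "0 \<le> h x" for x using g h by (auto simp: nonneg_bcontD)
  have part: "\<exists>a. (\<forall>x. apply_bcontfun a x = (k x / (g x + h x + \<eta>)) *\<^sub>R apply_bcontfun f x) \<and>
      (\<forall>x. norm (apply_bcontfun a x) \<le> k x)"
    if \<eta>: "0 < \<eta>" and k: "continuous_on UNIV k" "\<And>x. 0 \<le> k x" "\<And>x. k x \<le> g x + h x + \<eta>" for k \<eta>
  proof -
    have pos: "0 < g x + h x + \<eta>" for x using \<eta> g0[of x] h0[of x] by linarith
    have "continuous_on UNIV (\<lambda>x. k x / (g x + h x + \<eta>))"
      using k g h pos by (intro continuous_intros) (auto simp: nonneg_bcontD less_imp_neq[symmetric])
    moreover have "\<bar>k x / (g x + h x + \<eta>)\<bar> \<le> 1" for x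
      using k(2,3)[of x] pos[of x] by simp
    ultimately obtain a where a: "\<And>x. apply_bcontfun a x = (k x / (g x + h x + \<eta>)) *\<^sub>R apply_bcontfun f x"
      using bcontfun_real_multiple by blast
    have "norm (apply_bcontfun a x) \<le> k x" for x
    proof -
      have "norm (apply_bcontfun a x) = k x * norm (apply_bcontfun f x) / (g x + h x + \<eta>)"
        using k(2)[of x] pos[of x] by (simp add: a)
      also have "\<dots> \<le> k x * (g x + h x + \<eta>) / (g x + h x + \<eta>)"
        using k(2)[of x] pos[of x] f[of x] \<eta> by (intro divide_right_mono mult_left_mono) auto
      finally show ?thesis using pos[of x] by simp
    qed
    with a show ?thesis by blast
  qed
  have approx: "norm \<langle>m, f\<rangle> \<le> variation m g + variation m h + norm m * \<eta>" if \<eta>: "0 < \<eta>" for \<eta>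
  proof -
    have le: "g x \<le> g x + h x + \<eta>" "h x \<le> g x + h x + \<eta>" "\<eta> \<le> g x + h x + \<eta>" for x
      using g0[of x] h0[of x] \<eta> by simp_all
    obtain a where a: "\<And>x. apply_bcontfun a x = (g x / (g x + h x + \<eta>)) *\<^sub>R apply_bcontfun f x"
      "\<And>x. norm (apply_bcontfun a x) \<le> g x"
      using part[OF \<eta> nonneg_bcontD(1)[OF g] g0 le(1)] by blast
    obtain b where b: "\<And>x. apply_bcontfun b x = (h x / (g x + h x + \<eta>)) *\<^sub>R apply_bcontfun f x"
      "\<And>x. norm (apply_bcontfun b x) \<le> h x"
      using part[OF \<eta> nonneg_bcontD(1)[OF h] h0 le(2)] by blast
    obtain c where c: "\<And>x. apply_bcontfun c x = (\<eta> / (g x + h x + \<eta>)) *\<^sub>R apply_bcontfun f x"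
      "\<And>x. norm (apply_bcontfun c x) \<le> \<eta>"
      using part[OF \<eta> continuous_on_const less_imp_le[OF \<eta>] le(3)] by blast
    have "f = a + b + c"
    proof (rule bcontfun_eqI)
      fix x
      have "g x + h x + \<eta> \<noteq> 0" using \<eta> g0[of x] h0[of x] by linarith
      then show "apply_bcontfun f x = apply_bcontfun (a + b + c) x"
        by (simp add: a b c scaleR_add_left[symmetric] add_divide_distrib[symmetric])
    qed
    then have "norm \<langle>m, f\<rangle> \<le> norm \<langle>m, a\<rangle> + norm \<langle>m, b\<rangle> + norm \<langle>m, c\<rangle>"
      by (simp add: dual_pairing_simps norm_triangle_le norm_triangle_mono)
    moreover have "norm \<langle>m, a\<rangle> \<le> variation m g" by (rule variation_upper[OF g a(2)])
    moreover have "norm \<langle>m, b\<rangle> \<le> variation m h" by (rule variation_upper[OF h b(2)])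
    moreover have "norm \<langle>m, c\<rangle> \<le> norm m * \<eta>"
      using norm_dual_pairing[of m c] norm_bound[of c \<eta>, OF c(2)]
      by (meson mult_left_mono norm_ge_zero order_trans)
    ultimately show ?thesis by linarith
  qed
  show "norm \<langle>m, f\<rangle> \<le> variation m g + variation m h"
  proof (rule field_le_epsilon)
    fix e :: real assume e: "0 < e"
    define \<eta> where "\<eta> = e / (norm m + 1)"
    have n: "0 < norm m + 1" using norm_ge_zero[of m] by linarith
    have "0 < \<eta>" using e n by (simp add: \<eta>_def)
    moreover have "norm m * \<eta> \<le> (norm m + 1) * \<eta>"
      using \<open>0 < \<eta>\<close> by (intro mult_right_mono) auto
    then have "norm m * \<eta> \<le> e" using n by (simp add: \<eta>_def)
    ultimately show "norm \<langle>m, f\<rangle> \<le> variation m g + variation m h + e"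
      using approx[of \<eta>] by simp
  qed
qed

lemma pos_functional_variation:
  fixes m :: "('a::topological_space, 'k::{real_normed_field, euclidean_space}) cfun_dual"
  shows "pos_functional (variation m)"
proof (rule pos_functionalI)
  fix g h :: "'a \<Rightarrow> real" assume g: "g \<in> nonneg_bcont" and h: "h \<in> nonneg_bcont"
  show "variation m (\<lambda>x. g x + h x) = variation m g + variation m h"
  proof (rule antisym)
    have "norm \<langle>m, a\<rangle> \<le> variation m (\<lambda>x. g x + h x) - norm \<langle>m, b\<rangle>"
      if a: "\<And>x. norm (apply_bcontfun a x) \<le> g x" and b: "\<And>x. norm (apply_bcontfun b x) \<le> h x"
      for a b :: "'a \<Rightarrow>\<^sub>C 'k"
    proof -
      obtain d e where d: "norm d = 1" "d * \<langle>m, a\<rangle> = of_real (norm \<langle>m, a\<rangle>)"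
        and e: "norm e = 1" "e * \<langle>m, b\<rangle> = of_real (norm \<langle>m, b\<rangle>)"
        using unit_rotation[of "\<langle>m, a\<rangle>"] unit_rotation[of "\<langle>m, b\<rangle>"] by metis
      have "norm \<langle>m, cfun_scale d a + cfun_scale e b\<rangle> \<le> variation m (\<lambda>x. g x + h x)"
      proof (rule variation_upper)
        show "norm (apply_bcontfun (cfun_scale d a + cfun_scale e b) x) \<le> g x + h x" for x
          using norm_triangle_ineq[of "d * apply_bcontfun a x" "e * apply_bcontfun b x"] a[of x] b[of x]
          by (simp add: norm_mult d e)
      qed (use g h in auto)
      moreover have "\<langle>m, cfun_scale d a + cfun_scale e b\<rangle> = of_real (norm \<langle>m, a\<rangle> + norm \<langle>m, b\<rangle>)"
        by (simp add: dual_pairing_simps d e)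
      ultimately show ?thesis by (simp del: of_real_add)
    qed
    then have "variation m g \<le> variation m (\<lambda>x. g x + h x) - norm \<langle>m, b\<rangle>"
      if "\<And>x. norm (apply_bcontfun b x) \<le> h x" for b
      using that by (intro variation_least[OF g]) auto
    then have "variation m h \<le> variation m (\<lambda>x. g x + h x) - variation m g"
      by (intro variation_least[OF h]) (auto simp: algebra_simps)
    then show "variation m g + variation m h \<le> variation m (\<lambda>x. g x + h x)" by simp
  qed (rule variation_add_le[OF g h])
next
  fix g :: "'a \<Rightarrow> real" and c :: real assume g: "g \<in> nonneg_bcont" and c: "0 < c"
  show "variation m (\<lambda>x. c * g x) \<le> c * variation m g"
  proof (rule variation_least)
    show "(\<lambda>x. c * g x) \<in> nonneg_bcont" using g c by auto
    fix f :: "'a \<Rightarrow>\<^sub>C 'k" assume f: "\<And>x. norm (apply_bcontfun f x) \<le> c * g x"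
    have "norm \<langle>m, inverse c *\<^sub>R f\<rangle> \<le> variation m g"
      by (rule variation_upper[OF g]) (use f c in \<open>simp add: field_simps\<close>)
    then show "norm \<langle>m, f\<rangle> \<le> c * variation m g" using c by (simp add: dual_pairing_simps field_simps)
  qed
next
  fix g :: "'a \<Rightarrow> real" assume g: "g \<in> nonneg_bcont"
  show "0 \<le> variation m g"
    using variation_upper[OF g, of 0 m] nonneg_bcontD(2)[OF g] by (simp add: dual_pairing_simps)
qed

section \<open>Decomposition and truncation of functionals\<close>

text \<open>
  Apply the sandwich theorem to the real part of \<open>m\<close> and pass back to scalar-valued functionals. A
  bound on the real part by a seminorm is a bound on the modulus, since a unit scalar rotates each
  value to its modulus.
\<close>

lemma dual_decomposition:
  fixes m :: "('a::topological_space, 'k::{real_normed_field, euclidean_space}) cfun_dual"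
  assumes m: "\<And>f. norm \<langle>m, f\<rangle> \<le> p f + q f"
    and p: "\<And>f g. p (f + g) \<le> p f + p g" "\<And>c f. p (cfun_scale c f) = norm c * p f"
    and q: "\<And>f g. q (f + g) \<le> q f + q g" "\<And>c f. q (cfun_scale c f) = norm c * q f"
    and b: "0 \<le> b" "\<And>f. p f \<le> b * norm f"
  obtains n where "\<And>f. norm \<langle>n, f\<rangle> \<le> p f" "\<And>f. norm \<langle>m - n, f\<rangle> \<le> q f"
proof -
  have sub: "sublinear p" if "\<And>f g. p (f + g) \<le> p f + p g" "\<And>c f. p (cfun_scale c f) = norm c * p f"
    for p :: "('a \<Rightarrow>\<^sub>C 'k) \<Rightarrow> real"
    using that(2)[of "of_real _"] by (simp add: sublinear_def that(1) cfun_scale_of_real)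
  have "linear (\<lambda>f. inner \<langle>m, f\<rangle> 1)"
    by (rule linearI) (simp_all add: dual_pairing_simps inner_add_left)
  moreover have "inner \<langle>m, f\<rangle> 1 \<le> p f + q f" for f
    using inner_one_le_norm m order_trans by blast
  ultimately obtain \<psi> where \<psi>: "linear \<psi>" "\<And>f. \<psi> f \<le> p f" "\<And>f. inner \<langle>m, f\<rangle> 1 - \<psi> f \<le> q f"
    using Hahn_Banach_sandwich[OF sub[OF p] sub[OF q]] by blast
  obtain h :: "('a \<Rightarrow>\<^sub>C 'k) \<Rightarrow> 'k" where h: "\<And>f g. h (f + g) = h f + h g"
      "\<And>c f. h (cfun_scale c f) = c * h f" "\<And>f. inner (h f) 1 = \<psi> f"
    using linear_functional_with_real_part[OF \<psi>(1)] by metis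
  have real: "norm (l f) \<le> p f"
    if l: "\<And>c f. l (cfun_scale c f) = c * l f" "\<And>f. inner (l f) 1 \<le> p f" 
      and p: "\<And>c f. p (cfun_scale c f) = norm c * p f"
    for l :: "('a \<Rightarrow>\<^sub>C 'k) \<Rightarrow> 'k" and p f
  proof -
    obtain e where e: "norm e = 1" "e * l f = of_real (norm (l f))" by (rule unit_rotation)
    have "inner (l (cfun_scale e f)) 1 \<le> p (cfun_scale e f)" by (rule l(2))
    then show ?thesis by (simp add: l(1) e p inner_of_real_one)
  qed
  have hp: "norm (h f) \<le> p f" for f
    by (rule real[OF h(2) _ p(2)]) (simp add: h(3) \<psi>(2))
  then have "norm (h f) \<le> b * norm f" for f using b(2) order_trans by blast
  then obtain n where n: "\<And>f. \<langle>n, f\<rangle> = h f" using dual_exists[OF h(1,2) b(1)] by blast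
  have "norm \<langle>m - n, f\<rangle> \<le> q f" for f
    by (rule real[OF _ _ q(2)])
      (use \<psi>(3) in \<open>simp_all add: dual_pairing_simps n h inner_diff_left right_diff_distrib\<close>)
  then show ?thesis by (rule that[of n, rotated]) (simp add: n hp)
qed

lemma pos_functional_seminorm:
  fixes f g :: "'a::topological_space \<Rightarrow>\<^sub>C 'k::real_normed_field"
  assumes u: "pos_functional u"
  shows "u (modulus (f + g))
      \<le> u (modulus f) + u (modulus g)"
    and "u (modulus (cfun_scale c f)) = norm c * u (modulus f)"
proof -
  have "u (modulus (f + g))
      \<le> u (\<lambda>x. norm (apply_bcontfun f x) + norm (apply_bcontfun g x))"
    by (rule pos_functional_mono[OF u nonneg_bcont_norm nonneg_bcont_add[OF nonneg_bcont_norm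
            nonneg_bcont_norm]]) (simp add: norm_triangle_ineq)
  also have "\<dots> = u (modulus f) + u (modulus g)"
    by (rule pos_functional_add[OF u]) auto
  finally show "u (modulus (f + g))
      \<le> u (modulus f) + u (modulus g)" .
  show "u (modulus (cfun_scale c f)) = norm c * u (modulus f)"
    using pos_functional_scale[OF u, of "\<lambda>x. norm (apply_bcontfun f x)" "norm c"]
    by (simp add: norm_mult)
qed

lemma dual_decomposition_pos:
  fixes m :: "('a::topological_space, 'k::{real_normed_field, euclidean_space}) cfun_dual"
  assumes u: "pos_functional u" and v: "pos_functional v"
    and m: "\<And>f. norm \<langle>m, f\<rangle> \<le> u (modulus f) + v (modulus f)"
  obtains n where "\<And>f. norm \<langle>n, f\<rangle> \<le> u (modulus f)"
    "\<And>f. norm \<langle>m - n, f\<rangle> \<le> v (modulus f)"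
proof (rule dual_decomposition[OF m pos_functional_seminorm[OF u] pos_functional_seminorm[OF v]])
  show "0 \<le> u (\<lambda>_. 1)" by (rule pos_functional_nonneg[OF u]) auto
  show "u (modulus f) \<le> u (\<lambda>_. 1) * norm f" for f :: "'a \<Rightarrow>\<^sub>C 'k"
    using pos_functional_norm_le[OF u, of f] by (simp add: mult.commute)
qed (rule that)

lemma dual_decomposition_norm:
  fixes m :: "('a::topological_space, 'k::{real_normed_field, euclidean_space}) cfun_dual"
  assumes u: "pos_functional u" and c: "0 \<le> c"
    and m: "\<And>f. norm \<langle>m, f\<rangle> \<le> u (modulus f) + c * norm f"
  obtains n where "\<And>f. norm \<langle>n, f\<rangle> \<le> u (modulus f)" "norm (m - n) \<le> c"
proof -
  have "c * norm (f + g) \<le> c * norm f + c * norm g" for f g :: "'a \<Rightarrow>\<^sub>C 'k"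
    using mult_left_mono[OF norm_triangle_ineq[of f g] c] by (simp add: distrib_left)
  moreover have "c * norm (cfun_scale d f) = norm d * (c * norm f)" for d and f :: "'a \<Rightarrow>\<^sub>C 'k"
    by (simp add: norm_cfun_scale)
  moreover have "0 \<le> u (\<lambda>_. 1)" by (rule pos_functional_nonneg[OF u]) auto
  moreover have "u (modulus f) \<le> u (\<lambda>_. 1) * norm f" for f :: "'a \<Rightarrow>\<^sub>C 'k"
    using pos_functional_norm_le[OF u, of f] by (simp add: mult.commute)
  ultimately obtain n where "\<And>f. norm \<langle>n, f\<rangle> \<le> u (modulus f)"
      "\<And>f. norm \<langle>m - n, f\<rangle> \<le> c * norm f"
    using dual_decomposition[OF m pos_functional_seminorm[OF u]] by metis
  then show ?thesis using that norm_dual_le[OF c] by blast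
qed

text \<open>
  The variation of \<open>m\<close> is truncated as a positive functional, and \<open>m\<close> itself is then decomposed
  along \<open>variation m = v + (variation m - v)\<close>.
\<close>

lemma truncate_dual:
  fixes m :: "('a::topological_space, 'k::{real_normed_field, euclidean_space}) cfun_dual"
  assumes u: "\<And>n. pos_functional (u n)"
    and mono: "\<And>n g. g \<in> nonneg_bcont \<Longrightarrow> u n g \<le> u (Suc n) g"
    and m: "\<And>n f. norm \<langle>m, f\<rangle> \<le> u n (modulus f) + (r + \<epsilon> n) * norm f"
    and r: "0 \<le> r" and \<epsilon>: "\<And>n. 0 \<le> \<epsilon> n" "\<epsilon> \<longlonglongrightarrow> 0"
  obtains m' where "norm (m - m') \<le> r"
    "\<And>n f. norm \<langle>m', f\<rangle> \<le> u n (modulus f) + \<epsilon> n * norm f"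
proof -
  have excess: "variation m h \<le> u n h + (r + \<epsilon> n)"
    if h: "h \<in> nonneg_bcont" "\<And>x. h x \<le> 1" for n h
  proof (rule variation_least[OF h(1)])
    fix f :: "'a \<Rightarrow>\<^sub>C 'k" assume f: "\<And>x. norm (apply_bcontfun f x) \<le> h x"
    have "norm f \<le> 1" using f h(2) by (intro norm_bound) (auto intro: order_trans)
    then have "(r + \<epsilon> n) * norm f \<le> r + \<epsilon> n"
      using r \<epsilon>(1)[of n] by (intro mult_left_le) auto
    moreover have "u n (modulus f) \<le> u n h"
      by (rule pos_functional_mono[OF u]) (use f h in auto)
    ultimately show "norm \<langle>m, f\<rangle> \<le> u n h + (r + \<epsilon> n)" using m[of f n] by linarith
  qed
  show ?thesis
  proof (rule truncate_pos_functional[OF pos_functional_variation u mono excess r \<epsilon>])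
    fix v assume v: "pos_functional v" "\<And>g. g \<in> nonneg_bcont \<Longrightarrow> v g \<le> variation m g"
      "variation m (\<lambda>_. 1) - v (\<lambda>_. 1) \<le> r"
      and le: "\<And>n g c. g \<in> nonneg_bcont \<Longrightarrow> (\<And>x. g x \<le> c) \<Longrightarrow> v g \<le> u n g + \<epsilon> n * c"
    have w: "pos_functional (\<lambda>g. variation m g - v g)"
      by (rule pos_functional_minus[OF pos_functional_variation v(1,2)])
    obtain m' where m': "\<And>f. norm \<langle>m', f\<rangle> \<le> v (modulus f)"
      "\<And>f. norm \<langle>m - m', f\<rangle> \<le> variation m (modulus f) - v (modulus f)"
      by (rule dual_decomposition_pos[OF v(1) w, of m]) (auto simp: norm_pairing_le_variation)
    show thesis
    proof (rule that)
      show "norm (m - m') \<le> r"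
      proof (rule norm_dual_le[OF r])
        fix f
        have "norm \<langle>m - m', f\<rangle> \<le> norm f * (variation m (\<lambda>_. 1) - v (\<lambda>_. 1))"
          using m'(2)[of f] pos_functional_norm_le[OF w, of f] by linarith
        also have "\<dots> \<le> norm f * r" by (rule mult_left_mono[OF v(3)]) simp
        finally show "norm \<langle>m - m', f\<rangle> \<le> r * norm f" by (simp add: mult.commute)
      qed
      show "norm \<langle>m', f\<rangle> \<le> u n (modulus f) + \<epsilon> n * norm f" for n f
        using m'(1)[of f] le[of "\<lambda>x. norm (apply_bcontfun f x)" "norm f" n] norm_bounded[of f]
        by force
    qed
  qed
qed

section \<open>Operators into C(L) for extremally disconnected L\<close>

abbreviation cfun_linear ::
    "(('a::topological_space \<Rightarrow>\<^sub>C 'k::real_normed_field) \<Rightarrow>\<^sub>L ('b::topological_space \<Rightarrow>\<^sub>C 'k)) \<Rightarrow> bool" where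
  "cfun_linear R \<equiv> Vector_Spaces.linear cfun_scale cfun_scale (blinfun_apply R)"

text \<open>
  The neighbourhood filters satisfy the first three conditions, which the pointwise infimum of a chain
  inherits. So Zorn's lemma gives a family of finest filters.
\<close>

lemma minimal_open_filter_family:
  obtains F :: "'b::topological_space \<Rightarrow> 'b filter"
  where "\<And>t. F t \<noteq> bot" "\<And>t. F t \<le> nhds t" "\<And>P. open {t. eventually P (F t)}"
    "\<And>G. (\<And>t. G t \<noteq> bot) \<Longrightarrow> (\<And>P. open {t. eventually P (G t)}) \<Longrightarrow> G \<le> F \<Longrightarrow> G = F"
proof -
  define A :: "('b \<Rightarrow> 'b filter) set" where
    "A = {F. (\<forall>t. F t \<noteq> bot \<and> F t \<le> nhds t) \<and> (\<forall>P. open {t. eventually P (F t)})}"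
  define r where "r = {(G, F). G \<in> A \<and> F \<in> A \<and> F \<le> G}"
  have Fr: "Field r = A" by (auto simp: r_def Field_def)
  have po: "Partial_order r"
    unfolding partial_order_on_def preorder_on_def
    using Fr by (auto simp: r_def refl_on_def trans_def antisym_def)
  have "\<exists>m\<in>Field r. \<forall>a\<in>Field r. (m, a) \<in> r \<longrightarrow> a = m"
  proof (rule Zorns_po_lemma[OF po])
    fix C assume C: "C \<in> Chains r"
    then have CA: "C \<subseteq> A" by (auto simp: Chains_def r_def)
    have ch: "F \<le> G \<or> G \<le> F" if "F \<in> C" "G \<in> C" for F G
      using C that by (auto simp: Chains_def r_def)
    show "\<exists>u\<in>Field r. \<forall>a\<in>C. (a, u) \<in> r"
    proof (cases "C = {}")
      case True
      have "{t. eventually P (nhds t)} = interior {t. P t}" for P :: "'b \<Rightarrow> bool"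
        by (auto simp: interior_def eventually_nhds)
      then have "nhds \<in> A" by (auto simp: A_def)
      then show ?thesis using True Fr by auto
    next
      case False
      define u where "u t = (INF F\<in>C. F t)" for t
      have ev: "eventually P (u t) \<longleftrightarrow> (\<exists>F\<in>C. eventually P (F t))" for P t
        unfolding u_def
      proof (subst eventually_INF_base)
        show "\<exists>x\<in>C. x t \<le> inf (a t) (b t)" if "a \<in> C" "b \<in> C" for a b
          using ch[OF that] that by (auto simp: le_fun_def)
      qed (use False in auto)
      have "u \<in> A"
        unfolding A_def
      proof (intro CollectI conjI allI)
        fix t
        have "\<not> eventually (\<lambda>_. False) (u t)" using CA by (auto simp: ev A_def trivial_limit_def)
        then show "u t \<noteq> bot" by (simp add: trivial_limit_def)
        obtain F where "F \<in> C" using False by blast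
        then have "u t \<le> F t" unfolding u_def by (rule INF_lower)
        also have "\<dots> \<le> nhds t" using \<open>F \<in> C\<close> CA by (auto simp: A_def)
        finally show "u t \<le> nhds t" .
      next
        fix P
        have "{t. eventually P (u t)} = (\<Union>F\<in>C. {t. eventually P (F t)})" by (auto simp: ev)
        then show "open {t. eventually P (u t)}" using CA by (auto simp: A_def intro!: open_UN)
      qed
      moreover have "u \<le> F" if "F \<in> C" for F
        unfolding u_def le_fun_def using that by (auto intro: INF_lower)
      ultimately show ?thesis using CA unfolding Fr by (auto simp: r_def)
    qed
  qed
  then obtain F where F: "F \<in> A" and min: "\<And>G. G \<in> A \<Longrightarrow> G \<le> F \<Longrightarrow> G = F"
    unfolding Fr by (auto simp: r_def)
  show ?thesis
  proof (rule that[of F])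
    fix G assume G: "\<And>t. G t \<noteq> bot" "\<And>P. open {t. eventually P (G t)}" "G \<le> F"
    have "G t \<le> nhds t" for t using G(3) F by (auto simp: A_def le_fun_def intro: order_trans)
    with G show "G = F" by (intro min) (auto simp: A_def)
  qed (use F in \<open>auto simp: A_def\<close>)
qed

text \<open>
  The family of filters is a section of the map from ultrafilters on \<open>L\<close> to their limits, and
  openness of the sets \<open>{t. A \<in> F t}\<close> is its continuity. For a finest family, if \<open>C\<close> is the closure
  of \<open>{t. A \<in> F t}\<close>, then outside \<open>C\<close> the complement of \<open>A\<close> can be added to the filters; that keeps
  the conditions because \<open>C\<close> is clopen. So the complement of \<open>A\<close> is in \<open>F t\<close> already, for all \<open>t\<close>
  outside \<open>C\<close>, and the same argument for the complement shows that \<open>A\<close> is in \<open>F t\<close> for \<open>t\<close> in \<open>C\<close>.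
\<close>

lemma ultrafilter_section:
  assumes ed: "extremally_disconnected (euclidean :: 'b::topological_space topology)"
  obtains F :: "'b::topological_space \<Rightarrow> 'b filter"
  where "\<And>t. F t \<noteq> bot" "\<And>t. F t \<le> nhds t" "\<And>P. open {t. eventually P (F t)}"
    "\<And>t P. eventually P (F t) \<or> eventually (\<lambda>s. \<not> P s) (F t)"
proof -
  obtain F :: "'b \<Rightarrow> 'b filter" where F: "\<And>t. F t \<noteq> bot" "\<And>t. F t \<le> nhds t"
      "\<And>P. open {t. eventually P (F t)}"
    and min: "\<And>G. (\<And>t. G t \<noteq> bot) \<Longrightarrow> (\<And>P. open {t. eventually P (G t)}) \<Longrightarrow> G \<le> F \<Longrightarrow> G = F"
    using minimal_open_filter_family by blast
  have cl: "open (closure U)" if "open U" for U :: "'b set"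
    using ed that by (simp add: extremally_disconnected_def)
  have outside: "eventually (\<lambda>s. \<not> P s) (F t)" if t: "t \<notin> closure {t. eventually P (F t)}" for P t
  proof -
    define C where "C = closure {t. eventually P (F t)}"
    \<comment> \<open>Refine the filters outside \<open>C\<close> by the complement of \<open>P\<close>.\<close>
    define G where "G t = (if t \<in> C then F t else inf (F t) (principal {s. \<not> P s}))" for t
    have "G = F"
    proof (rule min)
      fix t
      have "\<not> eventually P (F t)" if "t \<notin> C"
        using that closure_subset[of "{t. eventually P (F t)}"] by (auto simp: C_def)
      then show "G t \<noteq> bot"
        using F(1) by (auto simp: G_def trivial_limit_def eventually_inf_principal)
    next
      fix Q
      have "{t. eventually Q (G t)} = ({t. eventually Q (F t)} \<inter> C) \<union>
          ({t. eventually (\<lambda>s. \<not> P s \<longrightarrow> Q s) (F t)} \<inter> - C)"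
        by (auto simp: G_def eventually_inf_principal)
      moreover have "open C" "open (- C)" using cl[OF F(3)] by (auto simp: C_def)
      ultimately show "open {t. eventually Q (G t)}" using F(3) by (auto intro!: open_Un open_Int)
    qed (simp add: G_def le_fun_def)
    then have "F t = inf (F t) (principal {s. \<not> P s})" using t by (metis C_def G_def)
    then have "F t \<le> principal {s. \<not> P s}" by (metis inf.cobounded2)
    then show ?thesis by (simp add: le_principal)
  qed
  have ultra: "eventually P (F t) \<or> eventually (\<lambda>s. \<not> P s) (F t)" for P t
  proof (cases "t \<in> closure {t. eventually P (F t)}")
    case True
    define N where "N = {t. eventually (\<lambda>s. \<not> P s) (F t)}"
    have "N \<inter> {t. eventually P (F t)} = {}"
    proof (intro equals0I)
      fix s assume "s \<in> N \<inter> {t. eventually P (F t)}"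
      then have "eventually (\<lambda>_. False) (F s)" by (auto simp: N_def elim: eventually_elim2)
      then show False using F(1) by (simp add: trivial_limit_def)
    qed
    then have "N \<inter> closure {t. eventually P (F t)} = {}"
      using F(3) by (simp add: N_def open_Int_closure_eq_empty)
    then have N: "N = - closure {t. eventually P (F t)}"
      using outside by (auto simp: N_def)
    moreover have "open (closure {t. eventually P (F t)})" by (rule cl) (rule F(3))
    ultimately have "closed N" by (simp add: closed_def)
    then have "t \<notin> closure {t. eventually (\<lambda>s. \<not> P s) (F t)}"
      using True N by (simp add: N_def)
    then show ?thesis using outside[of t "\<lambda>s. \<not> P s"] by simp
  qed (use outside in blast)
  show ?thesis by (rule that[OF F ultra])
qed

lemma ultrafilter_bounded_limit:
  fixes g :: "'b \<Rightarrow> 'k::heine_borel"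
  assumes F: "F \<noteq> bot" and ultra: "\<And>P. eventually P F \<or> eventually (\<lambda>s. \<not> P s) F"
    and g: "bounded (range g)"
  obtains l where "(g \<longlongrightarrow> l) F"
proof -
  have "compact (closure (range g))" using g by (simp add: compact_closure)
  moreover have "filtermap g F \<noteq> bot" using F by (simp add: filtermap_bot_iff)
  moreover have "filtermap g F \<le> principal (closure (range g))"
    using closure_subset[of "range g"] by (auto simp: le_principal eventually_filtermap intro!: always_eventually)
  ultimately obtain l where l: "inf (nhds l) (filtermap g F) \<noteq> bot"
    unfolding compact_filter le_principal by meson
  have "(g \<longlongrightarrow> l) F"
  proof (rule topological_tendstoI)
    fix U assume U: "open U" "l \<in> U"
    show "eventually (\<lambda>s. g s \<in> U) F"
    proof (rule ccontr)
      assume "\<not> ?thesis"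
      then have "eventually (\<lambda>s. g s \<notin> U) F" using ultra by blast
      then have "eventually (\<lambda>y. y \<notin> U) (filtermap g F)" by (simp add: eventually_filtermap)
      moreover have "eventually (\<lambda>y. y \<in> U) (nhds l)" using U by (rule eventually_nhds_in_open)
      ultimately have "eventually (\<lambda>_. False) (inf (nhds l) (filtermap g F))"
        unfolding eventually_inf by blast
      then show False using l by (simp add: trivial_limit_def)
    qed
  qed
  then show ?thesis by (rule that)
qed

text \<open>
  Continuity holds because the \<open>t\<close> for which \<open>F t\<close> contains a set \<open>{x. dist (g x) l < e}\<close> form an open
  set.
\<close>

lemma limit_functions:
  fixes F :: "'b::topological_space \<Rightarrow> 'b filter" and g :: "'b \<Rightarrow> 'k::{real_normed_vector, heine_borel}"
  assumes F: "\<And>t. F t \<noteq> bot" "\<And>P. open {t. eventually P (F t)}"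
    "\<And>t P. eventually P (F t) \<or> eventually (\<lambda>s. \<not> P s) (F t)"
    and g: "bounded (range g)"
  obtains h where "\<And>t. (g \<longlongrightarrow> apply_bcontfun h t) (F t)"
proof -
  have "\<exists>l. (g \<longlongrightarrow> l) (F t)" for t
    using ultrafilter_bounded_limit[OF F(1,3) g] by blast
  then obtain l where l: "\<And>t. (g \<longlongrightarrow> l t) (F t)" by metis
  obtain c where c: "\<And>t. norm (g t) \<le> c" using g by (auto simp: bounded_iff)
  have "l \<in> bcontfun"
  proof (rule bcontfun_normI)
    show "norm (l t) \<le> c" for t
      by (rule tendsto_upperbound[OF tendsto_norm[OF l]]) (use c F(1) in auto)
    show "continuous_on UNIV l"
      unfolding continuous_on_def
    proof (intro ballI tendstoI)
      fix t and e :: real assume e: "0 < e"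
      define V where "V = {s. eventually (\<lambda>x. dist (g x) (l t) < e / 2) (F s)}"
      have "open V" "t \<in> V"
        using F(2) tendstoD[OF l, of "e / 2" t] e by (auto simp: V_def)
      then have "eventually (\<lambda>s. s \<in> V) (at t within UNIV)"
        unfolding eventually_at_topological by blast
      then show "eventually (\<lambda>s. dist (l s) (l t) < e) (at t within UNIV)"
      proof (rule eventually_mono)
        fix s assume "s \<in> V"
        then have "dist (l s) (l t) \<le> e / 2"
          by (intro tendsto_upperbound[OF tendsto_dist[OF l tendsto_const]])
            (auto simp: V_def F(1) elim: eventually_mono)
        then show "dist (l s) (l t) < e" using e by simp
      qed
    qed
  qed
  then show ?thesis using that[of "Bcontfun l"] l by (simp add: Bcontfun_inverse)
qed

text \<open>
  A bounded family \<open>\<nu>\<close> of functionals is an operator from \<open>C(K)\<close> to the bounded functions on \<open>L\<close>.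
  Composing it with the limits along the ultrafilters, a norm-one projection onto \<open>C(L)\<close>, gives \<open>\<Phi> \<nu>\<close>.
  The last property says that this changes nothing if the family comes from an operator into \<open>C(L)\<close>.
\<close>

lemma bounded_family_operator:
  assumes ed: "extremally_disconnected (euclidean :: 'b::topological_space topology)"
  obtains \<Phi> :: "('b::topological_space \<Rightarrow> ('a::topological_space, 'k::{real_normed_field, euclidean_space}) cfun_dual)
      \<Rightarrow> ('a \<Rightarrow>\<^sub>C 'k) \<Rightarrow>\<^sub>L ('b \<Rightarrow>\<^sub>C 'k)"
  where "\<And>\<nu>. bounded (range \<nu>) \<Longrightarrow> cfun_linear (\<Phi> \<nu>)"
    "\<And>\<nu> f c. bounded (range \<nu>) \<Longrightarrow> (\<And>t. norm \<langle>\<nu> t, f\<rangle> \<le> c) \<Longrightarrow> norm (\<Phi> \<nu> f) \<le> c"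
    "\<And>\<mu> \<nu>. bounded (range \<mu>) \<Longrightarrow> bounded (range \<nu>) \<Longrightarrow> \<Phi> (\<lambda>t. \<mu> t - \<nu> t) = \<Phi> \<mu> - \<Phi> \<nu>"
    "\<And>\<nu> T. bounded (range \<nu>) \<Longrightarrow> (\<And>t f. \<langle>\<nu> t, f\<rangle> = apply_bcontfun (blinfun_apply T f) t) \<Longrightarrow> \<Phi> \<nu> = T"
proof -
  obtain F :: "'b \<Rightarrow> 'b filter" where F: "\<And>t. F t \<noteq> bot" "\<And>t. F t \<le> nhds t"
      "\<And>P. open {t. eventually P (F t)}" "\<And>t P. eventually P (F t) \<or> eventually (\<lambda>s. \<not> P s) (F t)"
    using ultrafilter_section[OF ed] by blast
  have "\<exists>R :: ('a \<Rightarrow>\<^sub>C 'k) \<Rightarrow>\<^sub>L ('b \<Rightarrow>\<^sub>C 'k). \<forall>f t. ((\<lambda>s. \<langle>\<nu> s, f\<rangle>) \<longlongrightarrow> apply_bcontfun (blinfun_apply R f) t) (F t)"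
    if \<nu>: "bounded (range \<nu>)" for \<nu> :: "'b \<Rightarrow> ('a, 'k) cfun_dual"
  proof -
    obtain c where c: "\<And>t. norm (\<nu> t) \<le> c" using \<nu> by (auto simp: bounded_iff)
    have c': "norm \<langle>\<nu> t, f\<rangle> \<le> norm f * c" for t f
      using norm_dual_pairing[of "\<nu> t" f] c[of t]
      by (metis mult.commute mult_left_mono norm_ge_zero order_trans)
    have "\<exists>h. \<forall>t. ((\<lambda>s. \<langle>\<nu> s, f\<rangle>) \<longlongrightarrow> apply_bcontfun h t) (F t)" for f
      by (rule limit_functions[OF F(1,3,4), of "\<lambda>s. \<langle>\<nu> s, f\<rangle>"])
        (use c' in \<open>auto simp: bounded_iff\<close>)
    then obtain R where R: "\<And>f t. ((\<lambda>s. \<langle>\<nu> s, f\<rangle>) \<longlongrightarrow> apply_bcontfun (R f) t) (F t)" by metis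
    have "bounded_linear R"
    proof (rule bounded_linear_intro)
      fix f g :: "'a \<Rightarrow>\<^sub>C 'k" and r :: real
      show "R (f + g) = R f + R g"
        by (rule bcontfun_eqI, rule tendsto_unique[OF F(1) R])
          (simp add: dual_pairing_simps tendsto_add R)
      show "R (r *\<^sub>R f) = r *\<^sub>R R f"
        by (rule bcontfun_eqI, rule tendsto_unique[OF F(1) R])
          (simp add: dual_pairing_simps tendsto_scaleR R)
      show "norm (R f) \<le> norm f * c"
        by (rule norm_bound, rule tendsto_upperbound[OF tendsto_norm[OF R]]) (use c' F(1) in auto)
    qed
    then show ?thesis by (intro exI[of _ "Blinfun R"]) (simp add: bounded_linear_Blinfun_apply R)
  qed
  then obtain \<Phi> :: "('b \<Rightarrow> ('a, 'k) cfun_dual) \<Rightarrow> ('a \<Rightarrow>\<^sub>C 'k) \<Rightarrow>\<^sub>L ('b \<Rightarrow>\<^sub>C 'k)"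
    where \<Phi>: "\<And>\<nu> f t. bounded (range \<nu>) \<Longrightarrow>
      ((\<lambda>s. \<langle>\<nu> s, f\<rangle>) \<longlongrightarrow> apply_bcontfun (blinfun_apply (\<Phi> \<nu>) f) t) (F t)"
    by metis
  show ?thesis
  proof (rule that)
    fix \<nu> :: "'b \<Rightarrow> ('a, 'k) cfun_dual" assume \<nu>: "bounded (range \<nu>)"
    have "blinfun_apply (\<Phi> \<nu>) (cfun_scale c f) = cfun_scale c (blinfun_apply (\<Phi> \<nu>) f)" for c f
      by (rule bcontfun_eqI, rule tendsto_unique[OF F(1) \<Phi>[OF \<nu>]])
        (simp add: dual_pairing_simps tendsto_mult \<Phi>[OF \<nu>])
    then show "cfun_linear (\<Phi> \<nu>)"
      by (simp add: Vector_Spaces.linear_iff vector_space_cfun_scale blinfun.add_right)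
    show "norm (\<Phi> \<nu> f) \<le> c" if "\<And>t. norm \<langle>\<nu> t, f\<rangle> \<le> c" for f c
      by (rule norm_bound, rule tendsto_upperbound[OF tendsto_norm[OF \<Phi>[OF \<nu>]]])
        (use that F(1) in auto)
    show "\<Phi> \<nu> = T" if T: "\<And>t f. \<langle>\<nu> t, f\<rangle> = apply_bcontfun (blinfun_apply T f) t" for T
    proof (rule blinfun_eqI, rule bcontfun_eqI)
      fix f t
      have "(apply_bcontfun (blinfun_apply T f) \<longlongrightarrow> apply_bcontfun (blinfun_apply T f) t) (nhds t)"
        using continuous_on_apply_bcontfun[of UNIV "blinfun_apply T f"]
        by (simp add: continuous_on_def tendsto_at_iff_tendsto_nhds)
      then have "(apply_bcontfun (blinfun_apply T f) \<longlongrightarrow> apply_bcontfun (blinfun_apply T f) t) (F t)"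
        using F(2) by (rule tendsto_mono[rotated])
      then show "apply_bcontfun (blinfun_apply (\<Phi> \<nu>) f) t = apply_bcontfun (blinfun_apply T f) t"
        using tendsto_unique[OF F(1) \<Phi>[OF \<nu>, of f t]] by (simp add: T)
    qed
    fix \<mu> :: "'b \<Rightarrow> ('a, 'k) cfun_dual" assume \<mu>: "bounded (range \<mu>)"
    have d: "bounded (range (\<lambda>t. \<mu> t - \<nu> t))" using \<mu> \<nu> by (rule bounded_minus_comp)
    show "\<Phi> (\<lambda>t. \<mu> t - \<nu> t) = \<Phi> \<mu> - \<Phi> \<nu>"
      by (rule blinfun_eqI, rule bcontfun_eqI, rule tendsto_unique[OF F(1) \<Phi>[OF d]])
        (simp add: dual_pairing_simps blinfun.diff_left tendsto_diff \<Phi>[OF \<mu>] \<Phi>[OF \<nu>])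
  qed
qed

lemma adjoint_point_eval:
  assumes "cfun_linear T"
  shows "\<langle>cfun_adjoint T (point_eval t), f\<rangle> = apply_bcontfun (blinfun_apply T f) t"
  by (simp add: adjoint_apply[OF assms] point_eval)

lemma norm_adjoint_le:
  assumes T: "cfun_linear T"
  shows "norm (cfun_adjoint T m) \<le> norm m * norm T"
proof (rule norm_dual_le)
  fix f
  have "norm \<langle>m, T f\<rangle> \<le> norm m * norm (T f)" by (rule norm_dual_pairing)
  also have "\<dots> \<le> norm m * (norm T * norm f)" by (intro mult_left_mono norm_blinfun) simp
  finally show "norm \<langle>cfun_adjoint T m, f\<rangle> \<le> norm m * norm T * norm f"
    by (simp add: adjoint_apply[OF T] mult.assoc)
qed simp

lemma bounded_rows:
  assumes T: "cfun_linear T"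
  shows "bounded (range (\<lambda>t. cfun_adjoint T (point_eval t)))"
proof -
  have "norm (cfun_adjoint T (point_eval t)) \<le> norm T" for t
    using norm_adjoint_le[OF T, of "point_eval t"] norm_point_eval[of t]
    by (meson mult_right_le_one_le mult_left_le_one_le norm_ge_zero order_trans)
  then show ?thesis by (auto simp: bounded_iff)
qed

text \<open>
  This turns estimates for single functionals into estimates for operators: the rows of \<open>T\<close> may be
  changed independently of each other.
\<close>

lemma operator_of_perturbed_rows:
  fixes T :: "('a::topological_space \<Rightarrow>\<^sub>C 'k::{real_normed_field, euclidean_space}) \<Rightarrow>\<^sub>L ('b::topological_space \<Rightarrow>\<^sub>C 'k)"
  assumes ed: "extremally_disconnected (euclidean :: 'b topology)"
    and T: "cfun_linear T"
    and r: "0 \<le> r" and \<nu>: "\<And>t. norm (cfun_adjoint T (point_eval t) - \<nu> t) \<le> r"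
  obtains W where "cfun_linear W" "norm (T - W) \<le> r"
    "\<And>f c. (\<And>t. norm \<langle>\<nu> t, f\<rangle> \<le> c) \<Longrightarrow> norm (W f) \<le> c"
proof -
  show ?thesis
  proof (rule bounded_family_operator[OF ed])
    fix \<Phi> :: "('b \<Rightarrow> ('a, 'k) cfun_dual) \<Rightarrow> ('a \<Rightarrow>\<^sub>C 'k) \<Rightarrow>\<^sub>L ('b \<Rightarrow>\<^sub>C 'k)"
      assume lin: "\<And>\<nu>. bounded (range \<nu>) \<Longrightarrow> cfun_linear (\<Phi> \<nu>)"
        and le: "\<And>\<nu> f c. bounded (range \<nu>) \<Longrightarrow> (\<And>t. norm \<langle>\<nu> t, f\<rangle> \<le> c) \<Longrightarrow> norm (\<Phi> \<nu> f) \<le> c"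
        and diff: "\<And>\<mu> \<nu>. bounded (range \<mu>) \<Longrightarrow> bounded (range \<nu>) \<Longrightarrow> \<Phi> (\<lambda>t. \<mu> t - \<nu> t) = \<Phi> \<mu> - \<Phi> \<nu>"
        and fix_op: "\<And>\<nu> T. bounded (range \<nu>) \<Longrightarrow> (\<And>t f. \<langle>\<nu> t, f\<rangle> = apply_bcontfun (blinfun_apply T f) t) \<Longrightarrow> \<Phi> \<nu> = T"
    define \<mu> where "\<mu> t = cfun_adjoint T (point_eval t)" for t
    have \<mu>: "bounded (range \<mu>)" using bounded_rows[OF T] by (simp add: \<mu>_def)
    have d: "bounded (range (\<lambda>t. \<mu> t - \<nu> t))" using \<nu> by (auto simp: bounded_iff \<mu>_def)
    have "range \<nu> = range (\<lambda>t. \<mu> t - (\<mu> t - \<nu> t))" by simp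
    then have \<nu>b: "bounded (range \<nu>)" using bounded_minus_comp[OF \<mu> d] by simp
    have "T - \<Phi> \<nu> = \<Phi> (\<lambda>t. \<mu> t - \<nu> t)"
      using diff[OF \<mu> \<nu>b] fix_op[OF \<mu>, of T] by (simp add: \<mu>_def adjoint_point_eval[OF T])
    moreover have "norm (\<Phi> (\<lambda>t. \<mu> t - \<nu> t)) \<le> r"
    proof (rule norm_blinfun_bound[OF r], rule le[OF d])
      fix f t
      show "norm \<langle>\<mu> t - \<nu> t, f\<rangle> \<le> r * norm f"
        using norm_dual_pairing[of "\<mu> t - \<nu> t" f] \<nu>[of t] unfolding \<mu>_def
        by (meson mult_right_mono norm_ge_zero order_trans)
    qed
    ultimately have "norm (T - \<Phi> \<nu>) \<le> r" by simp
    then show thesis by (rule that[OF lin[OF \<nu>b]]) (rule le[OF \<nu>b])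
  qed
qed

lemma norm_row_le:
  assumes T: "cfun_linear T"
  shows "norm \<langle>cfun_adjoint T (point_eval t), f\<rangle> \<le> norm (T f)"
  unfolding adjoint_point_eval[OF T] by (rule norm_bounded)

lemma operator_decomposition:
  fixes R :: "('a::topological_space \<Rightarrow>\<^sub>C 'k::{real_normed_field, euclidean_space}) \<Rightarrow>\<^sub>L ('b::topological_space \<Rightarrow>\<^sub>C 'k)"
  assumes ed: "extremally_disconnected (euclidean :: 'b topology)"
    and R: "cfun_linear R"
    and u: "pos_functional u" and c: "0 \<le> c"
    and le: "\<And>f. norm (R f) \<le> u (modulus f) + c * norm f"
  obtains R' where "cfun_linear R'" "norm (R - R') \<le> c"
    "\<And>f. norm (R' f) \<le> u (modulus f)"
proof -
  have "\<exists>n. (\<forall>f. norm \<langle>n, f\<rangle> \<le> u (modulus f)) \<and>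
      norm (cfun_adjoint R (point_eval t) - n) \<le> c" for t
    using dual_decomposition_norm[OF u c, of "cfun_adjoint R (point_eval t)"]
      order_trans[OF norm_row_le[OF R] le] by metis
  then obtain \<nu> where \<nu>: "\<And>t f. norm \<langle>\<nu> t, f\<rangle> \<le> u (modulus f)"
      "\<And>t. norm (cfun_adjoint R (point_eval t) - \<nu> t) \<le> c"
    by metis
  show ?thesis
  proof (rule operator_of_perturbed_rows[OF ed R c \<nu>(2)])
    fix W assume W: "cfun_linear W" "norm (R - W) \<le> c"
      "\<And>f c. (\<And>t. norm \<langle>\<nu> t, f\<rangle> \<le> c) \<Longrightarrow> norm (blinfun_apply W f) \<le> c"
    show thesis by (rule that[OF W(1,2)]) (rule W(3), rule \<nu>(1))
  qed
qed

lemma operator_truncation: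
  fixes T :: "('a::topological_space \<Rightarrow>\<^sub>C 'k::{real_normed_field, euclidean_space}) \<Rightarrow>\<^sub>L ('b::topological_space \<Rightarrow>\<^sub>C 'k)"
  assumes ed: "extremally_disconnected (euclidean :: 'b topology)"
    and T: "cfun_linear T"
    and u: "\<And>n. pos_functional (u n)"
    and mono: "\<And>n g. g \<in> nonneg_bcont \<Longrightarrow> u n g \<le> u (Suc n) g"
    and le: "\<And>n f. norm (T f) \<le> u n (modulus f) + (r + \<epsilon> n) * norm f"
    and r: "0 \<le> r" and \<epsilon>: "\<And>n. 0 \<le> \<epsilon> n" "\<epsilon> \<longlonglongrightarrow> 0"
  obtains W where "cfun_linear W" "norm (T - W) \<le> r"
    "\<And>n f. norm (W f) \<le> u n (modulus f) + \<epsilon> n * norm f"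
proof -
  have "\<exists>m'. norm (cfun_adjoint T (point_eval t) - m') \<le> r \<and>
    (\<forall>n f. norm \<langle>m', f\<rangle> \<le> u n (modulus f) + \<epsilon> n * norm f)" for t
  proof (rule truncate_dual[where u = u and \<epsilon> = \<epsilon> and r = r, OF u mono _ r \<epsilon>])
    show "norm \<langle>cfun_adjoint T (point_eval t), f\<rangle>
        \<le> u n (modulus f) + (r + \<epsilon> n) * norm f" for n f
      by (rule order_trans[OF norm_row_le[OF T] le])
  qed blast+
  then obtain \<nu> where \<nu>: "\<And>t. norm (cfun_adjoint T (point_eval t) - \<nu> t) \<le> r"
    "\<And>t n f. norm \<langle>\<nu> t, f\<rangle> \<le> u n (modulus f) + \<epsilon> n * norm f"
    by metis
  show ?thesis
  proof (rule operator_of_perturbed_rows[OF ed T r \<nu>(1)])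
    fix W assume W: "cfun_linear W" "norm (T - W) \<le> r"
      "\<And>f c. (\<And>t. norm \<langle>\<nu> t, f\<rangle> \<le> c) \<Longrightarrow> norm (blinfun_apply W f) \<le> c"
    show thesis by (rule that[OF W(1,2)]) (rule W(3), rule \<nu>(2))
  qed
qed

section \<open>Functionals dominated by a Hilbertian seminorm\<close>

abbreviation functional_linear :: "(('a::topological_space, 'k::real_normed_field) cfun_dual \<Rightarrow>\<^sub>L 'k) \<Rightarrow> bool" where
  "functional_linear \<phi> \<equiv> Vector_Spaces.linear dual_scale (*) (blinfun_apply \<phi>)"

lemma functional_linear_scale: "functional_linear \<phi> \<Longrightarrow> \<phi> (dual_scale c m) = c * \<phi> m"
  by (simp add: Vector_Spaces.linear_iff)

lemma norm_le_of_inner_one: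
  fixes v :: "'i \<Rightarrow> 'k::{real_normed_field, euclidean_space}"
  assumes rot: "\<And>c x. x \<in> A \<Longrightarrow> norm c = 1 \<Longrightarrow> \<exists>y\<in>A. v y = c * v x"
    and le: "\<And>x. x \<in> A \<Longrightarrow> inner (v x) 1 \<le> b" and x: "x \<in> A"
  shows "norm (v x) \<le> b"
proof -
  obtain e where e: "norm e = 1" "e * v x = of_real (norm (v x))" by (rule unit_rotation)
  obtain y where "y \<in> A" "v y = of_real (norm (v x))" using rot[OF x e(1)] e(2) by metis
  then show ?thesis using le[of y] by (simp add: inner_of_real_one)
qed

text \<open>
  Let \<open>E\<close> be the set of functionals bounded by \<open>q\<close>, the dual ball of a Hilbertian seminorm. This is
  reflexivity of Hilbert space, proved by smoothness of the norm. Let \<open>S\<close> be the supremum of the real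
  part of \<open>\<phi>\<close> on \<open>E\<close>, let \<open>\<nu>\<close> in \<open>E\<close> almost attain it, and let \<open>f\<close> with \<open>q f \<le> 1\<close> almost norm \<open>\<nu>\<close>. Then \<open>\<phi>\<close>
  and the evaluation at \<open>S f\<close> are both almost supporting functionals at \<open>\<nu>\<close>. The parallelogram law
  bounds the sum of the dual norms of \<open>\<nu> + t \<sigma>\<close> and \<open>\<nu> - t \<sigma>\<close> by \<open>2 + t\<^sup>2\<close>, so that two such supporting
  functionals almost agree on every \<open>\<sigma>\<close> in \<open>E\<close>.
\<close>

lemma hilbertian_functional_approx:
  fixes q :: "('a::topological_space \<Rightarrow>\<^sub>C 'k::{real_normed_field, euclidean_space}) \<Rightarrow> real"
    and \<phi> :: "('a, 'k) cfun_dual \<Rightarrow>\<^sub>L 'k"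
  assumes q0: "\<And>f. 0 \<le> q f" and qs: "\<And>c f. q (cfun_scale c f) = norm c * q f"
    and par: "\<And>f g. (q (f + g))\<^sup>2 + (q (f - g))\<^sup>2 \<le> 2 * (q f)\<^sup>2 + 2 * (q g)\<^sup>2"
    and b: "0 \<le> b" "\<And>f. q f \<le> b * norm f"
    and \<phi>: "functional_linear \<phi>" and e: "0 < e"
  obtains f where "\<And>\<sigma>. (\<And>g. norm \<langle>\<sigma>, g\<rangle> \<le> q g) \<Longrightarrow> norm (\<phi> \<sigma> - \<langle>\<sigma>, f\<rangle>) \<le> e"
proof -
  define E where "E = {\<nu> :: ('a, 'k) cfun_dual. \<forall>g. norm \<langle>\<nu>, g\<rangle> \<le> q g}"
  define S where "S = (SUP \<nu>\<in>E. inner (\<phi> \<nu>) 1)"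
  have ED: "norm \<langle>\<nu>, g\<rangle> \<le> q g" if "\<nu> \<in> E" for \<nu> g using that by (simp add: E_def)
  have Erot: "dual_scale c \<nu> \<in> E" if "\<nu> \<in> E" "norm c = 1" for c \<nu>
    using that by (simp add: E_def norm_mult)
  have E0: "0 \<in> E" using q0 by (simp add: E_def dual_pairing_simps)
  have bdd: "bdd_above ((\<lambda>\<nu>. inner (\<phi> \<nu>) 1) ` E)"
  proof (rule bdd_aboveI2)
    fix \<nu> assume "\<nu> \<in> E"
    then have "norm \<nu> \<le> b"
      using b(2) by (intro norm_dual_le[OF b(1)]) (auto simp: E_def intro: order_trans)
    then have "norm \<phi> * norm \<nu> \<le> norm \<phi> * b" by (intro mult_left_mono) auto
    then show "inner (\<phi> \<nu>) 1 \<le> norm \<phi> * b"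
      using inner_one_le_norm[of "\<phi> \<nu>"] norm_blinfun[of \<phi> \<nu>] by linarith
  qed
  have S: "inner (\<phi> \<nu>) 1 \<le> S" if "\<nu> \<in> E" for \<nu>
    unfolding S_def by (rule cSUP_upper[OF that bdd])
  have S0: "0 \<le> S" using S[OF E0] by (simp add: blinfun.zero_right)
  \<comment> \<open>If \<open>c\<close> bounds the dual norm of \<open>\<nu>\<close>, then \<open>\<nu> / c\<close> is in \<open>E\<close>. To allow \<open>c = 0\<close>, this is applied to all
    \<open>d > c\<close>.\<close>
  have gauge: "inner (\<phi> \<nu>) 1 \<le> c * S"
    if c: "\<And>g. q g \<le> 1 \<Longrightarrow> inner \<langle>\<nu>, g\<rangle> 1 \<le> c" for \<nu> c
  proof -
    have "q 0 \<le> 0" using qs[of 0 0] by (simp add: cfun_scale_of_real[of 0, simplified])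
    then have c0: "0 \<le> c" using c[of 0] by (simp add: dual_pairing_simps)
    have pos: "inner (\<phi> \<nu>) 1 \<le> d * S" if d: "c < d" for d
    proof -
      have d0: "0 < d" using c0 d by simp
      have "norm \<langle>\<nu>, g\<rangle> \<le> d * q g" for g
      proof (rule field_le_epsilon)
        fix \<epsilon> :: real assume \<epsilon>: "0 < \<epsilon>"
        define r where "r = q g + \<epsilon> / d"
        have r: "0 < r" "q g \<le> r" using q0[of g] \<epsilon> d0 by (simp_all add: r_def add_nonneg_pos)
        obtain a where a: "norm a = 1" "a * \<langle>\<nu>, g\<rangle> = of_real (norm \<langle>\<nu>, g\<rangle>)" by (rule unit_rotation)
        have "norm (of_real (inverse r) * a) = inverse r" using r a by (simp only: norm_mult norm_of_real) simp
        then have "q (cfun_scale (of_real (inverse r) * a) g) \<le> 1"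
          unfolding qs by (simp only:) (use r in \<open>simp add: field_simps\<close>)
        then have "inner (inverse r *\<^sub>R (a * \<langle>\<nu>, g\<rangle>)) 1 \<le> d"
          using c[of "cfun_scale (of_real (inverse r) * a) g"] d
          by (simp add: dual_pairing_simps scaleR_conv_of_real mult.assoc)
        then have "norm \<langle>\<nu>, g\<rangle> \<le> d * r" using r by (simp add: a inner_of_real_one field_simps)
        then show "norm \<langle>\<nu>, g\<rangle> \<le> d * q g + \<epsilon>" using d0 by (simp add: r_def algebra_simps)
      qed
      then have "inverse d *\<^sub>R \<nu> \<in> E"
        using d0 by (simp add: E_def dual_pairing_simps field_simps)
      from S[OF this] show ?thesis using d0 by (simp add: blinfun.scaleR_right field_simps)
    qed
    show ?thesis
    proof (rule field_le_epsilon)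
      fix \<epsilon> :: real assume \<epsilon>: "0 < \<epsilon>"
      have "inner (\<phi> \<nu>) 1 \<le> (c + \<epsilon> / (S + 1)) * S" by (rule pos) (use \<epsilon> S0 in simp)
      also have "\<dots> = c * S + \<epsilon> * (S / (S + 1))" by (simp add: algebra_simps)
      also have "\<epsilon> * (S / (S + 1)) \<le> \<epsilon>" using \<epsilon> S0 by (intro mult_left_le) auto
      finally show "inner (\<phi> \<nu>) 1 \<le> c * S + \<epsilon>" by simp
    qed
  qed
  have "\<exists>f. \<forall>\<sigma>\<in>E. inner (\<phi> \<sigma> - \<langle>\<sigma>, f\<rangle>) 1 \<le> e"
  proof (cases "S = 0")
    case True
    have "inner (\<phi> \<sigma> - \<langle>\<sigma>, 0\<rangle>) 1 \<le> e" if "\<sigma> \<in> E" for \<sigma>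
      using S[OF that] True e by (simp add: dual_pairing_simps)
    then show ?thesis by blast
  next
    case False
    then have S0: "0 < S" using S0 by simp
    \<comment> \<open>The error will be \<open>S (t + 2 \<eta> / t)\<close>, which these values turn into \<open>e\<close>.\<close>
    define t where "t = e / (2 * S)"
    define \<eta> where "\<eta> = t\<^sup>2 / 2"
    have t: "0 < t" using e S0 by (simp add: t_def)
    then have \<eta>: "0 < \<eta>" by (simp add: \<eta>_def)
    have "S * (1 - \<eta>) < S" using S0 \<eta> by simp
    then obtain \<nu> where \<nu>: "\<nu> \<in> E" "S * (1 - \<eta>) < inner (\<phi> \<nu>) 1"
      using less_cSUP_iff[OF _ bdd, of "S * (1 - \<eta>)"] E0 unfolding S_def by blast
    have "\<exists>f. q f \<le> 1 \<and> 1 - \<eta> < inner \<langle>\<nu>, f\<rangle> 1"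
    proof (rule ccontr)
      assume "\<not> ?thesis"
      then have "inner (\<phi> \<nu>) 1 \<le> (1 - \<eta>) * S" by (intro gauge) (auto simp: not_less)
      then show False using \<nu>(2) by (simp add: mult.commute)
    qed
    then obtain f where f: "q f \<le> 1" "1 - \<eta> < inner \<langle>\<nu>, f\<rangle> 1" by blast
    have "inner (\<phi> \<sigma> - \<langle>\<sigma>, S *\<^sub>R f\<rangle>) 1 \<le> e" if \<sigma>: "\<sigma> \<in> E" for \<sigma>
    proof -
      have "inner \<langle>\<nu> + t *\<^sub>R \<sigma>, g\<rangle> 1 \<le> 2 + t\<^sup>2 - inner \<langle>\<nu> - t *\<^sub>R \<sigma>, f\<rangle> 1" if g: "q g \<le> 1" for g
      proof -
        define x y where "x = q (g + f)" and "y = q (g - f)"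
        have "inner \<langle>\<nu>, g + f\<rangle> 1 \<le> x"
          using inner_one_le_norm ED[OF \<nu>(1)] order_trans unfolding x_def by blast
        moreover have "inner \<langle>\<sigma>, g - f\<rangle> 1 \<le> y"
          using inner_one_le_norm ED[OF \<sigma>] order_trans unfolding y_def by blast
        ultimately have "inner \<langle>\<nu>, g + f\<rangle> 1 + t * inner \<langle>\<sigma>, g - f\<rangle> 1 \<le> x + t * y"
          using t by (intro add_mono mult_left_mono) auto
        \<comment> \<open>The parallelogram law enters through \<open>x\<^sup>2 + y\<^sup>2 \<le> 4\<close>.\<close>
        moreover have "x + t * y \<le> 2 + t\<^sup>2"
        proof -
          have "x\<^sup>2 + y\<^sup>2 \<le> 2 * (q g)\<^sup>2 + 2 * (q f)\<^sup>2" unfolding x_def y_def by (rule par)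
          also have "\<dots> \<le> 4" using power_le_one[OF q0 g, of 2] power_le_one[OF q0 f(1), of 2] by simp
          finally have "x\<^sup>2 + y\<^sup>2 \<le> 4" .
          moreover have "0 \<le> (x / 2 - 1)\<^sup>2" "0 \<le> (y / 2 - t)\<^sup>2" by simp_all
          ultimately show ?thesis by (simp add: power2_eq_square algebra_simps)
        qed
        ultimately show ?thesis
          by (simp add: dual_pairing_simps inner_add_left inner_diff_left algebra_simps)
      qed
      from gauge[OF this]
      have "inner (\<phi> \<nu>) 1 + t * inner (\<phi> \<sigma>) 1
          \<le> (2 + t\<^sup>2 - inner \<langle>\<nu>, f\<rangle> 1 + t * inner \<langle>\<sigma>, f\<rangle> 1) * S"
        by (simp add: blinfun.bilinear_simps dual_pairing_simps inner_add_left inner_diff_left algebra_simps)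
      also have "\<dots> \<le> (2 + t\<^sup>2 - (1 - \<eta>) + t * inner \<langle>\<sigma>, f\<rangle> 1) * S"
        using f(2) S0 by (intro mult_right_mono) auto
      finally have "t * (inner (\<phi> \<sigma>) 1 - S * inner \<langle>\<sigma>, f\<rangle> 1) \<le> S * (t\<^sup>2 + 2 * \<eta>)"
        using \<nu>(2) by (simp add: algebra_simps)
      also have "\<dots> = t * (2 * S * t)" by (simp add: \<eta>_def power2_eq_square)
      finally have "inner (\<phi> \<sigma>) 1 - S * inner \<langle>\<sigma>, f\<rangle> 1 \<le> 2 * S * t" using t by simp
      also have "\<dots> = e" using S0 by (simp add: t_def)
      finally show ?thesis by (simp add: dual_pairing_simps inner_diff_left)
    qed
    then show ?thesis by blast
  qed
  then obtain f where f: "\<And>\<sigma>. \<sigma> \<in> E \<Longrightarrow> inner (\<phi> \<sigma> - \<langle>\<sigma>, f\<rangle>) 1 \<le> e" by blast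
  show ?thesis
  proof (rule that[of f])
    fix \<sigma> assume "\<And>g. norm \<langle>\<sigma>, g\<rangle> \<le> q g"
    then have \<sigma>: "\<sigma> \<in> E" by (simp add: E_def)
    show "norm (\<phi> \<sigma> - \<langle>\<sigma>, f\<rangle>) \<le> e"
    proof (rule norm_le_of_inner_one[of E "\<lambda>\<sigma>. \<phi> \<sigma> - \<langle>\<sigma>, f\<rangle>", OF _ f \<sigma>])
      show "\<exists>y\<in>E. \<phi> y - \<langle>y, f\<rangle> = c * (\<phi> x - \<langle>x, f\<rangle>)" if "x \<in> E" "norm c = 1" for c x
        using Erot[OF that]
        by (intro bexI[of _ "dual_scale c x"]) (simp_all add: functional_linear_scale[OF \<phi>] right_diff_distrib)
    qed
  qed
qed

lemma pos_functional_Cauchy_Schwarz: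
  assumes u: "pos_functional u" and g: "g \<in> nonneg_bcont"
  shows "(u g)\<^sup>2 \<le> u (\<lambda>_. 1) * u (\<lambda>x. (g x)\<^sup>2)"
proof -
  obtain c where c: "0 \<le> c" "\<And>x. g x \<le> c" using g by (rule nonneg_bcont_bound) blast
  have sq: "(\<lambda>x. (g x)\<^sup>2) \<in> nonneg_bcont"
    by (rule nonneg_bcontI[of _ "c\<^sup>2"])
      (use g c in \<open>auto intro!: continuous_intros power_mono simp: nonneg_bcontD\<close>)
  have amgm: "2 * l * u g \<le> l\<^sup>2 * u (\<lambda>_. 1) + u (\<lambda>x. (g x)\<^sup>2)" if l: "0 \<le> l" for l
  proof -
    have "u (\<lambda>x. (2 * l) * g x) \<le> u (\<lambda>x. l\<^sup>2 * 1 + (g x)\<^sup>2)"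
    proof (rule pos_functional_mono[OF u])
      show "(2 * l) * g x \<le> l\<^sup>2 * 1 + (g x)\<^sup>2" for x
        using sum_squares_bound[of l "g x"] by simp
    qed (use l g sq in auto)
    also have "\<dots> = l\<^sup>2 * u (\<lambda>_. 1) + u (\<lambda>x. (g x)\<^sup>2)"
      using pos_functional_add[OF u, of "\<lambda>x. l\<^sup>2 * 1" "\<lambda>x. (g x)\<^sup>2"] sq
        pos_functional_scale[OF u, of "\<lambda>_. 1" "l\<^sup>2"] by simp
    finally show ?thesis using pos_functional_scale[OF u g, of "2 * l"] l by simp
  qed
  have nn: "0 \<le> u g" "0 \<le> u (\<lambda>_. 1)" using pos_functional_nonneg[OF u] g by auto
  show ?thesis
  proof (cases "u (\<lambda>_. 1) = 0")
    case True
    then have "u g \<le> 0" using pos_functional_le_const[OF u g c(2)] by simp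
    with nn True show ?thesis by simp
  next
    case False
    define l where "l = u g / u (\<lambda>_. 1)"
    have "2 * l * u g \<le> l\<^sup>2 * u (\<lambda>_. 1) + u (\<lambda>x. (g x)\<^sup>2)" by (rule amgm) (use nn in \<open>simp add: l_def\<close>)
    then show ?thesis using False nn by (simp add: l_def power2_eq_square field_simps)
  qed
qed

text \<open>
  The seminorm \<open>f \<mapsto> u |f|\<close> is at most the Hilbertian seminorm \<open>sqrt (u 1 * u |f|\<^sup>2)\<close>.
\<close>

lemma dominated_functional_approx:
  fixes \<phi> :: "('a::topological_space, 'k::{real_normed_field, euclidean_space}) cfun_dual \<Rightarrow>\<^sub>L 'k"
  assumes u: "pos_functional u" and \<phi>: "functional_linear \<phi>" and e: "0 < e"
  obtains f where "\<And>\<sigma>. (\<And>g. norm \<langle>\<sigma>, g\<rangle> \<le> u (modulus g)) \<Longrightarrow>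
    norm (\<phi> \<sigma> - \<langle>\<sigma>, f\<rangle>) \<le> e"
proof -
  define Q where "Q f = u (\<lambda>_. 1) * u (\<lambda>x. (norm (apply_bcontfun f x))\<^sup>2)" for f :: "'a \<Rightarrow>\<^sub>C 'k"
  have sq: "(\<lambda>x. (norm (apply_bcontfun f x))\<^sup>2) \<in> nonneg_bcont" for f :: "'a \<Rightarrow>\<^sub>C 'k"
  proof (rule nonneg_bcontI)
    show "continuous_on UNIV (\<lambda>x. (norm (apply_bcontfun f x))\<^sup>2)"
      by (rule continuous_on_power, rule continuous_on_norm, rule continuous_on_apply_bcontfun)
    show "(norm (apply_bcontfun f x))\<^sup>2 \<le> (norm f)\<^sup>2" for x
      by (rule power_mono[OF norm_bounded norm_ge_zero])
  qed simp
  have one: "0 \<le> u (\<lambda>_. 1)" by (rule pos_functional_nonneg[OF u]) auto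
  have Q0: "0 \<le> Q f" for f
    unfolding Q_def using one pos_functional_nonneg[OF u sq] by simp
  have dom: "u (modulus f) \<le> sqrt (Q f)" for f
    unfolding Q_def by (rule real_le_rsqrt, rule pos_functional_Cauchy_Schwarz[OF u nonneg_bcont_norm])
  show ?thesis
  proof (rule hilbertian_functional_approx[of "\<lambda>f. sqrt (Q f)" "u (\<lambda>_. 1)", OF _ _ _ one _ \<phi> e])
    show "0 \<le> sqrt (Q f)" for f using Q0 by simp
    fix f g :: "'a \<Rightarrow>\<^sub>C 'k" and c
    have "Q (cfun_scale c f) = (norm c)\<^sup>2 * Q f"
      using pos_functional_scale[OF u sq[of f], of "(norm c)\<^sup>2"]
      by (simp add: Q_def norm_mult power_mult_distrib)
    then show "sqrt (Q (cfun_scale c f)) = norm c * sqrt (Q f)" by (simp add: real_sqrt_mult)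
    have "u (\<lambda>x. (norm (apply_bcontfun f x))\<^sup>2) \<le> (norm f)\<^sup>2 * u (\<lambda>_. 1)"
      by (rule pos_functional_le_const[OF u sq]) (rule power_mono[OF norm_bounded norm_ge_zero])
    then have "Q f \<le> u (\<lambda>_. 1) * ((norm f)\<^sup>2 * u (\<lambda>_. 1))"
      unfolding Q_def using one by (rule mult_left_mono)
    also have "\<dots> = (u (\<lambda>_. 1) * norm f)\<^sup>2" by (simp add: power2_eq_square algebra_simps)
    finally have "Q f \<le> (u (\<lambda>_. 1) * norm f)\<^sup>2" .
    then show "sqrt (Q f) \<le> u (\<lambda>_. 1) * norm f" using one by (intro real_le_lsqrt) simp_all
    have "u (\<lambda>x. (norm (apply_bcontfun (f + g) x))\<^sup>2 + (norm (apply_bcontfun (f - g) x))\<^sup>2)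
        = u (\<lambda>x. (2 * (norm (apply_bcontfun f x))\<^sup>2) + (2 * (norm (apply_bcontfun g x))\<^sup>2))"
      by (rule arg_cong[of _ _ u]) (simp add: fun_eq_iff power2_norm_eq_inner inner_add_left
          inner_add_right inner_diff_left inner_diff_right algebra_simps)
    also have "\<dots> = u (\<lambda>x. 2 * (norm (apply_bcontfun f x))\<^sup>2) + u (\<lambda>x. 2 * (norm (apply_bcontfun g x))\<^sup>2)"
      by (rule pos_functional_add[OF u]) (use sq in auto)
    also have "\<dots> = 2 * u (\<lambda>x. (norm (apply_bcontfun f x))\<^sup>2) + 2 * u (\<lambda>x. (norm (apply_bcontfun g x))\<^sup>2)"
      using pos_functional_scale[OF u sq[of f], of 2] pos_functional_scale[OF u sq[of g], of 2] by simp
    finally have sum: "u (\<lambda>x. (norm (apply_bcontfun (f + g) x))\<^sup>2) + u (\<lambda>x. (norm (apply_bcontfun (f - g) x))\<^sup>2)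
        = 2 * u (\<lambda>x. (norm (apply_bcontfun f x))\<^sup>2) + 2 * u (\<lambda>x. (norm (apply_bcontfun g x))\<^sup>2)"
      unfolding pos_functional_add[OF u sq sq] .
    have "Q (f + g) + Q (f - g) = 2 * Q f + 2 * Q g"
      unfolding Q_def distrib_left[symmetric] sum by (simp add: algebra_simps)
    then show "(sqrt (Q (f + g)))\<^sup>2 + (sqrt (Q (f - g)))\<^sup>2 \<le> 2 * (sqrt (Q f))\<^sup>2 + 2 * (sqrt (Q g))\<^sup>2"
      using Q0 by simp
  next
    fix f assume f: "\<And>\<sigma>. (\<And>g. norm \<langle>\<sigma>, g\<rangle> \<le> sqrt (Q g)) \<Longrightarrow> norm (\<phi> \<sigma> - \<langle>\<sigma>, f\<rangle>) \<le> e"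
    show thesis by (rule that[of f], rule f) (rule order_trans[OF _ dom])
  qed
qed

section \<open>Second adjoints of dominated operators\<close>

definition nearly_dominated ::
    "(('a::topological_space \<Rightarrow>\<^sub>C 'k::real_normed_field) \<Rightarrow>\<^sub>L ('b::topological_space \<Rightarrow>\<^sub>C 'k)) \<Rightarrow> bool" where
  "nearly_dominated R \<longleftrightarrow> (\<forall>e>0. \<exists>u. pos_functional u \<and>
     (\<forall>f. norm (R f) \<le> u (modulus f) + e * norm f))"

lemma adjoint_diff_le:
  assumes R: "cfun_linear R"
    and R': "cfun_linear R'"
  shows "norm (cfun_adjoint R m - cfun_adjoint R' m) \<le> norm (R - R') * norm m"
proof (rule norm_dual_le)
  fix f
  have "norm \<langle>m, (R - R') f\<rangle> \<le> norm m * norm ((R - R') f)" by (rule norm_dual_pairing)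
  also have "\<dots> \<le> norm m * (norm (R - R') * norm f)" by (intro mult_left_mono norm_blinfun) simp
  finally show "norm \<langle>cfun_adjoint R m - cfun_adjoint R' m, f\<rangle> \<le> norm (R - R') * norm m * norm f"
    by (simp add: dual_pairing_simps adjoint_apply[OF R] adjoint_apply[OF R'] blinfun.diff_left algebra_simps)
qed simp

text \<open>
  If \<open>R\<close> is close in norm to an operator \<open>R'\<close> with \<open>\<parallel>R' f\<parallel> \<le> u |f|\<close>, then on the unit ball \<open>m \<mapsto> \<phi> (R\<^sup>* m)\<close>
  is uniformly close to evaluation at \<open>R' f\<close>, for an \<open>f\<close> that represents \<open>\<phi>\<close> approximately on the
  functionals dominated by \<open>u\<close>. So the function \<open>t \<mapsto> \<phi> (R\<^sup>* \<delta>\<^sub>t)\<close> is a uniform limit of elements of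
  \<open>C(L)\<close>, and it represents the functional.
\<close>

lemma second_adjoint_into_cfun:
  fixes R :: "('a::topological_space \<Rightarrow>\<^sub>C 'k::{real_normed_field, euclidean_space}) \<Rightarrow>\<^sub>L ('b::topological_space \<Rightarrow>\<^sub>C 'k)"
  assumes ed: "extremally_disconnected (euclidean :: 'b topology)"
    and R: "cfun_linear R"
    and dom: "nearly_dominated R" and \<phi>: "functional_linear \<phi>"
  obtains y where "\<And>m. \<phi> (cfun_adjoint R m) = \<langle>m, y\<rangle>"
proof -
  have approx: "\<exists>y. \<forall>m. norm m \<le> 1 \<longrightarrow> norm (\<phi> (cfun_adjoint R m) - \<langle>m, y\<rangle>) \<le> e" if e: "0 < e" for e
  proof -
    define d where "d = (e / 2) / (norm \<phi> + 1)"
    have p: "0 < norm \<phi> + 1" by (simp add: add_nonneg_pos)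
    have d: "0 < d" using e p by (simp add: d_def)
    have "norm \<phi> * d \<le> (norm \<phi> + 1) * d" using d by (intro mult_right_mono) auto
    also have "\<dots> = e / 2"
      using p unfolding d_def by (metis less_irrefl nonzero_mult_div_cancel_left times_divide_eq_right)
    finally have d': "norm \<phi> * d \<le> e / 2" .
    obtain u where u: "pos_functional u"
        "\<And>f. norm (R f) \<le> u (modulus f) + d * norm f"
      using dom d unfolding nearly_dominated_def by blast
    obtain R' where R': "cfun_linear R'" "norm (R - R') \<le> d"
        "\<And>f. norm (R' f) \<le> u (modulus f)"
      using operator_decomposition[OF ed R u(1) less_imp_le[OF d] u(2)] by blast
    obtain f where f: "\<And>\<sigma>. (\<And>g. norm \<langle>\<sigma>, g\<rangle> \<le> u (modulus g)) \<Longrightarrow>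
        norm (\<phi> \<sigma> - \<langle>\<sigma>, f\<rangle>) \<le> e / 2"
      using dominated_functional_approx[OF u(1) \<phi>, of "e / 2"] e by auto
    have "norm (\<phi> (cfun_adjoint R m) - \<langle>m, R' f\<rangle>) \<le> e" if m: "norm m \<le> 1" for m
    proof -
      have "norm \<langle>cfun_adjoint R' m, g\<rangle> \<le> u (modulus g)" for g
      proof -
        have "norm \<langle>m, R' g\<rangle> \<le> norm m * norm (R' g)" by (rule norm_dual_pairing)
        also have "\<dots> \<le> norm (R' g)" using m by (intro mult_left_le_one_le) auto
        finally show ?thesis using R'(3)[of g] by (simp add: adjoint_apply[OF R'(1)])
      qed
      then have "norm (\<phi> (cfun_adjoint R' m) - \<langle>cfun_adjoint R' m, f\<rangle>) \<le> e / 2" by (rule f)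
      moreover have "norm (\<phi> (cfun_adjoint R m) - \<phi> (cfun_adjoint R' m)) \<le> e / 2"
      proof -
        have "norm (cfun_adjoint R m - cfun_adjoint R' m) \<le> norm (R - R') * norm m"
          by (rule adjoint_diff_le[OF R R'(1)])
        also have "\<dots> \<le> d" using R'(2) m d
          by (meson mult_left_le norm_ge_zero order_trans)
        finally have "norm \<phi> * norm (cfun_adjoint R m - cfun_adjoint R' m) \<le> norm \<phi> * d"
          by (intro mult_left_mono) auto
        with norm_blinfun[of \<phi> "cfun_adjoint R m - cfun_adjoint R' m"] d' show ?thesis
          by (simp add: blinfun.diff_right)
      qed
      ultimately show ?thesis
        using norm_triangle_ineq[of "\<phi> (cfun_adjoint R m) - \<phi> (cfun_adjoint R' m)"
            "\<phi> (cfun_adjoint R' m) - \<langle>m, R' f\<rangle>"]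
        by (simp add: adjoint_apply[OF R'(1)])
    qed
    then show ?thesis by blast
  qed
  have "\<exists>y. \<forall>m. norm m \<le> 1 \<longrightarrow> norm (\<phi> (cfun_adjoint R m) - \<langle>m, y\<rangle>) \<le> inverse (real (Suc n))" for n
    by (rule approx) simp
  then obtain Y where Y: "\<And>n m. norm m \<le> 1 \<Longrightarrow>
      norm (\<phi> (cfun_adjoint R m) - \<langle>m, Y n\<rangle>) \<le> inverse (real (Suc n))"
    by metis
  have "uniform_limit UNIV (\<lambda>n. apply_bcontfun (Y n)) (\<lambda>t. \<phi> (cfun_adjoint R (point_eval t))) sequentially"
  proof (rule uniform_limitI)
    fix e :: real assume "0 < e"
    then have "eventually (\<lambda>n. inverse (real (Suc n)) < e) sequentially"
      by (rule order_tendstoD(2)[OF LIMSEQ_inverse_real_of_nat])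
    then show "eventually (\<lambda>n. \<forall>t\<in>UNIV. dist (apply_bcontfun (Y n) t) (\<phi> (cfun_adjoint R (point_eval t))) < e) sequentially"
    proof (rule eventually_mono)
      fix n assume n: "inverse (real (Suc n)) < e"
      have "dist (apply_bcontfun (Y n) t) (\<phi> (cfun_adjoint R (point_eval t))) < e" for t
        using Y[OF norm_point_eval[of t], of n] n by (simp add: dist_norm norm_minus_commute point_eval)
      then show "\<forall>t\<in>UNIV. dist (apply_bcontfun (Y n) t) (\<phi> (cfun_adjoint R (point_eval t))) < e"
        by blast
    qed
  qed
  then obtain y where y: "Y \<longlonglongrightarrow> y"
    by (rule uniform_limit_bcontfunE) simp
  have unit: "\<phi> (cfun_adjoint R m) = \<langle>m, y\<rangle>" if m: "norm m \<le> 1" for m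
  proof (rule LIMSEQ_unique)
    show "(\<lambda>n. \<langle>m, Y n\<rangle>) \<longlonglongrightarrow> \<langle>m, y\<rangle>" by (intro tendsto_intros y)
    have "(\<lambda>n. \<phi> (cfun_adjoint R m) - \<langle>m, Y n\<rangle>) \<longlonglongrightarrow> 0"
      by (rule Lim_null_comparison[OF _ LIMSEQ_inverse_real_of_nat]) (use Y[OF m] in auto)
    then show "(\<lambda>n. \<langle>m, Y n\<rangle>) \<longlonglongrightarrow> \<phi> (cfun_adjoint R m)"
      using tendsto_diff[OF tendsto_const[of "\<phi> (cfun_adjoint R m)"]] by fastforce
  qed
  show ?thesis
  proof (rule that[of y])
    fix m
    show "\<phi> (cfun_adjoint R m) = \<langle>m, y\<rangle>"
    proof (cases "m = 0")
      case False
      then have "inverse (norm m) *\<^sub>R \<phi> (cfun_adjoint R m) = inverse (norm m) *\<^sub>R \<langle>m, y\<rangle>"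
        using unit[of "inverse (norm m) *\<^sub>R m"] by (simp add: blinfun.scaleR_right dual_pairing_simps)
      then show ?thesis using False by simp
    qed (simp add: blinfun.zero_right dual_pairing_simps)
  qed
qed

section \<open>Weak compactness from the second adjoint\<close>

text \<open>
  The unit ball of the dual space, in the topology of pointwise convergence (Alaoglu).
\<close>

lemma compact_dual_ball:
  fixes s :: "'k::{real_normed_field, euclidean_space} \<Rightarrow> 'e::real_normed_vector \<Rightarrow> 'e"
  shows "compact {g :: 'e \<Rightarrow> 'k. (\<forall>x y. g (x + y) = g x + g y) \<and> (\<forall>c x. g (s c x) = c * g x) \<and>
    (\<forall>x. norm (g x) \<le> norm x)}" (is "compact ?D")
proof -
  let ?P = "Pi\<^sub>E UNIV (\<lambda>x. cball 0 (norm x)) :: ('e \<Rightarrow> 'k) set"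
  have "compactin (product_topology (\<lambda>_::'e. euclidean :: 'k topology) UNIV) ?P"
    by (simp add: compactin_PiE)
  then have P: "compact ?P" by (simp add: euclidean_product_topology)
  have "?D = ?P \<inter> ((\<Inter>x y. {g. g (x + y) = g x + g y}) \<inter> (\<Inter>c x. {g. g (s c x) = c * g x}))"
    by auto
  moreover have "closed ((\<Inter>x y. {g :: 'e \<Rightarrow> 'k. g (x + y) = g x + g y}) \<inter> (\<Inter>c x. {g. g (s c x) = c * g x}))"
    by (intro closed_Int closed_INT ballI closed_Collect_eq continuous_on_add continuous_on_mult
        continuous_on_const continuous_on_product_coordinates)
  ultimately show ?thesis using P by (simp only: compact_Int_closed)
qed

lemma openin_weak_topology:
  assumes "Vector_Spaces.linear s (*) (blinfun_apply \<phi>)" "open U"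
  shows "openin (weak_topology s) (blinfun_apply \<phi> -` U)"
  unfolding weak_topology_def by (rule topology_generated_by_Basis) (use assms in auto)

lemma Hausdorff_weak_topology:
  fixes s :: "'k::real_normed_field \<Rightarrow> 'e::real_normed_vector \<Rightarrow> 'e"
  assumes "\<And>x y. x \<noteq> y \<Longrightarrow> \<exists>\<phi> :: 'e \<Rightarrow>\<^sub>L 'k. Vector_Spaces.linear s (*) (blinfun_apply \<phi>) \<and> \<phi> x \<noteq> \<phi> y"
  shows "Hausdorff_space (weak_topology s)"
  unfolding Hausdorff_space_def
proof (intro allI impI)
  fix x y :: 'e assume "x \<in> topspace (weak_topology s) \<and> y \<in> topspace (weak_topology s) \<and> x \<noteq> y"
  then obtain \<phi> :: "'e \<Rightarrow>\<^sub>L 'k" where \<phi>: "Vector_Spaces.linear s (*) (blinfun_apply \<phi>)" "\<phi> x \<noteq> \<phi> y"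
    using assms by blast
  obtain U V where UV: "open U" "open V" "\<phi> x \<in> U" "\<phi> y \<in> V" "U \<inter> V = {}"
    using hausdorff[OF \<phi>(2)] by blast
  then show "\<exists>U V. openin (weak_topology s) U \<and> openin (weak_topology s) V \<and> x \<in> U \<and> y \<in> V \<and> disjnt U V"
    using openin_weak_topology[OF \<phi>(1)]
    by (intro exI[of _ "\<phi> -` U"] exI[of _ "\<phi> -` V"]) (auto simp: disjnt_def)
qed

lemma compactin_weak_closure:
  fixes s :: "'k::real_normed_field \<Rightarrow> 'e::real_normed_vector \<Rightarrow> 'e" and h :: "'c::topological_space \<Rightarrow> 'e"
  assumes vs: "vector_space s" and D: "compact D"
    and cont: "\<And>\<phi> :: 'e \<Rightarrow>\<^sub>L 'k. Vector_Spaces.linear s (*) (blinfun_apply \<phi>) \<Longrightarrow> continuous_on D (\<lambda>g. \<phi> (h g))"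
    and sep: "\<And>x y. x \<noteq> y \<Longrightarrow> \<exists>\<phi> :: 'e \<Rightarrow>\<^sub>L 'k. Vector_Spaces.linear s (*) (blinfun_apply \<phi>) \<and> \<phi> x \<noteq> \<phi> y"
    and A: "A \<subseteq> h ` D"
  shows "compactin (weak_topology s) (weak_topology s closure_of A)"
proof -
  have "continuous_map (top_of_set D) (weak_topology s) h"
    unfolding weak_topology_def
  proof (rule continuous_on_generated_topo)
    fix W assume "W \<in> {blinfun_apply \<phi> -` U | (\<phi> :: 'e \<Rightarrow>\<^sub>L 'k) U. Vector_Spaces.linear s (*) \<phi> \<and> open U}"
    then obtain \<phi> :: "'e \<Rightarrow>\<^sub>L 'k" and U where
      W: "W = blinfun_apply \<phi> -` U" "Vector_Spaces.linear s (*) (blinfun_apply \<phi>)" "open U" by blast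
    have "openin (top_of_set D) (D \<inter> (\<lambda>g. \<phi> (h g)) -` U)"
      by (rule continuous_openin_preimage_gen[OF cont[OF W(2)] W(3)])
    moreover have "h -` W \<inter> topspace (top_of_set D) = D \<inter> (\<lambda>g. \<phi> (h g)) -` U"
      using W(1) by auto
    ultimately show "openin (top_of_set D) (h -` W \<inter> topspace (top_of_set D))" by simp
  next
    show "h ` topspace (top_of_set D) \<subseteq>
        \<Union>{blinfun_apply \<phi> -` U | (\<phi> :: 'e \<Rightarrow>\<^sub>L 'k) U. Vector_Spaces.linear s (*) \<phi> \<and> open U}"
      using topspace_weak_topology[OF vs] unfolding weak_topology_def topology_generated_by_topspace
      by auto
  qed
  then have "compactin (weak_topology s) (h ` D)"
    using D by (intro image_compactin[of "top_of_set D"]) (auto simp: compactin_subtopology)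
  moreover from this have "weak_topology s closure_of A \<subseteq> h ` D"
    using A by (intro closure_of_minimal compactin_imp_closedin Hausdorff_weak_topology sep)
  ultimately show ?thesis by (rule closed_compactin) (rule closedin_closure_of)
qed

lemma dual_separates:
  assumes "x \<noteq> y"
  shows "\<exists>\<phi> :: ('a::topological_space \<Rightarrow>\<^sub>C 'k::real_normed_field) \<Rightarrow>\<^sub>L 'k.
    Vector_Spaces.linear cfun_scale (*) (blinfun_apply \<phi>) \<and> \<phi> x \<noteq> \<phi> y"
proof -
  obtain t where "apply_bcontfun x t \<noteq> apply_bcontfun y t" using assms bcontfun_eqI by blast
  then have "\<langle>point_eval t, x\<rangle> \<noteq> \<langle>point_eval t, y\<rangle>" by (simp add: point_eval)
  then show ?thesis using functional_of_dual by blast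
qed

lemma evaluation_functional:
  fixes f :: "'a::topological_space \<Rightarrow>\<^sub>C 'k::real_normed_field"
  obtains \<Phi> where "functional_linear \<Phi>" "\<And>m. blinfun_apply \<Phi> m = \<langle>m, f\<rangle>"
proof -
  have bl: "bounded_linear (\<lambda>m. \<langle>m, f\<rangle>)"
    by (rule bounded_linear_intro[of _ "norm f"]) (auto simp: dual_pairing_simps norm_dual_pairing)
  show ?thesis
    by (rule that[of "Blinfun (\<lambda>m. \<langle>m, f\<rangle>)"])
      (simp_all add: bounded_linear_Blinfun_apply[OF bl] Vector_Spaces.linear_iff
        vector_space_dual_scale vector_space_over_itself dual_pairing_simps)
qed

lemma evaluations_separate:
  assumes "m \<noteq> n"
  shows "\<exists>\<Phi> :: ('a::topological_space, 'k::real_normed_field) cfun_dual \<Rightarrow>\<^sub>L 'k. functional_linear \<Phi> \<and> \<Phi> m \<noteq> \<Phi> n"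
proof -
  obtain f where f: "\<langle>m, f\<rangle> \<noteq> \<langle>n, f\<rangle>" using assms dual_eqI by blast
  obtain \<Phi> where "functional_linear \<Phi>" "\<And>m. blinfun_apply \<Phi> m = \<langle>m, f\<rangle>" using evaluation_functional[of f] by metis
  with f show ?thesis by metis
qed

text \<open>
  By hypothesis \<open>R\<^sup>*\<^sup>*\<close> is a weak*-to-weak continuous map from the second dual of \<open>C(K)\<close> into \<open>C(L)\<close>, and
  \<open>R\<^sup>*\<close> is weak*-to-weak continuous too. Both map the compact dual ball onto a set that contains the
  image of the unit ball in question.
\<close>

lemma weakly_compact_of_second_adjoint:
  fixes R :: "('a::topological_space \<Rightarrow>\<^sub>C 'k::{real_normed_field, euclidean_space}) \<Rightarrow>\<^sub>L ('b::topological_space \<Rightarrow>\<^sub>C 'k)"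
  assumes R: "cfun_linear R"
    and second: "\<And>\<phi>. functional_linear \<phi> \<Longrightarrow> \<exists>y. \<forall>m. blinfun_apply \<phi> (cfun_adjoint R m) = \<langle>m, y\<rangle>"
  shows "weakly_compact_op cfun_scale cfun_scale R"
    and "weakly_compact_op dual_scale dual_scale (cfun_adjoint R)"
proof -
  define D where "D = {g :: ('a, 'k) cfun_dual \<Rightarrow> 'k. (\<forall>x y. g (x + y) = g x + g y) \<and>
    (\<forall>c x. g (dual_scale c x) = c * g x) \<and> (\<forall>x. norm (g x) \<le> norm x)}"
  have D: "compact D" unfolding D_def by (rule compact_dual_ball)
  have "\<exists>y. \<forall>m. g (cfun_adjoint R m) = \<langle>m, y\<rangle>" if g: "g \<in> D" for g
  proof -
    have bl: "bounded_linear g"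
    proof (rule bounded_linear_intro)
      show "g (r *\<^sub>R m) = r *\<^sub>R g m" for r m
      proof -
        have "dual_scale (of_real r) m = r *\<^sub>R m"
          by (rule dual_eqI) (simp add: dual_pairing_simps scaleR_conv_of_real)
        then show ?thesis using g by (metis (mono_tags, lifting) D_def mem_Collect_eq scaleR_conv_of_real)
      qed
      show "norm (g m) \<le> norm m * 1" for m using g by (simp add: D_def)
    qed (use g in \<open>simp add: D_def\<close>)
    have "functional_linear (Blinfun g)"
      using g by (simp add: bounded_linear_Blinfun_apply[OF bl] Vector_Spaces.linear_iff
        vector_space_dual_scale vector_space_over_itself D_def)
    from second[OF this] show ?thesis by (simp add: bounded_linear_Blinfun_apply[OF bl])
  qed
  then obtain Y where Y: "\<And>g m. g \<in> D \<Longrightarrow> g (cfun_adjoint R m) = \<langle>m, Y g\<rangle>" by metis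
  have "compactin (weak_topology cfun_scale) (weak_topology cfun_scale closure_of (R ` cball 0 1))"
  proof (rule compactin_weak_closure[OF vector_space_cfun_scale D _ dual_separates])
    fix \<phi> :: "('b \<Rightarrow>\<^sub>C 'k) \<Rightarrow>\<^sub>L 'k" assume "Vector_Spaces.linear cfun_scale (*) (blinfun_apply \<phi>)"
    then have "functional_of_dual (dual_of_functional \<phi>) = \<phi>" by (simp add: dual_of_functional_inverse)
    then have "g (cfun_adjoint R (dual_of_functional \<phi>)) = \<phi> (Y g)" if "g \<in> D" for g
      using Y[OF that, of "dual_of_functional \<phi>"] by simp
    moreover have "continuous_on D (\<lambda>g. g (cfun_adjoint R (dual_of_functional \<phi>)))"
      by (rule continuous_on_subset[OF continuous_on_product_coordinates]) simp
    ultimately show "continuous_on D (\<lambda>g. \<phi> (Y g))" by (simp cong: continuous_on_cong)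
  next
    show "R ` cball 0 1 \<subseteq> Y ` D"
    proof
      fix z assume "z \<in> R ` cball 0 1"
      then obtain f where f: "z = R f" "norm f \<le> 1" by auto
      have "norm \<langle>m, f\<rangle> \<le> norm m" for m
        using norm_dual_pairing[of m f] f(2) by (meson mult_left_le norm_ge_zero order_trans)
      then have ev: "(\<lambda>m. \<langle>m, f\<rangle>) \<in> D" by (simp add: D_def dual_pairing_simps)
      have "Y (\<lambda>m. \<langle>m, f\<rangle>) = R f"
      proof (rule bcontfun_eqI)
        fix t
        show "apply_bcontfun (Y (\<lambda>m. \<langle>m, f\<rangle>)) t = apply_bcontfun (R f) t"
          using Y[OF ev, of "point_eval t"] by (simp add: adjoint_apply[OF R] point_eval)
      qed
      then show "z \<in> Y ` D" using ev f(1) by force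
    qed
  qed
  then show "weakly_compact_op cfun_scale cfun_scale R" using R by (simp add: weakly_compact_op_def)
next
  define D where "D = {g :: ('b \<Rightarrow>\<^sub>C 'k) \<Rightarrow> 'k. (\<forall>x y. g (x + y) = g x + g y) \<and>
    (\<forall>c x. g (cfun_scale c x) = c * g x) \<and> (\<forall>x. norm (g x) \<le> norm x)}"
  have D: "compact D" unfolding D_def by (rule compact_dual_ball)
  have "\<exists>m. \<forall>f. \<langle>m, f\<rangle> = g f" if g: "g \<in> D" for g
    by (rule dual_exists[of g 1]) (use g in \<open>auto simp: D_def\<close>)
  then obtain M where M: "\<And>g f. g \<in> D \<Longrightarrow> \<langle>M g, f\<rangle> = g f" by metis
  have "compactin (weak_topology dual_scale) (weak_topology dual_scale closure_of (cfun_adjoint R ` cball 0 1))"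
  proof (rule compactin_weak_closure[OF vector_space_dual_scale D _ evaluations_separate])
    fix \<phi> :: "('a, 'k) cfun_dual \<Rightarrow>\<^sub>L 'k" assume "functional_linear \<phi>"
    then obtain y where y: "\<And>m. \<phi> (cfun_adjoint R m) = \<langle>m, y\<rangle>" using second by blast
    have "continuous_on D (\<lambda>g. g y)"
      by (rule continuous_on_subset[OF continuous_on_product_coordinates]) simp
    then show "continuous_on D (\<lambda>g. \<phi> (cfun_adjoint R (M g)))" by (simp add: y M cong: continuous_on_cong)
  next
    show "cfun_adjoint R ` cball 0 1 \<subseteq> (\<lambda>g. cfun_adjoint R (M g)) ` D"
    proof
      fix z assume "z \<in> cfun_adjoint R ` cball 0 1"
      then obtain m where m: "z = cfun_adjoint R m" "norm m \<le> 1" by auto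
      have "norm \<langle>m, f\<rangle> \<le> norm f" for f
        using norm_dual_pairing[of m f] m(2) by (meson mult_left_le_one_le norm_ge_zero order_trans)
      then have ev: "blinfun_apply (functional_of_dual m) \<in> D" by (simp add: D_def dual_pairing_simps)
      have "M (blinfun_apply (functional_of_dual m)) = m" by (rule dual_eqI) (simp add: M[OF ev])
      then show "z \<in> (\<lambda>g. cfun_adjoint R (M g)) ` D" using ev m(1) by force
    qed
  qed
  then show "weakly_compact_op dual_scale dual_scale (cfun_adjoint R)"
    using linear_adjoint[OF R] by (simp add: weakly_compact_op_def)
qed

theorem nearly_dominated_imp_weakly_compact:
  fixes R :: "('a::topological_space \<Rightarrow>\<^sub>C 'k::{real_normed_field, euclidean_space}) \<Rightarrow>\<^sub>L ('b::topological_space \<Rightarrow>\<^sub>C 'k)"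
  assumes "extremally_disconnected (euclidean :: 'b topology)"
    and R: "cfun_linear R"
    and "nearly_dominated R"
  shows "weakly_compact_op cfun_scale cfun_scale R"
    and "weakly_compact_op dual_scale dual_scale (cfun_adjoint R)"
  using weakly_compact_of_second_adjoint[OF R] second_adjoint_into_cfun[OF assms] by metis+

section \<open>Sets of functionals that no positive functional dominates\<close>

text \<open>
  The index set splits into infinitely many infinite blocks. If no block has small off-diagonal sums,
  choose from each block a column with a large sum over its own block. In the submatrix of these
  columns the sums are smaller by \<open>\<delta>\<close>, since the entries of the block are missing, and induction on the
  bound applies.
\<close>

lemma Rosenthal_disjointification:
  fixes x :: "nat \<Rightarrow> nat \<Rightarrow> real"
  assumes "0 < \<delta>" "\<And>i j. 0 \<le> x i j"
    and "\<And>j F. finite F \<Longrightarrow> j \<notin> F \<Longrightarrow> (\<Sum>i\<in>F. x i j) \<le> real n * \<delta>"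
  shows "\<exists>m :: nat \<Rightarrow> nat. inj m \<and> (\<forall>j F. finite F \<longrightarrow> j \<notin> F \<longrightarrow> (\<Sum>i\<in>F. x (m i) (m j)) \<le> \<delta>)"
  using assms(2,3)
proof (induction n arbitrary: x)
  case 0
  have "(\<Sum>i\<in>F. x i j) \<le> \<delta>" if "finite F" "j \<notin> F" for j F
    using 0(2)[OF that] assms(1) by simp
  then have id: "inj (\<lambda>i :: nat. i) \<and> (\<forall>j F. finite F \<longrightarrow> j \<notin> F \<longrightarrow> (\<Sum>i\<in>F. x i j) \<le> \<delta>)" by simp
  show ?case by (rule exI[of _ "\<lambda>i :: nat. i"]) (rule id)
next
  case (Suc n)
  define P where "P k a = prod_encode (k, a)" for k a
  have P: "P k a = P l b \<longleftrightarrow> k = l \<and> a = b" for k a l b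
    by (simp add: P_def)
  have injP: "inj (P k)" for k by (rule injI) (simp add: P)
  show ?case
  proof (cases "\<exists>k. \<forall>j F. finite F \<longrightarrow> j \<notin> F \<longrightarrow> (\<Sum>i\<in>F. x (P k i) (P k j)) \<le> \<delta>")
    case True
    then show ?thesis using injP by blast
  next
    case False
    then have "\<forall>k. \<exists>j F. finite F \<and> j \<notin> F \<and> \<delta> < (\<Sum>i\<in>F. x (P k i) (P k j))"
      by (auto simp: not_le)
    then obtain a F where aF: "\<And>k. finite (F k)" "\<And>k. a k \<notin> F k"
        "\<And>k. \<delta> < (\<Sum>i\<in>F k. x (P k i) (P k (a k)))"
      by metis
    define p where "p k = P k (a k)" for k
    have injp: "inj p" by (rule injI) (simp add: p_def P)
    have "\<exists>m :: nat \<Rightarrow> nat. inj m \<and> (\<forall>j F. finite F \<longrightarrow> j \<notin> F \<longrightarrow> (\<Sum>i\<in>F. x (p (m i)) (p (m j))) \<le> \<delta>)"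
    proof (rule Suc.IH)
      fix l G assume G: "finite G" "l \<notin> (G :: nat set)"
      have disj: "p ` G \<inter> P l ` F l = {}" using G by (auto simp: p_def P)
      have "(\<Sum>k\<in>G. x (p k) (p l)) + (\<Sum>i\<in>F l. x (P l i) (p l)) = (\<Sum>i\<in>p ` G \<union> P l ` F l. x i (p l))"
        using G aF(1) disj
        by (simp add: sum.union_disjoint sum.reindex inj_on_subset[OF injp] inj_on_subset[OF injP])
      also have "\<dots> \<le> real (Suc n) * \<delta>"
        by (rule Suc.prems(2)) (use G aF in \<open>auto simp: p_def P\<close>)
      finally show "(\<Sum>k\<in>G. x (p k) (p l)) \<le> real n * \<delta>"
        using aF(3)[of l] by (simp add: p_def algebra_simps)
    qed (rule Suc.prems(1))
    then obtain m :: "nat \<Rightarrow> nat" where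
      m: "inj m \<and> (\<forall>j F. finite F \<longrightarrow> j \<notin> F \<longrightarrow> (\<Sum>i\<in>F. x (p (m i)) (p (m j))) \<le> \<delta>)" ..
    have "inj (\<lambda>k. p (m k))" using inj_compose[OF injp conjunct1[OF m]] by (simp only: comp_def)
    then have pm: "inj (\<lambda>k. p (m k)) \<and>
        (\<forall>j F. finite F \<longrightarrow> j \<notin> F \<longrightarrow> (\<Sum>i\<in>F. x (p (m i)) (p (m j))) \<le> \<delta>)"
      by (rule conjI) (rule conjunct2[OF m])
    show ?thesis by (rule exI[of _ "\<lambda>k. p (m k)"]) (rule pm)
  qed
qed

lemma apply_bcontfun_sum: "apply_bcontfun (sum a F) x = (\<Sum>i\<in>F. apply_bcontfun (a i) x)"
  for a :: "'i \<Rightarrow> ('a::topological_space \<Rightarrow>\<^sub>C 'k::real_normed_vector)"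
  by (induction F rule: infinite_finite_induct) auto

lemma sum_norm_pairing_le:
  fixes a :: "'i \<Rightarrow> ('a::topological_space \<Rightarrow>\<^sub>C 'k::{real_normed_field, euclidean_space})"
  assumes F: "finite F" and c: "0 \<le> c" and le: "\<And>x. (\<Sum>i\<in>F. norm (apply_bcontfun (a i) x)) \<le> c"
  shows "(\<Sum>i\<in>F. norm \<langle>\<mu>, a i\<rangle>) \<le> c * norm \<mu>"
proof -
  have "\<exists>e. norm e = 1 \<and> e * \<langle>\<mu>, a i\<rangle> = of_real (norm \<langle>\<mu>, a i\<rangle>)" for i
    using unit_rotation by metis
  then obtain e where e: "\<And>i. norm (e i) = 1" "\<And>i. e i * \<langle>\<mu>, a i\<rangle> = of_real (norm \<langle>\<mu>, a i\<rangle>)"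
    by metis
  have "norm (\<Sum>i\<in>F. cfun_scale (e i) (a i)) \<le> c"
  proof (rule norm_bound)
    fix x
    have "norm (apply_bcontfun (\<Sum>i\<in>F. cfun_scale (e i) (a i)) x)
        \<le> (\<Sum>i\<in>F. norm (apply_bcontfun (a i) x))"
      by (simp add: apply_bcontfun_sum sum_norm_le norm_mult e)
    with le[of x] show "norm (apply_bcontfun (\<Sum>i\<in>F. cfun_scale (e i) (a i)) x) \<le> c" by linarith
  qed
  then have le': "norm \<mu> * norm (\<Sum>i\<in>F. cfun_scale (e i) (a i)) \<le> norm \<mu> * c"
    by (intro mult_left_mono) auto
  have "\<langle>\<mu>, \<Sum>i\<in>F. cfun_scale (e i) (a i)\<rangle> = of_real (\<Sum>i\<in>F. norm \<langle>\<mu>, a i\<rangle>)"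
    by (simp add: blinfun.sum_right dual_pairing_scale_right e)
  then have "norm \<langle>\<mu>, \<Sum>i\<in>F. cfun_scale (e i) (a i)\<rangle> = \<bar>\<Sum>i\<in>F. norm \<langle>\<mu>, a i\<rangle>\<bar>"
    by (simp only: norm_of_real)
  moreover have "0 \<le> (\<Sum>i\<in>F. norm \<langle>\<mu>, a i\<rangle>)" by (simp add: sum_nonneg)
  ultimately show ?thesis
    using norm_dual_pairing[of \<mu> "\<Sum>i\<in>F. cfun_scale (e i) (a i)"] le'
    by (simp add: mult.commute)
qed

lemma convergent_of_bounded_variation:
  fixes a :: "nat \<Rightarrow> 'v::banach"
  assumes "\<And>m. (\<Sum>n<m. norm (a (Suc n) - a n)) \<le> c"
  shows "convergent a"
proof -
  have "summable (\<lambda>n. norm (a (Suc n) - a n))"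
    by (rule summableI_nonneg_bounded[of _ c]) (use assms in auto)
  then have "summable (\<lambda>n. a (Suc n) - a n)" by (rule summable_norm_cancel)
  then have "convergent (\<lambda>m. (\<Sum>n<m. a (Suc n) - a n) + a 0)"
    by (intro convergent_add) (simp_all add: summable_iff_convergent convergent_const)
  then show ?thesis by (simp add: sum_lessThan_telescope)
qed

text \<open>
  If independent events have the probabilities \<open>h i\<close>, the summand is the probability that the event \<open>i\<close>
  is the last one to occur.
\<close>

lemma sum_disjointified:
  fixes h :: "nat \<Rightarrow> real"
  shows "(\<Sum>i\<le>N. (\<Prod>l\<in>{i<..N}. 1 - h l) * h i) = 1 - (\<Prod>l\<le>N. 1 - h l)"
proof (induction N)
  case (Suc N)
  have "{i<..Suc N} = insert (Suc N) {i<..N}" if "i \<le> N" for i using that by auto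
  then have "(\<Sum>i\<le>N. (\<Prod>l\<in>{i<..Suc N}. 1 - h l) * h i)
      = (1 - h (Suc N)) * (\<Sum>i\<le>N. (\<Prod>l\<in>{i<..N}. 1 - h l) * h i)"
    by (simp add: sum_distrib_left mult.assoc)
  also have "\<dots> = (1 - h (Suc N)) * (1 - (\<Prod>l\<le>N. 1 - h l))" by (simp only: Suc)
  finally show ?case by simp (simp add: algebra_simps)
qed simp

text \<open>
  The functions \<open>g i N\<close> are \<open>f i\<close>, multiplied by factors that suppress it where one of the later
  functions \<open>f l\<close> with \<open>l \<le> N\<close> is large. Their moduli add up to at most \<open>1\<close>, as for disjoint functions,
  so for each functional \<open>\<mu>\<close> the limits \<open>\<Gamma> i \<mu>\<close> over \<open>N\<close> are absolutely summable in \<open>i\<close>. The factors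
  belong to later indices since these are the functions that are small for a functional chosen
  at stage \<open>i\<close>.
\<close>

locale disjointification =
  fixes f :: "nat \<Rightarrow> ('a::topological_space \<Rightarrow>\<^sub>C 'k::{real_normed_field, euclidean_space})"
  assumes norm_le_one: "\<And>i. norm (f i) \<le> 1"
begin

abbreviation h where "h i x \<equiv> norm (apply_bcontfun (f i) x)"

lemma h_le: "h i x \<le> 1"
  using norm_bounded[of "f i" x] norm_le_one[of i] by linarith

abbreviation w where "w i N x \<equiv> (\<Prod>l\<in>{i<..N}. 1 - h l x)"

lemma w_bounds: "0 \<le> w i N x" "w i N x \<le> 1"
  using h_le by (auto intro!: prod_nonneg prod_le_1)

definition g :: "nat \<Rightarrow> nat \<Rightarrow> ('a \<Rightarrow>\<^sub>C 'k)" where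
  "g i N = (if i \<le> N then Bcontfun (\<lambda>x. w i N x *\<^sub>R apply_bcontfun (f i) x) else 0)"

lemma g_apply: "apply_bcontfun (g i N) x = (if i \<le> N then w i N x *\<^sub>R apply_bcontfun (f i) x else 0)"
proof -
  have "continuous_on UNIV (\<lambda>x. w i N x)"
    by (intro continuous_on_prod continuous_on_diff continuous_on_const continuous_on_norm
        continuous_on_apply_bcontfun)
  moreover have "\<bar>w i N x\<bar> \<le> 1" for x using w_bounds[where i = i and N = N and x = x] by simp
  ultimately obtain k where "\<And>x. apply_bcontfun k x = w i N x *\<^sub>R apply_bcontfun (f i) x"
    using bcontfun_real_multiple by blast
  then have "(\<lambda>x. w i N x *\<^sub>R apply_bcontfun (f i) x) = apply_bcontfun k" by (simp add: fun_eq_iff)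
  then have "(\<lambda>x. w i N x *\<^sub>R apply_bcontfun (f i) x) \<in> bcontfun"
    using apply_bcontfun[of k] by simp
  then show ?thesis by (simp add: g_def Bcontfun_inverse)
qed

lemma sum_norm_g_le:
  assumes "finite F"
  shows "(\<Sum>i\<in>F. norm (apply_bcontfun (g i N) x)) \<le> 1"
proof -
  have "(\<Sum>i\<in>F. norm (apply_bcontfun (g i N) x)) = (\<Sum>i\<in>F \<inter> {..N}. w i N x * h i x)"
    by (rule sum.mono_neutral_cong_right) (use assms w_bounds in \<open>auto simp: g_apply\<close>)
  also have "\<dots> \<le> (\<Sum>i\<le>N. w i N x * h i x)"
    by (rule sum_mono2) (use w_bounds in auto)
  also have "\<dots> \<le> 1"
    unfolding sum_disjointified using h_le by (simp add: prod_nonneg)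
  finally show ?thesis .
qed

lemma sum_pairing_g_le: "finite F \<Longrightarrow> (\<Sum>i\<in>F. norm \<langle>\<mu>, g i N\<rangle>) \<le> norm \<mu>"
  using sum_norm_pairing_le[of F 1 "\<lambda>i. g i N" \<mu>] sum_norm_g_le by simp

lemma convergent_pairing_g: "convergent (\<lambda>N. \<langle>\<mu>, g i N\<rangle>)"
proof -
  have "(\<Sum>n<m. norm (apply_bcontfun (g i (i + Suc n) - g i (i + n)) x)) \<le> 1" for m x
  proof -
    have w_Suc: "w i (Suc (i + n)) x = w i (i + n) x * (1 - h (Suc (i + n)) x)" for n
    proof -
      have "{i<..Suc (i + n)} = insert (Suc (i + n)) {i<..i + n}" by auto
      then show ?thesis by (simp add: mult.commute)
    qed
    have "norm (apply_bcontfun (g i (i + Suc n) - g i (i + n)) x)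
        = (w i (i + n) x - w i (Suc (i + n)) x) * h i x" for n
    proof -
      have "w i (Suc (i + n)) x \<le> w i (i + n) x"
        unfolding w_Suc using h_le w_bounds by (intro mult_right_le_one_le) auto
      then show ?thesis by (simp add: g_apply scaleR_diff_left[symmetric])
    qed
    then have "(\<Sum>n<m. norm (apply_bcontfun (g i (i + Suc n) - g i (i + n)) x))
        = (\<Sum>n<m. w i (i + n) x - w i (i + Suc n) x) * h i x"
      by (simp add: sum_distrib_right)
    also have "\<dots> = (1 - w i (i + m) x) * h i x"
      by (subst sum_lessThan_telescope') simp
    also have "\<dots> \<le> 1" using w_bounds(1) h_le by (intro mult_le_one) auto
    finally show ?thesis .
  qed
  then have "(\<Sum>n<m. norm \<langle>\<mu>, g i (i + Suc n) - g i (i + n)\<rangle>) \<le> 1 * norm \<mu>" for m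
    by (intro sum_norm_pairing_le) auto
  then have "convergent (\<lambda>n. \<langle>\<mu>, g i (i + n)\<rangle>)"
    by (intro convergent_of_bounded_variation[where c = "1 * norm \<mu>"])
      (simp add: dual_pairing_simps)
  then obtain L where "(\<lambda>n. \<langle>\<mu>, g i (n + i)\<rangle>) \<longlonglongrightarrow> L" by (auto simp: convergent_def add.commute)
  then show ?thesis using LIMSEQ_offset convergent_def by blast
qed

definition \<Gamma> :: "nat \<Rightarrow> ('a, 'k) cfun_dual \<Rightarrow> 'k" where
  "\<Gamma> i \<mu> = lim (\<lambda>N. \<langle>\<mu>, g i N\<rangle>)"

lemma \<Gamma>: "(\<lambda>N. \<langle>\<mu>, g i N\<rangle>) \<longlonglongrightarrow> \<Gamma> i \<mu>"
  using convergent_pairing_g by (simp add: \<Gamma>_def convergent_LIMSEQ_iff)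

lemma sum_\<Gamma>_le:
  assumes "finite F"
  shows "(\<Sum>i\<in>F. norm (\<Gamma> i \<mu>)) \<le> norm \<mu>"
proof (rule LIMSEQ_le_const2)
  show "(\<lambda>N. \<Sum>i\<in>F. norm \<langle>\<mu>, g i N\<rangle>) \<longlonglongrightarrow> (\<Sum>i\<in>F. norm (\<Gamma> i \<mu>))"
    by (intro tendsto_intros \<Gamma>)
qed (use sum_pairing_g_le[OF assms] in auto)

lemma \<Gamma>_diff_le:
  assumes le: "\<And>N. (\<Sum>l\<in>{i<..N}. variation \<mu> (\<lambda>x. h l x)) \<le> c"
  shows "norm (\<langle>\<mu>, f i\<rangle> - \<Gamma> i \<mu>) \<le> c"
proof (rule LIMSEQ_le_const2)
  show "(\<lambda>N. norm (\<langle>\<mu>, f i\<rangle> - \<langle>\<mu>, g i N\<rangle>)) \<longlonglongrightarrow> norm (\<langle>\<mu>, f i\<rangle> - \<Gamma> i \<mu>)"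
    by (intro tendsto_intros \<Gamma>)
  have "norm (\<langle>\<mu>, f i\<rangle> - \<langle>\<mu>, g i N\<rangle>) \<le> c" if N: "i \<le> N" for N
  proof -
    have sum_cone: "(\<lambda>x. \<Sum>l\<in>F. h l x) \<in> nonneg_bcont \<and>
        variation \<mu> (\<lambda>x. \<Sum>l\<in>F. h l x) = (\<Sum>l\<in>F. variation \<mu> (\<lambda>x. h l x))" if "finite F" for F
      using that
    proof induction
      case (insert l F)
      then show ?case
        using pos_functional_add[OF pos_functional_variation, of "\<lambda>x. h l x" "\<lambda>x. \<Sum>l\<in>F. h l x" \<mu>]
        by (auto intro: nonneg_bcont_add)
    qed (auto simp: pos_functional_at_zero[OF pos_functional_variation])
    have "norm \<langle>\<mu>, f i - g i N\<rangle> \<le> variation \<mu> (\<lambda>x. \<Sum>l\<in>{i<..N}. h l x)"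
    proof (rule variation_upper)
      fix x
      have "norm (apply_bcontfun (f i - g i N) x) = (1 - w i N x) * h i x"
      proof -
        have "apply_bcontfun (f i - g i N) x = (1 - w i N x) *\<^sub>R apply_bcontfun (f i) x"
          using N by (simp add: g_apply scaleR_diff_left)
        then show ?thesis using w_bounds(2)[where i = i and N = N and x = x] by simp
      qed
      also have "\<dots> \<le> 1 - w i N x" using w_bounds(2)[where i = i and N = N and x = x] h_le by (intro mult_left_le) auto
      also have "\<dots> \<le> (\<Sum>l\<in>{i<..N}. h l x)"
        using Weierstrass_prod_ineq[of "{i<..N}" "\<lambda>l. h l x"] h_le by (simp add: algebra_simps)
      finally show "norm (apply_bcontfun (f i - g i N) x) \<le> (\<Sum>l\<in>{i<..N}. h l x)" .
    qed (use sum_cone in blast)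
    also have "\<dots> \<le> c" using sum_cone[of "{i<..N}"] le[of N] by simp
    finally show ?thesis by (simp add: dual_pairing_simps)
  qed
  then show "\<exists>M. \<forall>N\<ge>M. norm (\<langle>\<mu>, f i\<rangle> - \<langle>\<mu>, g i N\<rangle>) \<le> c" by blast
qed

end

text \<open>
  Functionals \<open>\<nu> k\<close> and functions \<open>f k\<close> are chosen in turn, violating domination by a large multiple of
  the sum of the variations of all earlier functionals. As \<open>\<nu> k\<close> is bounded on \<open>f k\<close>, that sum is
  small there.
\<close>

lemma undominated_sequence:
  fixes H :: "('a::topological_space, 'k::{real_normed_field, euclidean_space}) cfun_dual set"
  assumes C: "\<And>\<nu>. \<nu> \<in> H \<Longrightarrow> norm \<nu> \<le> C" and e: "0 < e"
    and undom: "\<And>u. pos_functional u \<Longrightarrow>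
      \<exists>\<nu>\<in>H. \<exists>f. u (modulus f) + e * norm f < norm \<langle>\<nu>, f\<rangle>"
  obtains \<nu> f where "\<And>j. \<nu> j \<in> H" "\<And>j. norm (f j) \<le> 1" "\<And>j. e \<le> norm \<langle>\<nu> j, f j\<rangle>"
    "\<And>j l. j < l \<Longrightarrow> variation (\<nu> j) (modulus (f l)) \<le> (e / 8) * (1/2) ^ l"
proof -
  have "\<exists>\<nu> f. \<nu> \<in> H \<and> norm f \<le> 1 \<and> u (modulus f) + e < norm \<langle>\<nu>, f\<rangle>"
    if u: "pos_functional u" for u
  proof -
    obtain \<nu> f where \<nu>: "\<nu> \<in> H" "u (modulus f) + e * norm f < norm \<langle>\<nu>, f\<rangle>"
      using undom[OF u] by blast
    have "0 \<le> u (modulus f)" by (rule pos_functional_nonneg[OF u]) auto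
    then have "f \<noteq> 0" using \<nu>(2) e by (auto simp: dual_pairing_simps)
    define r where "r = inverse (norm f)"
    have r: "0 < r" "r * norm f = 1" using \<open>f \<noteq> 0\<close> by (simp_all add: r_def)
    have "u (\<lambda>x. r * norm (apply_bcontfun f x)) + e
        = r * (u (modulus f) + e * norm f)"
      using pos_functional_scale[OF u, of "\<lambda>x. norm (apply_bcontfun f x)" r] r
      by (simp add: algebra_simps)
    also have "\<dots> < r * norm \<langle>\<nu>, f\<rangle>" using \<nu>(2) r(1) by (rule mult_strict_left_mono)
    finally show ?thesis using \<nu>(1) r
      by (intro exI[of _ \<nu>] exI[of _ "r *\<^sub>R f"]) (simp add: dual_pairing_simps)
  qed
  then obtain N F where NF: "\<And>u. pos_functional u \<Longrightarrow> N u \<in> H" "\<And>u. pos_functional u \<Longrightarrow> norm (F u) \<le> 1"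
      "\<And>u. pos_functional u \<Longrightarrow> u (modulus (F u)) + e < norm \<langle>N u, F u\<rangle>"
    by metis
  \<comment> \<open>The maximum makes the multiples \<open>\<kappa> k\<close> below positive.\<close>
  define C' where "C' = max C 1"
  \<comment> \<open>With these multiples the values of the earlier variations on \<open>f k\<close> are at most \<open>e / 8\<close> times \<open>2\<^sup>-\<^sup>k\<close>,
    and their sum over \<open>k\<close> is at most \<open>e / 4\<close>.\<close>
  define \<kappa> where "\<kappa> k = 8 * C' / e * 2 ^ k" for k :: nat
  have \<kappa>: "0 < \<kappa> k" for k using e by (simp add: \<kappa>_def C'_def)
  define v where "v = rec_nat (\<lambda>_. 0) (\<lambda>k v g. v g + variation (N (\<lambda>g. \<kappa> k * v g)) g)"
  define \<nu> where "\<nu> k = N (\<lambda>g. \<kappa> k * v k g)" for k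
  define f where "f k = F (\<lambda>g. \<kappa> k * v k g)" for k
  have v0: "v 0 = (\<lambda>_. 0)" and vS: "v (Suc k) = (\<lambda>g. v k g + variation (\<nu> k) g)" for k
    by (simp_all add: v_def \<nu>_def)
  have pos: "pos_functional (v k)" for k
    by (induction k) (auto simp: v0 vS pos_functional_variation)
  then have pos': "pos_functional (\<lambda>g. \<kappa> k * v k g)" for k
    using \<kappa>[of k] by (intro pos_functional_mult) auto
  have var: "variation (\<nu> j) g \<le> v l g" if "j < l" "g \<in> nonneg_bcont" for j l g
    using that(1)
  proof (induction l)
    case (Suc l)
    have "0 \<le> variation (\<nu> l) g" "0 \<le> v l g"
      using pos_functional_nonneg[OF pos_functional_variation that(2)] pos_functional_nonneg[OF pos that(2)]
      by auto
    then show ?case using Suc by (cases "j = l") (auto simp: vS)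
  qed simp
  show ?thesis
  proof (rule that[of \<nu> f])
    show \<nu>H: "\<nu> j \<in> H" for j unfolding \<nu>_def by (rule NF(1)[OF pos'])
    show f1: "norm (f j) \<le> 1" for j unfolding f_def by (rule NF(2)[OF pos'])
    have big: "\<kappa> j * v j (modulus (f j)) + e < norm \<langle>\<nu> j, f j\<rangle>" for j
      unfolding \<nu>_def f_def by (rule NF(3)[OF pos'])
    have nn: "0 \<le> v j (modulus (f j))" for j
      by (rule pos_functional_nonneg[OF pos]) auto
    show "e \<le> norm \<langle>\<nu> j, f j\<rangle>" for j
      using big[of j] mult_nonneg_nonneg[OF less_imp_le[OF \<kappa>[of j]] nn[of j]] by linarith
    fix j l :: nat assume jl: "j < l"
    have "norm \<langle>\<nu> l, f l\<rangle> \<le> C'"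
    proof -
      have "norm (\<nu> l) * norm (f l) \<le> C' * 1"
        using C[OF \<nu>H[of l]] f1[of l] by (intro mult_mono) (auto simp: C'_def)
      then show ?thesis using norm_dual_pairing[of "\<nu> l" "f l"] by simp
    qed
    then have "\<kappa> l * v l (modulus (f l)) \<le> C'" using big[of l] e by linarith
    then have "v l (modulus (f l)) \<le> C' / \<kappa> l"
      using \<kappa>[of l] by (simp add: pos_le_divide_eq mult.commute)
    also have "\<dots> = (e / 8) * (1/2) ^ l" by (simp add: \<kappa>_def C'_def power_one_over)
    finally show "variation (\<nu> j) (modulus (f l)) \<le> (e / 8) * (1/2) ^ l"
      using var[OF jl nonneg_bcont_norm[of "f l"]] by linarith
  qed
qed

text \<open>
  Rosenthal's lemma selects indices for which \<open>\<Gamma> i (\<nu> j)\<close> is large for \<open>i = j\<close> and has a small sum over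
  the other \<open>i\<close>. The sums of the first \<open>k\<close> functions form the array: as functionals \<open>L k\<close> on \<open>M(K)\<close>, they
  are large at \<open>\<nu> j\<close> for \<open>j \<le> k\<close> and small for \<open>j > k\<close>. So the two iterated limits of \<open>L k (\<nu> j)\<close> are
  separated.
\<close>

lemma undominated_array:
  fixes H :: "('a::topological_space, 'k::{real_normed_field, euclidean_space}) cfun_dual set"
  assumes C: "\<And>\<nu>. \<nu> \<in> H \<Longrightarrow> norm \<nu> \<le> C" and e: "0 < e"
    and undom: "\<And>u. pos_functional u \<Longrightarrow>
      \<exists>\<nu>\<in>H. \<exists>f. u (modulus f) + e * norm f < norm \<langle>\<nu>, f\<rangle>"
  obtains \<nu> x L l \<delta> where "0 < \<delta>" "\<And>j. \<nu> j \<in> H" "\<And>k N. norm (x k N) \<le> 1"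
    "\<And>k \<mu>. (\<lambda>N. \<langle>\<mu>, x k N\<rangle>) \<longlonglongrightarrow> L k \<mu>" "\<And>\<mu>. (\<lambda>k. L k \<mu>) \<longlonglongrightarrow> l \<mu>"
    "\<And>j k. k < j \<Longrightarrow> norm (L k (\<nu> j)) \<le> \<delta>" "\<And>j k. j \<le> k \<Longrightarrow> 3 * \<delta> \<le> norm (L k (\<nu> j))"
proof -
  obtain \<nu> f where \<nu>: "\<And>j. \<nu> j \<in> H" and f: "\<And>j. norm (f j) \<le> 1" "\<And>j. e \<le> norm \<langle>\<nu> j, f j\<rangle>"
    and small: "\<And>j l. j < l \<Longrightarrow> variation (\<nu> j) (modulus (f l)) \<le> (e / 8) * (1/2) ^ l"
    using undominated_sequence[OF C e undom] by metis
  interpret disjointification f by standard (rule f)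
  have geo: "(\<Sum>l\<in>{j<..N}. (1/2 :: real) ^ l) \<le> 2" for j N
  proof -
    have "(\<Sum>l\<in>{j<..N}. (1/2 :: real) ^ l) \<le> (\<Sum>l. (1/2) ^ l)"
      by (rule sum_le_suminf) (simp_all add: summable_geometric)
    then show ?thesis by (simp add: suminf_geometric)
  qed
  have diag: "3 * e / 4 \<le> norm (\<Gamma> j (\<nu> j))" for j
  proof -
    have "(\<Sum>l\<in>{j<..N}. variation (\<nu> j) (modulus (f l))) \<le> e / 4" for N
    proof -
      have "(\<Sum>l\<in>{j<..N}. variation (\<nu> j) (modulus (f l)))
          \<le> (\<Sum>l\<in>{j<..N}. (e / 8) * (1/2) ^ l)"
        by (rule sum_mono, rule small) simp
      also have "\<dots> = (e / 8) * (\<Sum>l\<in>{j<..N}. (1/2) ^ l)" by (simp only: sum_distrib_left)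
      also have "\<dots> \<le> (e / 8) * 2" using e geo by (intro mult_left_mono) auto
      finally show ?thesis by simp
    qed
    then have "norm (\<langle>\<nu> j, f j\<rangle> - \<Gamma> j (\<nu> j)) \<le> e / 4" by (rule \<Gamma>_diff_le)
    then show ?thesis
      using f(2)[of j] norm_triangle_ineq2[of "\<langle>\<nu> j, f j\<rangle>" "\<Gamma> j (\<nu> j)"] by linarith
  qed
  \<comment> \<open>The diagonal entries are at least \<open>4 \<delta>\<close>.\<close>
  define \<delta> where "\<delta> = 3 * e / 16"
  have \<delta>: "0 < \<delta>" using e by (simp add: \<delta>_def)
  obtain n where n: "C \<le> real n * \<delta>"
    using real_arch_simple[of "C / \<delta>"] \<delta> by (auto simp: pos_divide_le_eq)
  obtain m :: "nat \<Rightarrow> nat" where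
    m0: "inj m \<and> (\<forall>j F. finite F \<longrightarrow> j \<notin> F \<longrightarrow> (\<Sum>i\<in>F. norm (\<Gamma> (m i) (\<nu> (m j)))) \<le> \<delta>)"
  proof (rule exE[OF Rosenthal_disjointification[OF \<delta>, of "\<lambda>i j. norm (\<Gamma> i (\<nu> j))" n]])
    show "(\<Sum>i\<in>F. norm (\<Gamma> i (\<nu> j))) \<le> real n * \<delta>" if "finite F" for j F
      using sum_\<Gamma>_le[OF that, of "\<nu> j"] C[OF \<nu>[of j]] n by linarith
  qed simp_all
  have m: "inj m" "\<And>j F. finite F \<Longrightarrow> j \<notin> F \<Longrightarrow> (\<Sum>i\<in>F. norm (\<Gamma> (m i) (\<nu> (m j)))) \<le> \<delta>"
    using m0 by simp_all
  have image: "(\<Sum>i\<in>F. t (m i)) = (\<Sum>i\<in>m ` F. t i)" for t :: "nat \<Rightarrow> real" and F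
    using m(1) by (simp add: sum.reindex inj_on_subset)
  show ?thesis
  proof (rule that[of \<delta> "\<lambda>j. \<nu> (m j)" "\<lambda>k N. \<Sum>i\<le>k. g (m i) N" "\<lambda>k \<mu>. \<Sum>i\<le>k. \<Gamma> (m i) \<mu>"
        "\<lambda>\<mu>. \<Sum>i. \<Gamma> (m i) \<mu>"])
    show "norm (\<Sum>i\<le>k. g (m i) N) \<le> 1" for k N
    proof (rule norm_bound)
      fix x
      have "norm (apply_bcontfun (\<Sum>i\<le>k. g (m i) N) x) \<le> (\<Sum>i\<le>k. norm (apply_bcontfun (g (m i) N) x))"
        unfolding apply_bcontfun_sum by (rule norm_sum)
      also have "\<dots> \<le> 1"
        unfolding image[of "\<lambda>i. norm (apply_bcontfun (g i N) x)"] by (rule sum_norm_g_le) simp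
      finally show "norm (apply_bcontfun (\<Sum>i\<le>k. g (m i) N) x) \<le> 1" .
    qed
    show "(\<lambda>N. \<langle>\<mu>, \<Sum>i\<le>k. g (m i) N\<rangle>) \<longlonglongrightarrow> (\<Sum>i\<le>k. \<Gamma> (m i) \<mu>)" for k \<mu>
      unfolding blinfun.sum_right by (intro tendsto_sum \<Gamma>)
    show "(\<lambda>k. \<Sum>i\<le>k. \<Gamma> (m i) \<mu>) \<longlonglongrightarrow> (\<Sum>i. \<Gamma> (m i) \<mu>)" for \<mu>
    proof (rule summable_LIMSEQ', rule summable_norm_cancel, rule summableI_nonneg_bounded)
      show "(\<Sum>i<k. norm (\<Gamma> (m i) \<mu>)) \<le> norm \<mu>" for k
        unfolding image[of "\<lambda>i. norm (\<Gamma> i \<mu>)"] by (rule sum_\<Gamma>_le) simp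
    qed simp
    show "norm (\<Sum>i\<le>k. \<Gamma> (m i) (\<nu> (m j))) \<le> \<delta>" if "k < j" for j k
      using norm_sum[of "\<lambda>i. \<Gamma> (m i) (\<nu> (m j))" "{..k}"] m(2)[of "{..k}" j] that by simp
    show "3 * \<delta> \<le> norm (\<Sum>i\<le>k. \<Gamma> (m i) (\<nu> (m j)))" if "j \<le> k" for j k
    proof -
      have "(\<Sum>i\<le>k. \<Gamma> (m i) (\<nu> (m j)))
          = \<Gamma> (m j) (\<nu> (m j)) + (\<Sum>i\<in>{..k} - {j}. \<Gamma> (m i) (\<nu> (m j)))"
        using that by (subst sum.remove[of _ j]) auto
      moreover have "norm (\<Sum>i\<in>{..k} - {j}. \<Gamma> (m i) (\<nu> (m j))) \<le> \<delta>"
        using norm_sum[of "\<lambda>i. \<Gamma> (m i) (\<nu> (m j))" "{..k} - {j}"] m(2)[of "{..k} - {j}" j] by simp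
      moreover have "4 * \<delta> \<le> norm (\<Gamma> (m j) (\<nu> (m j)))" using diag[of "m j"] by (simp add: \<delta>_def)
      ultimately show ?thesis
        using norm_triangle_ineq2[of "\<Gamma> (m j) (\<nu> (m j))" "- (\<Sum>i\<in>{..k} - {j}. \<Gamma> (m i) (\<nu> (m j)))"]
        by simp
    qed
  qed (use \<delta> \<nu> in auto)
qed

section \<open>Domination by a positive functional from weak compactness\<close>

text \<open>
  A cluster point of the sequence, expressed by the closed conditions that it inherits.
\<close>

lemma weak_cluster_point:
  fixes s :: "'k::real_normed_field \<Rightarrow> 'e::real_normed_vector \<Rightarrow> 'e" and x :: "nat \<Rightarrow> 'e"
  assumes vs: "vector_space s" and S: "compactin (weak_topology s) S" and x: "\<And>j. x j \<in> S"
  shows "\<exists>z\<in>S. \<forall>(\<phi> :: 'e \<Rightarrow>\<^sub>L 'k) B. Vector_Spaces.linear s (*) (blinfun_apply \<phi>) \<longrightarrow> closed B \<longrightarrow>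
       eventually (\<lambda>j. \<phi> (x j) \<in> B) sequentially \<longrightarrow> \<phi> z \<in> B"
proof -
  define \<U> where "\<U> = {blinfun_apply \<phi> -` B | (\<phi> :: 'e \<Rightarrow>\<^sub>L 'k) B. Vector_Spaces.linear s (*) \<phi> \<and>
    closed B \<and> eventually (\<lambda>j. \<phi> (x j) \<in> B) sequentially}"
  have "S \<inter> \<Inter>\<U> \<noteq> {}"
  proof (rule S[unfolded compactin_fip, THEN conjunct2, rule_format], intro conjI ballI allI impI)
    fix C assume "C \<in> \<U>"
    then obtain \<phi> :: "'e \<Rightarrow>\<^sub>L 'k" and B where C: "C = blinfun_apply \<phi> -` B"
      "Vector_Spaces.linear s (*) (blinfun_apply \<phi>)" "closed B"
      by (auto simp: \<U>_def)
    have "openin (weak_topology s) (blinfun_apply \<phi> -` (- B))"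
      by (rule openin_weak_topology[OF C(2)]) (use C(3) in auto)
    moreover have "topspace (weak_topology s) - C = blinfun_apply \<phi> -` (- B)"
      using topspace_weak_topology[OF vs] C(1) by auto
    ultimately show "closedin (weak_topology s) C"
      using topspace_weak_topology[OF vs] by (simp add: closedin_def)
  next
    fix \<F> assume \<F>: "finite \<F> \<and> \<F> \<subseteq> \<U>"
    have "eventually (\<lambda>j. \<forall>C\<in>\<F>. x j \<in> C) sequentially"
      using \<F> by (intro eventually_ball_finite ballI) (auto simp: \<U>_def)
    then obtain j where "\<forall>C\<in>\<F>. x j \<in> C" by (auto simp: eventually_sequentially)
    then show "S \<inter> \<Inter>\<F> \<noteq> {}" using x[of j] by blast
  qed
  then obtain z where "z \<in> S" "\<And>C. C \<in> \<U> \<Longrightarrow> z \<in> C" by blast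
  then show ?thesis by (intro bexI[of _ z]) (auto simp: \<U>_def)
qed

lemma weak_cluster_point_limit:
  fixes \<phi> :: "'e::real_normed_vector \<Rightarrow>\<^sub>L 'k::real_normed_field"
  assumes cl: "\<And>B. closed B \<Longrightarrow> eventually (\<lambda>j. \<phi> (x j) \<in> B) sequentially \<Longrightarrow> \<phi> z \<in> B"
    and lim: "(\<lambda>j. \<phi> (x j)) \<longlonglongrightarrow> l"
  shows "\<phi> z = l"
proof -
  have "dist (\<phi> z) l \<le> e" if "0 < e" for e
  proof -
    have "\<phi> z \<in> cball l e"
    proof (rule cl)
      show "eventually (\<lambda>j. \<phi> (x j) \<in> cball l e) sequentially"
        using tendstoD[OF lim that] by (rule eventually_mono) (auto simp: dist_commute)
    qed simp
    then show ?thesis by (simp add: dist_commute)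
  qed
  then show ?thesis by (metis dense_ge dist_le_zero_iff)
qed

lemma closed_norm_sets:
  "closed {z :: 'k::real_normed_vector. norm z \<le> c}" "closed {z :: 'k::real_normed_vector. c \<le> norm z}"
  by (intro closed_Collect_le continuous_intros)+

lemma functional_limit:
  fixes \<Phi> :: "nat \<Rightarrow> ('a::topological_space, 'k::real_normed_field) cfun_dual \<Rightarrow>\<^sub>L 'k"
  assumes lin: "\<And>n. functional_linear (\<Phi> n)" and bound: "\<And>n m. norm (\<Phi> n m) \<le> norm m"
    and lim: "\<And>m. (\<lambda>n. \<Phi> n m) \<longlonglongrightarrow> l m"
  obtains \<Psi> where "functional_linear \<Psi>" "\<And>m. blinfun_apply \<Psi> m = l m" "\<And>m. norm (\<Psi> m) \<le> norm m"
proof -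
  have add: "l (m + n) = l m + l n" for m n
    by (rule LIMSEQ_unique[OF lim]) (simp add: blinfun.add_right tendsto_add lim)
  have scale: "l (dual_scale c m) = c * l m" for c m
    by (rule LIMSEQ_unique[OF lim]) (simp add: functional_linear_scale[OF lin] tendsto_mult_left lim)
  have le: "norm (l m) \<le> norm m" for m
    by (rule LIMSEQ_le_const2[OF tendsto_norm[OF lim]]) (use bound in auto)
  have bl: "bounded_linear l"
  proof (rule bounded_linear_intro[where K = 1])
    show "l (r *\<^sub>R m) = r *\<^sub>R l m" for r m
      by (rule LIMSEQ_unique[OF lim]) (simp add: blinfun.scaleR_right tendsto_scaleR lim)
  qed (use add le in auto)
  show ?thesis
    by (rule that[of "Blinfun l"])
      (simp_all add: bounded_linear_Blinfun_apply[OF bl] Vector_Spaces.linear_iff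
        vector_space_dual_scale vector_space_over_itself add scale le)
qed

text \<open>
  A weak cluster point \<open>z\<close> of the functionals \<open>\<nu> j\<close> of an undominated array satisfies \<open>norm (L k z) \<le> \<delta>\<close>
  for all \<open>k\<close>, hence \<open>norm (l z) \<le> \<delta>\<close> for the limit \<open>l\<close>; but \<open>norm (l (\<nu> j)) \<ge> 3 \<delta>\<close> for all \<open>j\<close>.
\<close>

lemma weakly_compact_set_dominated:
  fixes S :: "('a::topological_space, 'k::{real_normed_field, euclidean_space}) cfun_dual set"
  assumes S: "compactin (weak_topology dual_scale) S" and H: "H \<subseteq> S"
    and C: "\<And>\<nu>. \<nu> \<in> H \<Longrightarrow> norm \<nu> \<le> C" and e: "0 < e"
  obtains u where "pos_functional u"
    "\<And>\<nu> f. \<nu> \<in> H \<Longrightarrow> norm \<langle>\<nu>, f\<rangle> \<le> u (modulus f) + e * norm f"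
proof (rule ccontr)
  note obt = that
  assume neg: "\<not> thesis"
  have undom: "\<exists>\<nu>\<in>H. \<exists>f. u (modulus f) + e * norm f < norm \<langle>\<nu>, f\<rangle>"
    if u: "pos_functional u" for u
  proof (rule ccontr)
    assume "\<not> ?thesis"
    then have "norm \<langle>\<nu>, f\<rangle> \<le> u (modulus f) + e * norm f" if "\<nu> \<in> H" for \<nu> f
      using that by (meson not_less)
    then have thesis by (rule obt[OF u])
    with neg show False ..
  qed
  show False
  proof (rule undominated_array[OF C e undom])
    fix \<nu> :: "nat \<Rightarrow> ('a, 'k) cfun_dual" and x :: "nat \<Rightarrow> nat \<Rightarrow> 'a \<Rightarrow>\<^sub>C 'k" and L l and \<delta> :: real
    assume \<delta>: "0 < \<delta>" and \<nu>: "\<And>j. \<nu> j \<in> H" and x: "\<And>k N. norm (x k N) \<le> 1"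
      and L: "\<And>k \<mu>. (\<lambda>N. \<langle>\<mu>, x k N\<rangle>) \<longlonglongrightarrow> L k \<mu>" and l: "\<And>\<mu>. (\<lambda>k. L k \<mu>) \<longlonglongrightarrow> l \<mu>"
      and small: "\<And>j k. k < j \<Longrightarrow> norm (L k (\<nu> j)) \<le> \<delta>"
      and large: "\<And>j k. j \<le> k \<Longrightarrow> 3 * \<delta> \<le> norm (L k (\<nu> j))"
    have "\<exists>\<Psi>. functional_linear \<Psi> \<and> (\<forall>m. \<Psi> m = L k m) \<and> (\<forall>m. norm (\<Psi> m) \<le> norm m)" for k
    proof -
      have "\<exists>\<Phi>. functional_linear \<Phi> \<and> (\<forall>m. \<Phi> m = \<langle>m, x k N\<rangle>)" for N
        using evaluation_functional[of "x k N"] by metis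
      then obtain \<Phi> where \<Phi>: "\<And>N. functional_linear (\<Phi> N)" "\<And>N m. blinfun_apply (\<Phi> N) m = \<langle>m, x k N\<rangle>"
        by metis
      have "norm (\<Phi> N m) \<le> norm m" for N m
        using norm_dual_pairing[of m "x k N"] x[of k N] unfolding \<Phi>(2)
        by (meson mult_left_le norm_ge_zero order_trans)
      from functional_limit[where l = "L k" and \<Phi> = \<Phi>, OF \<Phi>(1) this] L show ?thesis unfolding \<Phi>(2) by metis
    qed
    then obtain \<Psi> where \<Psi>: "\<And>k. functional_linear (\<Psi> k)" "\<And>k m. blinfun_apply (\<Psi> k) m = L k m"
        "\<And>k m. norm (blinfun_apply (\<Psi> k) m) \<le> norm m"
      by metis
    obtain \<Psi>' where \<Psi>': "functional_linear \<Psi>'" "\<And>m. blinfun_apply \<Psi>' m = l m"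
      using functional_limit[where l = l and \<Phi> = \<Psi>, OF \<Psi>(1,3)] l unfolding \<Psi>(2) by metis
    have "\<nu> j \<in> S" for j using \<nu> H by blast
    from weak_cluster_point[OF vector_space_dual_scale S this]
    obtain z where z': "\<forall>\<phi> B. functional_linear \<phi> \<longrightarrow> closed B \<longrightarrow>
        eventually (\<lambda>j. blinfun_apply \<phi> (\<nu> j) \<in> B) sequentially \<longrightarrow> \<phi> z \<in> B" ..
    note z = z'[rule_format]
    have "norm (L k z) \<le> \<delta>" for k
    proof -
      have "eventually (\<lambda>j. \<Psi> k (\<nu> j) \<in> {z. norm z \<le> \<delta>}) sequentially"
        using eventually_gt_at_top[of k] by (rule eventually_mono) (simp add: \<Psi>(2) small)
      from z[OF \<Psi>(1) closed_norm_sets(1) this] show ?thesis by (simp add: \<Psi>(2))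
    qed
    then have "norm (l z) \<le> \<delta>"
      by (intro LIMSEQ_le_const2[OF tendsto_norm[OF l]]) auto
    moreover have "3 * \<delta> \<le> norm (l z)"
    proof -
      have "3 * \<delta> \<le> norm (l (\<nu> j))" for j
        by (rule LIMSEQ_le_const[OF tendsto_norm[OF l]]) (use large in blast)
      then have "eventually (\<lambda>j. \<Psi>' (\<nu> j) \<in> {z. 3 * \<delta> \<le> norm z}) sequentially"
        by (simp add: \<Psi>'(2))
      from z[OF \<Psi>'(1) closed_norm_sets(2) this] show ?thesis by (simp add: \<Psi>'(2))
    qed
    ultimately show False using \<delta> by simp
  qed
qed

text \<open>
  The set of rows of \<open>V\<close> would contain the functionals \<open>\<nu> j\<close> of an undominated array, at points \<open>t j\<close>.
  Now the cluster points are taken on the other side: \<open>y k\<close> of the images under \<open>V\<close> of the \<open>k\<close>th line of the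
  array, \<open>w\<close> of the \<open>y k\<close>, both in \<open>C(L)\<close>, and \<open>s\<close> of the points \<open>t j\<close> in \<open>L\<close>. Then \<open>norm (w s) \<ge> 3 \<delta>\<close> as a
  limit over \<open>j\<close> and \<open>norm (y k s) \<le> \<delta>\<close> for all \<open>k\<close>.
\<close>

lemma weakly_compact_imp_nearly_dominated:
  fixes V :: "('a::topological_space \<Rightarrow>\<^sub>C 'k::{real_normed_field, euclidean_space}) \<Rightarrow>\<^sub>L ('b::topological_space \<Rightarrow>\<^sub>C 'k)"
  assumes compact: "compact (UNIV :: 'b set)" and wc: "weakly_compact_op cfun_scale cfun_scale V"
  shows "nearly_dominated V"
  unfolding nearly_dominated_def
proof (intro allI impI, rule ccontr)
  fix e :: real assume e: "0 < e"
  assume neg: "\<not> (\<exists>u. pos_functional u \<and>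
     (\<forall>f. norm (V f) \<le> u (modulus f) + e * norm f))"
  have V: "cfun_linear V"
    using wc by (simp add: weakly_compact_op_def)
  define S where "S = weak_topology (cfun_scale :: 'k \<Rightarrow> ('b \<Rightarrow>\<^sub>C 'k) \<Rightarrow> _) closure_of (V ` cball 0 1)"
  have S: "compactin (weak_topology cfun_scale) S"
    using wc by (simp add: weakly_compact_op_def S_def)
  have VS: "V f \<in> S" if "norm f \<le> 1" for f
    unfolding S_def
    by (rule subsetD[OF closure_of_subset]) (use that in \<open>auto simp: topspace_weak_topology[OF vector_space_cfun_scale]\<close>)
  define H where "H = range (\<lambda>t. cfun_adjoint V (point_eval t))"
  obtain C where C: "\<And>\<nu>. \<nu> \<in> H \<Longrightarrow> norm \<nu> \<le> C"
    using bounded_rows[OF V] unfolding H_def bounded_iff by blast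
  have undom: "\<exists>\<nu>\<in>H. \<exists>f. u (modulus f) + e * norm f < norm \<langle>\<nu>, f\<rangle>"
    if u: "pos_functional u" for u
  proof (rule ccontr)
    assume "\<not> ?thesis"
    then have "norm (apply_bcontfun (V f) t) \<le> u (modulus f) + e * norm f" for f t
      by (auto simp: H_def adjoint_point_eval[OF V] not_less)
    then have "norm (V f) \<le> u (modulus f) + e * norm f" for f
      by (rule norm_bound)
    with u neg show False by blast
  qed
  show False
  proof (rule undominated_array[OF C e undom])
    fix \<nu> :: "nat \<Rightarrow> ('a, 'k) cfun_dual" and x :: "nat \<Rightarrow> nat \<Rightarrow> 'a \<Rightarrow>\<^sub>C 'k" and L l and \<delta> :: real
    assume \<delta>: "0 < \<delta>" and \<nu>: "\<And>j. \<nu> j \<in> H" and x: "\<And>k N. norm (x k N) \<le> 1"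
      and L: "\<And>k \<mu>. (\<lambda>N. \<langle>\<mu>, x k N\<rangle>) \<longlonglongrightarrow> L k \<mu>" and l: "\<And>\<mu>. (\<lambda>k. L k \<mu>) \<longlonglongrightarrow> l \<mu>"
      and small: "\<And>j k. k < j \<Longrightarrow> norm (L k (\<nu> j)) \<le> \<delta>"
      and large: "\<And>j k. j \<le> k \<Longrightarrow> 3 * \<delta> \<le> norm (L k (\<nu> j))"
    have "\<forall>j. \<exists>t. \<nu> j = cfun_adjoint V (point_eval t)" using \<nu> by (auto simp: H_def)
    then obtain t where t: "\<And>j. \<nu> j = cfun_adjoint V (point_eval (t j))" by metis
    have "\<exists>y\<in>S. \<forall>s. apply_bcontfun y s = L k (cfun_adjoint V (point_eval s))" for k
    proof -
      from weak_cluster_point[OF vector_space_cfun_scale S VS[OF x]]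
      obtain y where y: "y \<in> S" "\<forall>\<phi> B. Vector_Spaces.linear cfun_scale (*) (blinfun_apply \<phi>) \<longrightarrow> closed B \<longrightarrow>
          eventually (\<lambda>N. blinfun_apply \<phi> (V (x k N)) \<in> B) sequentially \<longrightarrow> blinfun_apply \<phi> y \<in> B" ..
      have "apply_bcontfun y s = L k (cfun_adjoint V (point_eval s))" for s
      proof -
        have "\<langle>point_eval s, y\<rangle> = L k (cfun_adjoint V (point_eval s))"
        proof (rule weak_cluster_point_limit)
          show "(\<lambda>N. \<langle>point_eval s, V (x k N)\<rangle>) \<longlonglongrightarrow> L k (cfun_adjoint V (point_eval s))"
            using L[of "cfun_adjoint V (point_eval s)" k] by (simp add: adjoint_apply[OF V])
          show "\<langle>point_eval s, y\<rangle> \<in> B"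
            if "closed B" "eventually (\<lambda>N. \<langle>point_eval s, V (x k N)\<rangle> \<in> B) sequentially" for B
            using y(2)[rule_format, OF _ that] functional_of_dual[of "point_eval s"] by simp
        qed
        then show ?thesis by (simp add: point_eval)
      qed
      with y(1) show ?thesis by blast
    qed
    then obtain y where y: "\<And>k. y k \<in> S" "\<And>k s. apply_bcontfun (y k) s = L k (cfun_adjoint V (point_eval s))"
      by metis
    from weak_cluster_point[OF vector_space_cfun_scale S y(1)]
    obtain w where w: "\<forall>\<phi> B. Vector_Spaces.linear cfun_scale (*) (blinfun_apply \<phi>) \<longrightarrow> closed B \<longrightarrow>
        eventually (\<lambda>k. blinfun_apply \<phi> (y k) \<in> B) sequentially \<longrightarrow> blinfun_apply \<phi> w \<in> B" ..
    have w': "apply_bcontfun w s \<in> B" if "closed B" "eventually (\<lambda>k. apply_bcontfun (y k) s \<in> B) sequentially" for s B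
      using w[rule_format, of "functional_of_dual (point_eval s)" B] functional_of_dual[of "point_eval s"] that
      by (simp add: point_eval)
    have wt: "3 * \<delta> \<le> norm (apply_bcontfun w (t j))" for j
    proof -
      have "eventually (\<lambda>k. apply_bcontfun (y k) (t j) \<in> {z. 3 * \<delta> \<le> norm z}) sequentially"
        using eventually_ge_at_top[of j] by (rule eventually_mono) (use large in \<open>simp add: y(2) t[symmetric]\<close>)
      from w'[OF closed_norm_sets(2) this] show ?thesis by simp
    qed
    have yt: "norm (apply_bcontfun (y k) (t j)) \<le> \<delta>" if "k < j" for j k
      using small[OF that] by (simp add: y(2) t)
    have "filtermap t sequentially \<noteq> bot" by (simp add: filtermap_bot_iff)
    then obtain s where s: "inf (nhds s) (filtermap t sequentially) \<noteq> bot"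
      using compact[unfolded compact_filter] by auto
    have cluster: "v s \<in> B" if v: "continuous_on UNIV v" and B: "closed B" and ev: "eventually (\<lambda>j. v (t j) \<in> B) sequentially"
      for v :: "'b \<Rightarrow> real" and B
    proof (rule ccontr)
      assume "v s \<notin> B"
      have "open (v -` (- B))" by (intro open_vimage v open_Compl B)
      then have "eventually (\<lambda>r. v r \<notin> B) (nhds s)"
        using \<open>v s \<notin> B\<close> by (auto simp: eventually_nhds)
      moreover have "eventually (\<lambda>r. v r \<in> B) (filtermap t sequentially)"
        using ev by (simp add: eventually_filtermap)
      ultimately have "eventually (\<lambda>_. False) (inf (nhds s) (filtermap t sequentially))"
        unfolding eventually_inf by blast
      then show False using s by (simp add: trivial_limit_def)
    qed
    have cont: "continuous_on UNIV (\<lambda>r. norm (apply_bcontfun v r))" for v :: "'b \<Rightarrow>\<^sub>C 'k"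
      by (rule continuous_on_norm) (rule continuous_on_apply_bcontfun)
    have "norm (apply_bcontfun w s) \<in> {3 * \<delta>..}"
      by (rule cluster[OF cont]) (simp_all add: wt)
    moreover have "norm (apply_bcontfun (y k) s) \<in> {..\<delta>}" for k
    proof (rule cluster[OF cont])
      show "eventually (\<lambda>j. norm (apply_bcontfun (y k) (t j)) \<in> {..\<delta>}) sequentially"
        using eventually_gt_at_top[of k] by (rule eventually_mono) (simp add: yt)
    qed simp
    then have "eventually (\<lambda>k. apply_bcontfun (y k) s \<in> {z. norm z \<le> \<delta>}) sequentially" by simp
    from w'[OF closed_norm_sets(1) this] have "norm (apply_bcontfun w s) \<le> \<delta>" by simp
    ultimately show False using \<delta> by simp
  qed
qed

section \<open>The best approximation\<close>

lemma weak_ess_norm_le: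
  assumes "weakly_compact_op s s' W"
  shows "weak_ess_norm s s' R \<le> norm (R - W)"
  unfolding weak_ess_norm_def
  by (rule cInf_lower) (use assms in \<open>auto intro!: bdd_belowI[of _ 0]\<close>)

lemma weak_ess_norm_ge:
  assumes "vector_space s" "vector_space s'" "\<And>W. weakly_compact_op s s' W \<Longrightarrow> c \<le> norm (R - W)"
  shows "c \<le> weak_ess_norm s s' R"
  unfolding weak_ess_norm_def
  by (rule cInf_greatest) (use assms weakly_compact_op_zero[OF assms(1,2)] in auto)

lemma weak_ess_norm_approx:
  assumes "vector_space s" "vector_space s'" "weak_ess_norm s s' R < c"
  obtains W where "weakly_compact_op s s' W" "norm (R - W) < c"
  using assms weak_ess_norm_ge[of s s' c R] by (meson not_le)

text \<open>
  The distance \<open>r\<close> of the adjoint yields the dominating functionals for \<open>T\<close> up to \<open>r + \<epsilon> n\<close>, and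
  truncation yields \<open>W\<close>.
\<close>

theorem best_weakly_compact_approximation:
  fixes T :: "('a::topological_space \<Rightarrow>\<^sub>C 'k::{real_normed_field, euclidean_space}) \<Rightarrow>\<^sub>L ('b::topological_space \<Rightarrow>\<^sub>C 'k)"
  assumes compact: "compact (UNIV :: 'b set)"
    and ed: "extremally_disconnected (euclidean :: 'b topology)"
    and T: "cfun_linear T"
  shows "\<exists>W. weakly_compact_op cfun_scale cfun_scale W \<and>
    weak_ess_norm dual_scale dual_scale (cfun_adjoint T) = weak_ess_norm cfun_scale cfun_scale T \<and>
    weak_ess_norm cfun_scale cfun_scale T = norm (T - W)"
proof -
  define r where "r = weak_ess_norm dual_scale dual_scale (cfun_adjoint T)"
  define \<epsilon> where "\<epsilon> n = inverse (real (Suc n))" for n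
  have \<epsilon>: "0 < \<epsilon> n" for n by (simp add: \<epsilon>_def)
  have r: "0 \<le> r"
    unfolding r_def by (rule weak_ess_norm_ge) (simp_all add: vector_space_dual_scale)
  have "\<exists>u. pos_functional u \<and>
      (\<forall>f. norm (T f) \<le> u (modulus f) + (r + \<epsilon> n) * norm f)" for n
  proof -
    have "r < r + \<epsilon> n / 2" using \<epsilon>[of n] by simp
    then obtain Z where Z: "weakly_compact_op dual_scale dual_scale Z"
        "norm (cfun_adjoint T - Z) < r + \<epsilon> n / 2"
      unfolding r_def
      by (rule weak_ess_norm_approx[OF vector_space_dual_scale vector_space_dual_scale])
    define H where "H = range (\<lambda>t. Z (point_eval t))"
    have Zb: "norm (Z (point_eval t)) \<le> norm Z" for t
      using norm_blinfun[of Z "point_eval t"] norm_point_eval[of t, where 'k = 'k]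
      by (meson mult_left_le norm_ge_zero order_trans)
    obtain u where u: "pos_functional u"
      "\<And>\<nu> f. \<nu> \<in> H \<Longrightarrow> norm \<langle>\<nu>, f\<rangle> \<le> u (modulus f) + (\<epsilon> n / 2) * norm f"
    proof (rule weakly_compact_set_dominated)
      show "compactin (weak_topology dual_scale) (weak_topology dual_scale closure_of (Z ` cball 0 1))"
        using Z(1) by (simp add: weakly_compact_op_def)
      have "H \<subseteq> Z ` cball 0 1" by (auto simp: H_def norm_point_eval)
      also have "\<dots> \<subseteq> weak_topology dual_scale closure_of (Z ` cball 0 1)"
        by (rule closure_of_subset) (simp add: topspace_weak_topology[OF vector_space_dual_scale])
      finally show "H \<subseteq> weak_topology dual_scale closure_of (Z ` cball 0 1)" .
      show "norm \<nu> \<le> norm Z" if "\<nu> \<in> H" for \<nu> using that Zb by (auto simp: H_def)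
      show "0 < \<epsilon> n / 2" using \<epsilon>[of n] by simp
    qed blast
    have "norm (T f) \<le> u (modulus f) + (r + \<epsilon> n) * norm f" for f
    proof (rule norm_bound)
      fix t
      let ?d = "point_eval t :: ('b, 'k) cfun_dual"
      have "norm \<langle>(cfun_adjoint T - Z) ?d, f\<rangle> \<le> norm ((cfun_adjoint T - Z) ?d) * norm f"
        by (rule norm_dual_pairing)
      also have "norm ((cfun_adjoint T - Z) ?d) \<le> norm (cfun_adjoint T - Z) * norm ?d"
        by (rule norm_blinfun)
      also have "\<dots> \<le> norm (cfun_adjoint T - Z)"
        using norm_point_eval by (intro mult_left_le) auto
      also have "\<dots> \<le> r + \<epsilon> n / 2" using Z(2) by simp
      finally have "norm \<langle>(cfun_adjoint T - Z) ?d, f\<rangle> \<le> (r + \<epsilon> n / 2) * norm f"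
        by (simp add: mult_right_mono)
      moreover have "norm \<langle>Z ?d, f\<rangle> \<le> u (modulus f) + (\<epsilon> n / 2) * norm f"
        by (rule u(2)) (simp add: H_def)
      moreover have "apply_bcontfun (T f) t = \<langle>(cfun_adjoint T - Z) ?d, f\<rangle> + \<langle>Z ?d, f\<rangle>"
        by (simp add: blinfun.diff_left dual_pairing_simps adjoint_point_eval[OF T])
      ultimately show "norm (apply_bcontfun (T f) t)
          \<le> u (modulus f) + (r + \<epsilon> n) * norm f"
        using norm_triangle_ineq[of "\<langle>(cfun_adjoint T - Z) ?d, f\<rangle>" "\<langle>Z ?d, f\<rangle>"]
        by (simp add: algebra_simps)
    qed
    with u(1) show ?thesis by blast
  qed
  then obtain u where u: "\<And>n. pos_functional (u n)"
      "\<And>n f. norm (T f) \<le> u n (modulus f) + (r + \<epsilon> n) * norm f"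
    by metis
  \<comment> \<open>Partial sums make the dominating functionals increase with \<open>n\<close>.\<close>
  define v where "v n g = (\<Sum>i\<le>n. u i g)" for n g
  have v: "pos_functional (v n)" for n
    unfolding v_def by (rule pos_functional_sum) (use u in auto)
  have vmono: "v n g \<le> v (Suc n) g" and uv: "u n g \<le> v n g" if "g \<in> nonneg_bcont" for n g
    using pos_functional_nonneg[OF u(1) that] by (auto simp: v_def intro: member_le_sum)
  obtain W where W: "cfun_linear W" "norm (T - W) \<le> r"
      "\<And>n f. norm (W f) \<le> v n (modulus f) + \<epsilon> n * norm f"
  proof (rule operator_truncation[where T = T and u = v and r = r and \<epsilon> = \<epsilon>, OF ed T v vmono _ r])
    show "norm (T f) \<le> v n (modulus f) + (r + \<epsilon> n) * norm f" for n f
      using u(2)[of f n] uv[of "\<lambda>x. norm (apply_bcontfun f x)" n] by auto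
    show "\<epsilon> \<longlonglongrightarrow> 0" unfolding \<epsilon>_def by (rule LIMSEQ_inverse_real_of_nat)
  qed (use \<epsilon> less_imp_le in blast)+
  have "nearly_dominated W"
    unfolding nearly_dominated_def
  proof (intro allI impI)
    fix e :: real assume "0 < e"
    then obtain n where n: "\<epsilon> n < e" unfolding \<epsilon>_def using reals_Archimedean by blast
    have "norm (W f) \<le> v n (modulus f) + e * norm f" for f
      using W(3)[of f n] mult_right_mono[of "\<epsilon> n" e "norm f"] n by auto
    then show "\<exists>u. pos_functional u \<and> (\<forall>f. norm (W f) \<le> u (modulus f) + e * norm f)"
      using v by blast
  qed
  then have wc: "weakly_compact_op cfun_scale cfun_scale W"
    by (rule nearly_dominated_imp_weakly_compact[OF ed W(1)])
  have "r \<le> weak_ess_norm cfun_scale cfun_scale T"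
  proof (rule weak_ess_norm_ge[OF vector_space_cfun_scale vector_space_cfun_scale])
    fix V :: "('a \<Rightarrow>\<^sub>C 'k) \<Rightarrow>\<^sub>L ('b \<Rightarrow>\<^sub>C 'k)" assume V: "weakly_compact_op cfun_scale cfun_scale V"
    then have lin: "cfun_linear V"
      by (simp add: weakly_compact_op_def)
    have "weakly_compact_op dual_scale dual_scale (cfun_adjoint V)"
      by (rule nearly_dominated_imp_weakly_compact[OF ed lin weakly_compact_imp_nearly_dominated[OF compact V]])
    then have "r \<le> norm (cfun_adjoint T - cfun_adjoint V)" unfolding r_def by (rule weak_ess_norm_le)
    also have "\<dots> \<le> norm (T - V)"
      by (rule norm_blinfun_bound) (use adjoint_diff_le[OF T lin] in \<open>auto simp: blinfun.diff_left\<close>)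
    finally show "r \<le> norm (T - V)" .
  qed
  with weak_ess_norm_le[OF wc, of T] W(2) show ?thesis
    unfolding r_def[symmetric] by (intro exI[of _ W]) (use wc in auto)
qed

theorem corollary1p2:
  assumes "compact (UNIV :: 'a::t2_space set)"
    and "compact (UNIV :: 'b::t2_space set)"
    and "extremally_disconnected (euclidean :: 'b topology)"
  shows "(\<forall>T :: ('a \<Rightarrow>\<^sub>C real) \<Rightarrow>\<^sub>L ('b \<Rightarrow>\<^sub>C real).
            Vector_Spaces.linear cfun_scale cfun_scale (blinfun_apply T) \<longrightarrow>
            (\<exists>W. weakly_compact_op cfun_scale cfun_scale W \<and>
                 weak_ess_norm dual_scale dual_scale (cfun_adjoint T) =
                   weak_ess_norm cfun_scale cfun_scale T \<and>
                 weak_ess_norm cfun_scale cfun_scale T = norm (T - W))) \<and>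
         (\<forall>T :: ('a \<Rightarrow>\<^sub>C complex) \<Rightarrow>\<^sub>L ('b \<Rightarrow>\<^sub>C complex).
            Vector_Spaces.linear cfun_scale cfun_scale (blinfun_apply T) \<longrightarrow>
            (\<exists>W. weakly_compact_op cfun_scale cfun_scale W \<and>
                 weak_ess_norm dual_scale dual_scale (cfun_adjoint T) =
                   weak_ess_norm cfun_scale cfun_scale T \<and>
                 weak_ess_norm cfun_scale cfun_scale T = norm (T - W)))"
  by (intro conjI allI impI best_weakly_compact_approximation assms(2,3))

end
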